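(* For each stationary wave $u_0$ of $\tilde{\mathcal M}(1)$, there exists a sequence $u_0^\varepsilon$ which converges to $u_0$ in $C^\infty$ as $\varepsilon\to0$ such that, denoting by $u^\varepsilon$ the solution of $i\partial_tu=\Pi(|u|^2u)$ with $u^\varepsilon(0)=u_0^\varepsilon$, for every $r\in(0,1)$ there exists $t^\varepsilon$ such that the limit points in $H^{1/2}_+$ of $u^\varepsilon(t^\varepsilon)$ as $\varepsilon\to0$ are of the form $$v(z)=\alpha\,\frac{z-\overline q}{1-qz},\qquad |\alpha|=\|u_0\|_{L^2},\quad |q|=r.$$
   Context: $\mathbb S^1$ is the unit circle in $\mathbb C$, with measure $\frac{d\theta}{2\pi}$; $E_+$ denotes the subspace of elements $u$ of a space $E$ of distributions on $\mathbb S^1$ with $\hat u(k)=0$ for all $k<0$; $\Pi:L^2(\mathbb S^1)\to L^2_+$ is the orthogonal projector. $\tilde{\mathcal M}(1)$ is the set of functions $u(z)=\frac{az+b}{1-pz}$ with $a\in\mathbb C\setminus\{0\}$, $b\in\mathbb C$, $|p|<1$, $a+bp\ne0$. The stationary waves of $\tilde{\mathcal M}(1)$ are the data $u_0\in\tilde{\mathcal M}(1)$ whose solution is $e^{-i\omega t}u_0$ for some $\omega\in\mathbb R$, namely $u_0(z)=a\frac{z-\overline p}{1-pz}$ with $a\in\mathbb C\setminus\{0\}$, $|p|<1$. For each $u_0\in H^{1/2}_+$ the equation $i\partial_tu=\Pi(|u|^2u)$ has a unique solution $u\in C(\mathbb R,H^{1/2}_+)$ with $u(0)=u_0$. The family is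 indexed by small $\varepsilon>0$, and $t^\varepsilon$ depends on $\varepsilon$ and $r$. *)

theory Defs
  imports "HOL-Analysis.Analysis"
begin

text \<open>
  Functions on the unit circle are functions \<open>complex \<Rightarrow> complex\<close> of which only the values on
  \<open>sphere 0 1\<close> matter; elements of the function spaces below are representatives, to be
  identified when they agree almost everywhere.
\<close>

definition circle_measure :: "complex measure" where
  "circle_measure =
     distr (uniform_measure lborel {0..2 * pi}) (restrict_space borel (sphere 0 1)) cis"

definition fourier :: "(complex \<Rightarrow> complex) \<Rightarrow> int \<Rightarrow> complex" where
  "fourier u k = (LINT z|circle_measure. u z * z powi (- k))"

definition L2 :: "(complex \<Rightarrow> complex) set" where
  "L2 = {u \<in> borel_measurable circle_measure. integrable circle_measure (\<lambda>z. (cmod (u z))\<^sup>2)}"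

definition L2_inner :: "(complex \<Rightarrow> complex) \<Rightarrow> (complex \<Rightarrow> complex) \<Rightarrow> complex" where
  "L2_inner u v = (LINT z|circle_measure. u z * cnj (v z))"

definition L2_norm :: "(complex \<Rightarrow> complex) \<Rightarrow> real" where
  "L2_norm u = sqrt (LINT z|circle_measure. (cmod (u z))\<^sup>2)"

definition Hhalf :: "(complex \<Rightarrow> complex) set" where
  "Hhalf = {u \<in> L2. (\<lambda>k. (1 + real_of_int \<bar>k\<bar>) * (cmod (fourier u k))\<^sup>2) summable_on UNIV}"

definition Hhalf_norm :: "(complex \<Rightarrow> complex) \<Rightarrow> real" where
  "Hhalf_norm u = sqrt (\<Sum>\<^sub>\<infinity>k. (1 + real_of_int \<bar>k\<bar>) * (cmod (fourier u k))\<^sup>2)"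

definition plus_part :: "(complex \<Rightarrow> complex) set \<Rightarrow> (complex \<Rightarrow> complex) set" where
  "plus_part E = {u \<in> E. \<forall>k<0. fourier u k = 0}"

text \<open>
  The orthogonal projector of \<open>L2\<close> onto \<open>plus_part L2\<close>, as a relation, since its value is only
  determined almost everywhere.
\<close>

definition is_szego_projection :: "(complex \<Rightarrow> complex) \<Rightarrow> (complex \<Rightarrow> complex) \<Rightarrow> bool" where
  "is_szego_projection f g \<longleftrightarrow>
     f \<in> L2 \<and> g \<in> plus_part L2 \<and> (\<forall>h \<in> plus_part L2. L2_inner (\<lambda>z. f z - g z) h = 0)"

text \<open>
  \<open>u\<close> is a solution of the cubic Szego equation in the class of continuous functions of time
  with values in \<open>plus_part Hhalf\<close>. Since \<open>Hhalf\<close> embeds continuously in the sixth-power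
  integrable functions, the nonlinear term is continuous in time with values in \<open>L2\<close>, so that
  the time derivative exists in the sense of the \<open>L2\<close> norm.
\<close>

definition szego_solution :: "(complex \<Rightarrow> complex) \<Rightarrow> (real \<Rightarrow> complex \<Rightarrow> complex) \<Rightarrow> bool" where
  "szego_solution u0 u \<longleftrightarrow>
     (\<forall>t. u t \<in> plus_part Hhalf) \<and>
     (\<forall>t. ((\<lambda>s. Hhalf_norm (\<lambda>z. u s z - u t z)) \<longlongrightarrow> 0) (at t)) \<and>
     (\<forall>t. \<exists>g. is_szego_projection (\<lambda>z. of_real ((cmod (u t z))\<^sup>2) * u t z) g \<and>
        ((\<lambda>h. L2_norm (\<lambda>z. \<i> * ((u (t + h) z - u t z) / of_real h) - g z)) \<longlongrightarrow> 0) (at 0)) \<and>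
     (AE z in circle_measure. u 0 z = u0 z)"

definition M1_tilde :: "(complex \<Rightarrow> complex) set" where
  "M1_tilde = {u. \<exists>a b p. a \<noteq> 0 \<and> cmod p < 1 \<and> a + b * p \<noteq> 0 \<and>
                  (\<forall>z \<in> sphere 0 1. u z = (a * z + b) / (1 - p * z))}"

definition stationary_wave :: "(complex \<Rightarrow> complex) \<Rightarrow> bool" where
  "stationary_wave u0 \<longleftrightarrow>
     (\<exists>\<omega>::real. szego_solution u0 (\<lambda>t z. exp (- \<i> * of_real (\<omega> * t)) * u0 z))"

definition angular_deriv :: "nat \<Rightarrow> (complex \<Rightarrow> complex) \<Rightarrow> real \<Rightarrow> complex" where
  "angular_deriv n f = ((\<lambda>g \<theta>. vector_derivative g (at \<theta>)) ^^ n) (\<lambda>\<theta>. f (cis \<theta>))"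

definition smooth_on_circle :: "(complex \<Rightarrow> complex) \<Rightarrow> bool" where
  "smooth_on_circle f \<longleftrightarrow> (\<forall>n \<theta>. angular_deriv n f differentiable (at \<theta>))"

definition tendsto_smooth ::
    "('i \<Rightarrow> complex \<Rightarrow> complex) \<Rightarrow> (complex \<Rightarrow> complex) \<Rightarrow> 'i filter \<Rightarrow> bool" where
  "tendsto_smooth f g F \<longleftrightarrow>
     (\<forall>\<^sub>F i in F. smooth_on_circle (f i)) \<and> smooth_on_circle g \<and>
     (\<forall>n. uniform_limit UNIV (\<lambda>i. angular_deriv n (f i)) (angular_deriv n g) F)"

definition Hhalf_limit_point ::
    "('i \<Rightarrow> complex \<Rightarrow> complex) \<Rightarrow> 'i filter \<Rightarrow> (complex \<Rightarrow> complex) \<Rightarrow> bool" where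
  "Hhalf_limit_point w F v \<longleftrightarrow>
     v \<in> plus_part Hhalf \<and>
     (\<forall>\<delta>>0. \<exists>\<^sub>F i in F. Hhalf_norm (\<lambda>z. w i z - v z) < \<delta>)"

end

theory Submission
  imports Defs "HOL-Complex_Analysis.Complex_Analysis" "HOL-Real_Asymp.Real_Asymp"
begin

text \<open>
  A stationary wave is \<open>A (z - cnj p) / (1 - p z)\<close>; write \<open>p = s c\<close> with \<open>\<bar>c\<bar> = 1\<close>. Adding
  \<open>- \<i> \<epsilon> A cnj c / (1 - p z)\<close> gives data of the form \<open>(a z + b) / (1 - p z)\<close>, a class that is
  preserved by the flow. For given values of the mass and the momentum, which are conserved, the
  coefficients \<open>a\<close>, \<open>b\<close>, \<open>p\<close> solve a linear system; solving it explicitly shows that \<open>p\<close>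
  travels, in time of order \<open>1 / \<epsilon>\<close>, along an ellipse close to the diameter of the unit disc
  through \<open>c\<close>, so that \<open>\<bar>p\<bar>\<close> takes the value \<open>r\<close>. The conservation laws also give
  \<open>\<bar>b + a cnj p\<bar> = O(\<epsilon>)\<close> for all times, so the limit points are again stationary.

  Any solution with these data coincides with the explicit one: the difference of the two is
  estimated in \<open>L\<^sup>2\<close> by splitting it at frequency \<open>n\<close>, which costs \<open>sqrt (ln n)\<close> in the
  Gronwall exponent and gains \<open>1 / sqrt n\<close>.
\<close>

section \<open>Square-integrable functions on the circle\<close>

text \<open>For fixed \<open>Q\<close> and \<open>M\<close> the pair \<open>p\<close>,
  \<open>a * cnj b\<close> obeys a 2 x 2 system with constant coefficients and frequencies m + w, m
  - w. At a stationary wave the two frequencies collide, w = 0, but the nilpotent part of the system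
  kills the initial vector, so the growth of sin(w t) / w stays invisible. A perturbation of size
  epsilon makes both w and the vector multiplied by sin(w t) / w of order epsilon; their quotient
  does not tend to 0, so \<open>p\<close> is displaced by an amount of order one however small
  epsilon is. The factor i in the perturbation turns this displacement into the direction of c, and
  in the limit the half-length of the diameter is sqrt(s^2 + (1 - s^2)) = 1, which is why every r <
  1 is reached.

  The claim concerns every family of solutions in the class, so uniqueness has to be proved.
  Elements of \<open>Hhalf\<close> may be unbounded and the plain L2 estimate of a difference does
  not close; a pointwise bound is available for the explicit solution only, and the estimates are
  arranged to use just that one.\<close>

lemma space_circle [simp]: "space circle_measure = sphere 0 1"
  and sets_circle [measurable_cong]:
    "sets circle_measure = sets (restrict_space borel (sphere (0::complex) 1))"
  by (auto simp: circle_measure_def space_restrict_space)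

lemma measurable_cis_circle:
  "cis \<in> uniform_measure lborel {0..2 * pi} \<rightarrow>\<^sub>M restrict_space borel (sphere 0 1)"
proof (rule measurable_restrict_space2)
  show "cis \<in> space (uniform_measure lborel {0..2 * pi}) \<rightarrow> sphere 0 1"
    by (auto simp: dist_norm)
  have "cis \<in> borel_measurable lborel"
    using borel_measurable_continuous_onI[of cis] continuous_on_cis[OF continuous_on_id] by simp
  then show "cis \<in> borel_measurable (uniform_measure lborel {0..2 * pi})"
    by (simp cong: measurable_cong_sets)
qed

lemma emeasure_circle: "emeasure circle_measure (sphere 0 1) = 1"
proof -
  have "emeasure circle_measure (sphere 0 1) =
      emeasure (uniform_measure lborel {0..2 * pi})
        (cis -` sphere 0 1 \<inter> space (uniform_measure lborel {0..2 * pi}))"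
    unfolding circle_measure_def
    by (rule emeasure_distr[OF measurable_cis_circle]) (simp add: sets_restrict_space_iff)
  also have "cis -` sphere 0 1 \<inter> space (uniform_measure lborel {0..2 * pi}) = UNIV"
    by (auto simp: dist_norm)
  also have "emeasure (uniform_measure lborel {0..2 * pi}) UNIV = 1"
    using emeasure_uniform_measure_1[of lborel "{0..2*pi}"] by simp
  finally show ?thesis .
qed

interpretation circle: finite_measure circle_measure
  by standard (simp add: emeasure_circle)

lemma measure_circle [simp]: "measure circle_measure (sphere 0 1) = 1"
  by (simp add: measure_def emeasure_circle)

lemma measurable_continuous_circle:
  fixes f :: "complex \<Rightarrow> 'b::topological_space"
  shows "continuous_on (sphere 0 1) f \<Longrightarrow> f \<in> borel_measurable circle_measure"
  using borel_measurable_continuous_on_restrict[of "sphere 0 1" f]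
  by (simp cong: measurable_cong_sets add: sets_circle)

lemma integrable_circle_bounded:
  fixes f :: "complex \<Rightarrow> 'b::{banach, second_countable_topology}"
  assumes "f \<in> borel_measurable circle_measure" "\<And>z. cmod z = 1 \<Longrightarrow> norm (f z) \<le> K"
  shows "integrable circle_measure f"
  by (rule circle.integrable_const_bound[where B = K]) (use assms in \<open>auto intro!: AE_I2\<close>)

lemma integral_circle_eq:
  fixes f :: "complex \<Rightarrow> complex"
  assumes [measurable]: "f \<in> borel_measurable circle_measure"
  shows "(LINT z|circle_measure. f z) =
    (LINT x|lborel. indicator {0..2*pi} x *\<^sub>R (f (cis x) / of_real (2 * pi)))"
proof -
  have f: "f \<in> borel_measurable (restrict_space borel (sphere 0 1))"
    using assms by (simp cong: measurable_cong_sets add: sets_circle)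
  have m: "(\<lambda>x. f (cis x)) \<in> borel_measurable lborel"
    using measurable_compose[OF measurable_cis_circle f] by (simp cong: measurable_cong_sets)
  have u: "uniform_measure lborel {0..2 * pi} = density lborel (\<lambda>x. ennreal (indicator {0..2*pi} x / (2*pi)))"
    unfolding uniform_measure_def
    by (intro arg_cong2[where f = density] ext)
       (auto simp: indicator_def divide_ennreal[symmetric] ennreal_1[symmetric] simp del: ennreal_1)
  have "(LINT z|circle_measure. f z) = (LINT x|uniform_measure lborel {0..2 * pi}. f (cis x))"
    unfolding circle_measure_def by (rule integral_distr[OF measurable_cis_circle f])
  also have "\<dots> = (LINT x|lborel. (indicator {0..2*pi} x / (2*pi)) *\<^sub>R f (cis x))"
    unfolding u by (rule integral_density[OF m]) auto
  also have "\<dots> = (LINT x|lborel. indicator {0..2*pi} x *\<^sub>R (f (cis x) / of_real (2 * pi)))"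
    by (intro Bochner_Integration.integral_cong) (auto simp: scaleR_conv_of_real)
  finally show ?thesis .
qed

lemma measurable_powi_circle [measurable]: "(\<lambda>z. z powi k) \<in> borel_measurable circle_measure"
  by (rule measurable_continuous_circle) (auto intro!: continuous_intros)

lemma integral_powi_circle: "(LINT z|circle_measure. z powi k) = (if k = 0 then 1 else 0)"
proof (cases "k = 0")
  case True then show ?thesis by simp
next
  case False
  define c where "c = \<i> * of_int k"
  define F where "F = (\<lambda>x::real. exp (c * of_real x) / (c * of_real (2*pi)))"
  have c: "c \<noteq> 0" using False by (simp add: c_def)
  have cis: "cis x powi k = exp (c * of_real x)" for x
    by (simp add: cis_conv_exp exp_power_int mult_ac c_def)
  have "(LINT z|circle_measure. z powi k) =
     (LINT x|lborel. indicator {0..2*pi} x *\<^sub>R (exp (c * of_real x) / of_real (2 * pi)))"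
    by (subst integral_circle_eq) (auto simp: cis)
  also have "\<dots> = F (2*pi) - F 0"
  proof (rule integral_FTC_atLeastAtMost)
    fix x :: real
    have "((\<lambda>z. exp (c * z) / (c * of_real (2*pi))) has_field_derivative
        exp (c * of_real x) * c / (c * of_real (2 * pi))) (at (of_real x))"
      by (intro DERIV_cdivide) (auto intro!: derivative_eq_intros)
    then have "((\<lambda>z. exp (c * z) / (c * of_real (2*pi))) has_field_derivative
        exp (c * of_real x) / of_real (2 * pi)) (at (of_real x))"
      using c by simp
    then show "(F has_vector_derivative exp (c * of_real x) / of_real (2 * pi))
        (at x within {0..2*pi})"
      unfolding F_def
      by (rule has_vector_derivative_at_within[OF has_vector_derivative_real_field])
  qed (auto intro!: continuous_intros)
  also have "\<dots> = 0"
    using cis[of "2*pi"] by (simp add: F_def)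
  finally show ?thesis using False by simp
qed

lemma L2_measurable: "f \<in> L2 \<Longrightarrow> f \<in> borel_measurable circle_measure"
  and L2_integrable: "f \<in> L2 \<Longrightarrow> integrable circle_measure (\<lambda>z. (cmod (f z))\<^sup>2)"
  by (auto simp: L2_def)

lemma L2I_bounded:
  assumes "f \<in> borel_measurable circle_measure" "\<And>z. cmod z = 1 \<Longrightarrow> cmod (f z) \<le> K"
  shows "f \<in> L2"
  unfolding L2_def using assms
  by (auto intro!: integrable_circle_bounded[where K = "K\<^sup>2"] power_mono)

lemma L2I_continuous:
  assumes "continuous_on (sphere 0 1) f" shows "f \<in> L2"
proof -
  have "compact (f ` sphere 0 1)"
    using assms by (intro compact_continuous_image) auto
  then obtain K where "\<forall>z\<in>sphere 0 1. cmod (f z) \<le> K"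
    using compact_imp_bounded bounded_iff by (metis imageI)
  then show ?thesis
    using assms by (intro L2I_bounded[where K = K] measurable_continuous_circle) auto
qed

lemma L2_mult_bounded:
  assumes "f \<in> L2" "g \<in> borel_measurable circle_measure" "\<And>z. cmod z = 1 \<Longrightarrow> cmod (g z) \<le> K"
  shows "(\<lambda>z. g z * f z) \<in> L2"
proof -
  note [measurable] = assms(2) L2_measurable[OF assms(1)]
  have "integrable circle_measure (\<lambda>z. (cmod (g z * f z))\<^sup>2)"
  proof (rule Bochner_Integration.integrable_bound)
    show "integrable circle_measure (\<lambda>z. K\<^sup>2 * (cmod (f z))\<^sup>2)"
      using L2_integrable[OF assms(1)] by simp
    show "AE x in circle_measure. norm ((cmod (g x * f x))\<^sup>2) \<le> norm (K\<^sup>2 * (cmod (f x))\<^sup>2)"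
      using assms(3) by (intro AE_I2) (auto simp: norm_mult power_mult_distrib intro!: mult_right_mono power_mono)
  qed measurable
  then show ?thesis by (simp add: L2_def)
qed

lemma L2_cmult: "f \<in> L2 \<Longrightarrow> (\<lambda>z. c * f z) \<in> L2"
  by (rule L2_mult_bounded[where K = "cmod c"]) auto

lemma L2_powi_mult: "f \<in> L2 \<Longrightarrow> (\<lambda>z. f z * z powi k) \<in> L2"
  using L2_mult_bounded[of f "\<lambda>z. z powi k" 1] by (simp add: norm_power_int mult.commute)

lemma L2_powi: "(\<lambda>z. z powi k) \<in> L2"
  by (rule L2I_continuous) (auto intro!: continuous_intros)

lemma L2_const: "(\<lambda>z. c) \<in> L2"
  by (rule L2I_continuous) auto

lemma sum_sq_le: "(a + b)\<^sup>2 \<le> 2 * a\<^sup>2 + 2 * b\<^sup>2" for a b :: real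
  using sum_squares_bound[of a b] by (simp add: power2_sum)

lemma cmod_add_sq_le: "(cmod (a + b))\<^sup>2 \<le> 2 * (cmod a)\<^sup>2 + 2 * (cmod b)\<^sup>2"
  by (rule order_trans[OF power_mono[OF norm_triangle_ineq] sum_sq_le]) simp

lemma L2_add:
  assumes "f \<in> L2" "g \<in> L2" shows "(\<lambda>z. f z + g z) \<in> L2"
proof -
  note [measurable] = L2_measurable[OF assms(1)] L2_measurable[OF assms(2)]
  have "integrable circle_measure (\<lambda>z. (cmod (f z + g z))\<^sup>2)"
  proof (rule Bochner_Integration.integrable_bound)
    show "integrable circle_measure (\<lambda>z. 2 * (cmod (f z))\<^sup>2 + 2 * (cmod (g z))\<^sup>2)"
      using L2_integrable assms by simp
  qed (auto simp: cmod_add_sq_le intro!: AE_I2)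
  then show ?thesis by (simp add: L2_def)
qed

lemma L2_diff: "f \<in> L2 \<Longrightarrow> g \<in> L2 \<Longrightarrow> (\<lambda>z. f z - g z) \<in> L2"
  using L2_add[of f "\<lambda>z. (-1) * g z"] L2_cmult[of g "-1"] by simp

lemma L2_sum: "(\<And>i. i \<in> I \<Longrightarrow> f i \<in> L2) \<Longrightarrow> (\<lambda>z. \<Sum>i\<in>I. f i z) \<in> L2"
proof (induction I rule: infinite_finite_induct)
  case (insert x F)
  then show ?case using L2_add[of "f x" "\<lambda>z. \<Sum>i\<in>F. f i z"] by simp
qed (auto simp: L2_const)

lemma L2_cnj: "f \<in> L2 \<Longrightarrow> (\<lambda>z. cnj (f z)) \<in> L2"
  unfolding L2_def
  using borel_measurable_continuous_onI[of cnj] measurable_compose[of f circle_measure borel cnj borel]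
  by (auto intro!: continuous_intros)

lemma L2_norm_nonneg [simp]: "0 \<le> L2_norm f"
  by (simp add: L2_norm_def)

lemma L2_norm_sq: "(L2_norm f)\<^sup>2 = (LINT z|circle_measure. (cmod (f z))\<^sup>2)"
  by (simp add: L2_norm_def)

lemma L2_norm_le_bound:
  assumes "\<And>z. cmod z = 1 \<Longrightarrow> cmod (f z) \<le> K"
  shows "L2_norm f \<le> K"
proof -
  have K: "0 \<le> K" using order_trans[OF norm_ge_zero assms[of 1]] by simp
  have "(LINT z|circle_measure. (cmod (f z))\<^sup>2) \<le> (LINT z|circle_measure. K\<^sup>2)"
  \<comment> \<open>Without measurability of \<open>f\<close> the integral may be the default value
    0, which also satisfies the bound.\<close>
  proof (cases "integrable circle_measure (\<lambda>z. (cmod (f z))\<^sup>2)")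
    case True
    then show ?thesis
      by (rule integral_mono) (use assms in \<open>auto intro!: power_mono\<close>)
  qed (use K in \<open>simp add: not_integrable_integral_eq\<close>)
  then show ?thesis using K real_sqrt_le_mono by (fastforce simp: L2_norm_def)
qed

lemma L2_mult_integrable:
  assumes "f \<in> L2" "g \<in> L2" shows "integrable circle_measure (\<lambda>z. f z * g z)"
proof (rule Bochner_Integration.integrable_bound)
  show "integrable circle_measure (\<lambda>z. (cmod (f z))\<^sup>2 + (cmod (g z))\<^sup>2)"
    using L2_integrable assms by simp
  show "AE z in circle_measure. norm (f z * g z) \<le> norm ((cmod (f z))\<^sup>2 + (cmod (g z))\<^sup>2)"
  proof (intro AE_I2)
    fix z
    have "0 \<le> cmod (f z) * cmod (g z)" by simp
    then have "cmod (f z) * cmod (g z) \<le> (cmod (f z))\<^sup>2 + (cmod (g z))\<^sup>2"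
      using sum_squares_bound[of "cmod (f z)" "cmod (g z)"] by linarith
    then show "norm (f z * g z) \<le> norm ((cmod (f z))\<^sup>2 + (cmod (g z))\<^sup>2)"
      by (simp add: norm_mult)
  qed
  show "(\<lambda>z. f z * g z) \<in> borel_measurable circle_measure"
    using L2_measurable assms by measurable
qed

lemma L2_cauchy_schwarz:
  assumes "f \<in> L2" "g \<in> L2"
  shows "(LINT z|circle_measure. cmod (f z) * cmod (g z)) \<le> L2_norm f * L2_norm g"
proof -
  note [measurable] = L2_measurable[OF assms(1)] L2_measurable[OF assms(2)]
  define I where "I = (LINT z|circle_measure. cmod (f z) * cmod (g z))"
  have I: "integrable circle_measure (\<lambda>z. cmod (f z) * cmod (g z))"
    using integrable_norm[OF L2_mult_integrable[OF assms]] by (simp add: norm_mult)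
  have I0: "0 \<le> I" unfolding I_def by (intro integral_nonneg_AE) auto
  have e: "(\<integral>\<^sup>+z. ennreal (cmod (h z)) ^ 2 \<partial>circle_measure) = ennreal ((L2_norm h)\<^sup>2)"
    if "h \<in> L2" for h
    unfolding L2_norm_sq
    using nn_integral_eq_integral[OF L2_integrable[OF that]] by (simp add: ennreal_power)
  have "(\<integral>\<^sup>+z. ennreal (cmod (f z)) * ennreal (cmod (g z)) \<partial>circle_measure)\<^sup>2 \<le>
      (\<integral>\<^sup>+z. ennreal (cmod (f z)) ^ 2 \<partial>circle_measure) * (\<integral>\<^sup>+z. ennreal (cmod (g z)) ^ 2 \<partial>circle_measure)"
    by (rule Cauchy_Schwarz_nn_integral) measurable
  also have "(\<integral>\<^sup>+z. ennreal (cmod (f z)) * ennreal (cmod (g z)) \<partial>circle_measure) = ennreal I"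
    unfolding I_def using nn_integral_eq_integral[OF I] by (simp add: ennreal_mult')
  finally have "ennreal (I\<^sup>2) \<le> ennreal ((L2_norm f)\<^sup>2 * (L2_norm g)\<^sup>2)"
    unfolding e[OF assms(1)] e[OF assms(2)] using I0 by (simp add: ennreal_power ennreal_mult)
  then have "I\<^sup>2 \<le> (L2_norm f * L2_norm g)\<^sup>2"
    by (simp add: ennreal_le_iff power_mult_distrib)
  then show ?thesis
    unfolding I_def[symmetric] using L2_norm_nonneg by (metis mult_nonneg_nonneg power2_le_imp_le)
qed

lemma L2_inner_le:
  assumes "f \<in> L2" "g \<in> L2" shows "cmod (L2_inner f g) \<le> L2_norm f * L2_norm g"
proof -
  have "cmod (L2_inner f g) \<le> (LINT z|circle_measure. norm (f z * cnj (g z)))"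
    unfolding L2_inner_def by (rule integral_norm_bound)
  also have "\<dots> \<le> L2_norm f * L2_norm g"
    using L2_cauchy_schwarz[OF assms] by (simp add: norm_mult)
  finally show ?thesis .
qed

lemma L2_inner_integrable: "f \<in> L2 \<Longrightarrow> g \<in> L2 \<Longrightarrow> integrable circle_measure (\<lambda>z. f z * cnj (g z))"
  by (intro L2_mult_integrable L2_cnj)

lemma L2_inner_add_left:
  "f \<in> L2 \<Longrightarrow> g \<in> L2 \<Longrightarrow> h \<in> L2 \<Longrightarrow> L2_inner (\<lambda>z. f z + g z) h = L2_inner f h + L2_inner g h"
  unfolding L2_inner_def by (simp add: L2_inner_integrable distrib_right)

lemma L2_inner_diff_left:
  "f \<in> L2 \<Longrightarrow> g \<in> L2 \<Longrightarrow> h \<in> L2 \<Longrightarrow> L2_inner (\<lambda>z. f z - g z) h = L2_inner f h - L2_inner g h"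
  unfolding L2_inner_def by (simp add: L2_inner_integrable left_diff_distrib)

lemma L2_inner_cmult_left: "L2_inner (\<lambda>z. c * f z) h = c * L2_inner f h"
  unfolding L2_inner_def by (simp add: mult.assoc)

lemma L2_inner_cnj: "L2_inner g f = cnj (L2_inner f g)"
  unfolding L2_inner_def
  using Bochner_Integration.integral_cnj[of circle_measure "\<lambda>z. f z * cnj (g z)"]
  by (simp add: mult.commute)

lemma L2_inner_self: "L2_inner f f = of_real ((L2_norm f)\<^sup>2)"
  unfolding L2_inner_def L2_norm_sq integral_complex_of_real[symmetric]
  by (simp only: complex_norm_square)

lemma L2_inner_sum_left:
  "(\<And>i. i \<in> I \<Longrightarrow> f i \<in> L2) \<Longrightarrow> h \<in> L2 \<Longrightarrow>
     L2_inner (\<lambda>z. \<Sum>i\<in>I. f i z) h = (\<Sum>i\<in>I. L2_inner (f i) h)"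
  unfolding L2_inner_def by (simp add: L2_inner_integrable sum_distrib_right)

lemma L2_norm_add_sq:
  assumes "f \<in> L2" "g \<in> L2"
  shows "(L2_norm (\<lambda>z. f z + g z))\<^sup>2 = (L2_norm f)\<^sup>2 + 2 * Re (L2_inner g f) + (L2_norm g)\<^sup>2"
proof -
  let ?s = "\<lambda>z. f z + g z"
  have "L2_inner f ?s = cnj (L2_inner f f + L2_inner g f)"
    using assms L2_inner_cnj[of f ?s] by (simp add: L2_inner_add_left)
  moreover have "L2_inner g ?s = cnj (cnj (L2_inner g f) + L2_inner g g)"
    using assms L2_inner_cnj[of g ?s] L2_inner_cnj[of f g] by (simp add: L2_inner_add_left)
  ultimately have "L2_inner ?s ?s = cnj (L2_inner f f + L2_inner g f) + (L2_inner g f + cnj (L2_inner g g))"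
    using L2_inner_add_left[OF assms L2_add[OF assms]] by simp
  then have "complex_of_real ((L2_norm ?s)\<^sup>2) =
      complex_of_real ((L2_norm f)\<^sup>2 + 2 * Re (L2_inner g f) + (L2_norm g)\<^sup>2)"
    by (simp only: L2_inner_self) (simp add: complex_eq_iff)
  then show ?thesis unfolding of_real_eq_iff .
qed

lemma L2_norm_cmult: "L2_norm (\<lambda>z. c * f z) = cmod c * L2_norm f"
  by (simp add: L2_norm_def norm_mult power_mult_distrib real_sqrt_mult)

lemma L2_norm_triangle:
  assumes "f \<in> L2" "g \<in> L2" shows "L2_norm (\<lambda>z. f z + g z) \<le> L2_norm f + L2_norm g"
proof (rule power2_le_imp_le)
  have "Re (L2_inner g f) \<le> L2_norm g * L2_norm f"
    using L2_inner_le[of g f] assms complex_Re_le_cmod order_trans by blast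
  then show "(L2_norm (\<lambda>z. f z + g z))\<^sup>2 \<le> (L2_norm f + L2_norm g)\<^sup>2"
    using assms by (simp add: L2_norm_add_sq power2_sum mult_ac)
qed simp

lemma L2_norm_triangle_diff:
  assumes "f \<in> L2" "g \<in> L2" shows "L2_norm (\<lambda>z. f z - g z) \<le> L2_norm f + L2_norm g"
  using L2_norm_triangle[of f "\<lambda>z. (-1) * g z"] L2_cmult[of g "-1"] L2_norm_cmult[of "-1" g] assms
  by simp

lemma L2_norm_eq_0_iff:
  assumes "f \<in> L2" shows "L2_norm f = 0 \<longleftrightarrow> (AE z in circle_measure. f z = 0)"
  using integral_nonneg_eq_0_iff_AE[OF L2_integrable[OF assms]] by (simp add: L2_norm_def)

section \<open>Fourier coefficients as inner products\<close>

lemma cnj_eq_inverse: "cmod z = 1 \<Longrightarrow> cnj z = inverse z"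
  by (rule inverse_unique[symmetric]) (simp add: complex_norm_square[symmetric])

lemma fourier_eq_inner: "fourier f k = L2_inner f (\<lambda>z. z powi k)"
  unfolding fourier_def L2_inner_def
  by (intro Bochner_Integration.integral_cong)
    (auto simp: cnj_eq_inverse power_int_minus power_int_inverse)

lemma fourier_add: "f \<in> L2 \<Longrightarrow> g \<in> L2 \<Longrightarrow> fourier (\<lambda>z. f z + g z) k = fourier f k + fourier g k"
  by (simp add: fourier_eq_inner L2_inner_add_left L2_powi)

lemma fourier_diff: "f \<in> L2 \<Longrightarrow> g \<in> L2 \<Longrightarrow> fourier (\<lambda>z. f z - g z) k = fourier f k - fourier g k"
  by (simp add: fourier_eq_inner L2_inner_diff_left L2_powi)

lemma fourier_cmult: "fourier (\<lambda>z. c * f z) k = c * fourier f k"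
  by (simp add: fourier_eq_inner L2_inner_cmult_left)

lemma fourier_sum:
  "(\<And>i. i \<in> I \<Longrightarrow> f i \<in> L2) \<Longrightarrow> fourier (\<lambda>z. \<Sum>i\<in>I. f i z) k = (\<Sum>i\<in>I. fourier (f i) k)"
  by (simp add: fourier_eq_inner L2_inner_sum_left L2_powi)

lemma fourier_powi_mult: "fourier (\<lambda>z. z powi j * f z) k = fourier f (k - j)"
  unfolding fourier_def
proof (intro Bochner_Integration.integral_cong refl)
  fix z :: complex assume "z \<in> space circle_measure"
  then have "z \<noteq> 0" by auto
  then show "z powi j * f z * z powi (- k) = f z * z powi - (k - j)"
    by (simp add: power_int_diff power_int_minus divide_simps)
qed

lemma fourier_powi: "fourier (\<lambda>z. z powi j) k = (if j = k then 1 else 0)"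
  using fourier_powi_mult[of j "\<lambda>_. 1" k] by (simp add: fourier_def integral_powi_circle)

lemma fourier_cong_AE:
  assumes "AE z in circle_measure. f z = g z"
    "f \<in> borel_measurable circle_measure" "g \<in> borel_measurable circle_measure"
  shows "fourier f k = fourier g k"
  unfolding fourier_def using assms by (intro integral_cong_AE) auto

lemma L2_norm_powi: "L2_norm (\<lambda>z. z powi k) = 1"
proof -
  have "L2_norm (\<lambda>z. z powi k) = L2_norm (\<lambda>z. 1)"
    unfolding L2_norm_def
    by (intro arg_cong[where f = sqrt] Bochner_Integration.integral_cong) (auto simp: norm_power_int)
  then show ?thesis by (simp add: L2_norm_def)
qed

lemma cmod_fourier_le: "f \<in> L2 \<Longrightarrow> cmod (fourier f k) \<le> L2_norm f"
  using L2_inner_le[of f "\<lambda>z. z powi k"] by (simp add: fourier_eq_inner L2_powi L2_norm_powi)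

lemma plus_partD: "f \<in> plus_part E \<Longrightarrow> f \<in> E" "f \<in> plus_part E \<Longrightarrow> k < 0 \<Longrightarrow> fourier f k = 0"
  by (auto simp: plus_part_def)

lemma plus_part_L2_diff:
  "f \<in> plus_part L2 \<Longrightarrow> g \<in> plus_part L2 \<Longrightarrow> (\<lambda>z. f z - g z) \<in> plus_part L2"
  by (auto simp: plus_part_def L2_diff fourier_diff)

section \<open>Completeness of the trigonometric system\<close>

text \<open>Trigonometric polynomials, encoded as the algebra generated by \<open>z\<close> and
  \<open>cnj z\<close> rather than by coefficient lists: polynomials in the real coordinates, as
  delivered by Stone-Weierstrass, fall into it by induction, and \<open>trig_inner_zero\<close> is
  again an induction over the generators.\<close>

inductive trig :: "(complex \<Rightarrow> complex) \<Rightarrow> bool" where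
  trig_const: "trig (\<lambda>z. c)"
| trig_id: "trig (\<lambda>z. z)"
| trig_cnj: "trig cnj"
| trig_add: "trig f \<Longrightarrow> trig g \<Longrightarrow> trig (\<lambda>z. f z + g z)"
| trig_mult: "trig f \<Longrightarrow> trig g \<Longrightarrow> trig (\<lambda>z. f z * g z)"

lemma continuous_trig: "trig f \<Longrightarrow> continuous_on S f"
  by (induction rule: trig.induct) (auto intro!: continuous_intros)

lemma trig_L2: "trig f \<Longrightarrow> f \<in> L2"
  by (intro L2I_continuous continuous_trig)

lemma trig_bounded:
  assumes "trig f" shows "\<exists>K. \<forall>z. cmod z = 1 \<longrightarrow> cmod (f z) \<le> K"
proof -
  have "bounded (f ` sphere 0 1)"
    by (intro compact_imp_bounded compact_continuous_image continuous_trig assms compact_sphere)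
  then obtain K where "\<And>y. y \<in> f ` sphere 0 1 \<Longrightarrow> cmod y \<le> K"
    unfolding bounded_iff by blast
  then show ?thesis by (intro exI[of _ K]) simp
qed

lemma L2_mult_trig: "h \<in> L2 \<Longrightarrow> trig f \<Longrightarrow> (\<lambda>z. h z * cnj (f z)) \<in> L2"
  using trig_bounded[of f] L2_mult_bounded[OF _ L2_measurable[OF L2_cnj[OF trig_L2]], of h f]
  by (auto simp: mult.commute)

lemma real_polynomial_trig:
  fixes f :: "complex \<Rightarrow> real"
  assumes "real_polynomial_function f"
  shows "trig (\<lambda>z. of_real (f z))"
  using assms
proof (induction rule: real_polynomial_function.induct)
  case (linear f)
  interpret f: bounded_linear f by fact
  \<comment> \<open>A real-linear form is determined by its values at 1 and \<open>\<i>\<close>;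
    this is its coefficient on \<open>z\<close>, and the coefficient on \<open>cnj z\<close> is the
    conjugate.\<close>
  define \<alpha> where "\<alpha> = (of_real (f 1) - \<i> * of_real (f \<i>)) / 2"
  have "of_real (f z) = \<alpha> * z + cnj \<alpha> * cnj z" for z
  proof -
    have "z = Re z *\<^sub>R 1 + Im z *\<^sub>R \<i>"
      by (simp add: complex_eq_iff)
    then have "f z = Re z * f 1 + Im z * f \<i>"
      by (metis f.add f.scaleR real_scaleR_def)
    then show ?thesis
      by (simp add: \<alpha>_def complex_eq_iff field_simps)
  qed
  then show ?case by (simp add: trig.intros)
qed (auto intro: trig.intros)

lemma polynomial_trig:
  fixes f :: "complex \<Rightarrow> complex"
  assumes "polynomial_function f"
  shows "trig f"
proof -
  have "real_polynomial_function (Re \<circ> f)" "real_polynomial_function (Im \<circ> f)"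
    using assms bounded_linear_Re bounded_linear_Im unfolding polynomial_function_def by blast+
  then have "trig (\<lambda>z. of_real ((Re \<circ> f) z) + \<i> * of_real ((Im \<circ> f) z))"
    by (intro trig.intros real_polynomial_trig)
  then show ?thesis
    by (simp flip: complex_eq)
qed

section \<open>Density of the trigonometric polynomials in \<open>L2\<close>\<close>

definition approximable :: "(complex \<Rightarrow> complex) \<Rightarrow> bool" where
  "approximable f \<longleftrightarrow> f \<in> L2 \<and> (\<forall>e>0. \<exists>g. trig g \<and> L2_norm (\<lambda>z. f z - g z) < e)"

lemma approximable_closed:
  assumes "f \<in> L2" "\<And>e. e > 0 \<Longrightarrow> \<exists>g. approximable g \<and> L2_norm (\<lambda>z. f z - g z) < e"
  shows "approximable f"
  unfolding approximable_def
proof (intro conjI allI impI)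
  fix e :: real assume "e > 0"
  then obtain g where g: "approximable g" "L2_norm (\<lambda>z. f z - g z) < e / 2"
    using assms(2)[of "e/2"] by auto
  then obtain h where h: "trig h" "L2_norm (\<lambda>z. g z - h z) < e / 2"
    using \<open>e > 0\<close> unfolding approximable_def by (meson half_gt_zero)
  have "L2_norm (\<lambda>z. (f z - g z) + (g z - h z)) \<le> L2_norm (\<lambda>z. f z - g z) + L2_norm (\<lambda>z. g z - h z)"
    using assms(1) g h by (intro L2_norm_triangle L2_diff) (auto simp: approximable_def trig_L2)
  then show "\<exists>g. trig g \<and> L2_norm (\<lambda>z. f z - g z) < e"
    using g h by (intro exI[of _ h]) auto
qed fact

lemma approximable_add:
  assumes "approximable f" "approximable g" shows "approximable (\<lambda>z. f z + g z)"
  unfolding approximable_def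
proof (intro conjI allI impI)
  have L2: "f \<in> L2" "g \<in> L2" using assms by (auto simp: approximable_def)
  then show "(\<lambda>z. f z + g z) \<in> L2" by (rule L2_add)
  fix e :: real assume "e > 0"
  then obtain f' g' where h: "trig f'" "L2_norm (\<lambda>z. f z - f' z) < e / 2"
     "trig g'" "L2_norm (\<lambda>z. g z - g' z) < e / 2"
    using assms unfolding approximable_def by (meson half_gt_zero)
  have "L2_norm (\<lambda>z. (f z - f' z) + (g z - g' z)) \<le> L2_norm (\<lambda>z. f z - f' z) + L2_norm (\<lambda>z. g z - g' z)"
    using L2 h by (intro L2_norm_triangle L2_diff) (auto simp: trig_L2)
  moreover have "(\<lambda>z. (f z - f' z) + (g z - g' z)) = (\<lambda>z. (f z + g z) - (f' z + g' z))"
    by auto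
  ultimately show "\<exists>h. trig h \<and> L2_norm (\<lambda>z. f z + g z - h z) < e"
    using h by (intro exI[of _ "\<lambda>z. f' z + g' z"]) (auto intro: trig_add)
qed

lemma approximable_cmult:
  assumes "approximable f" shows "approximable (\<lambda>z. c * f z)"
  unfolding approximable_def
proof (intro conjI allI impI)
  show "(\<lambda>z. c * f z) \<in> L2" using assms by (auto simp: approximable_def L2_cmult)
  fix e :: real assume "e > 0"
  then have "e / (cmod c + 1) > 0" by (intro divide_pos_pos) (auto simp: add_nonneg_pos)
  then obtain g where g: "trig g" "L2_norm (\<lambda>z. f z - g z) < e / (cmod c + 1)"
    using assms unfolding approximable_def by meson
  have "L2_norm (\<lambda>z. c * (f z - g z)) \<le> (cmod c + 1) * L2_norm (\<lambda>z. f z - g z)"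
    unfolding L2_norm_cmult by (intro mult_right_mono) auto
  also have "\<dots> < e"
    using g(2) by (subst (asm) pos_less_divide_eq) (auto simp: add_nonneg_pos mult.commute)
  finally show "\<exists>h. trig h \<and> L2_norm (\<lambda>z. c * f z - h z) < e"
    using g by (intro exI[of _ "\<lambda>z. c * g z"]) (auto intro: trig.intros simp: right_diff_distrib)
qed

lemma approximable_trig: "trig f \<Longrightarrow> approximable f"
  unfolding approximable_def using trig_L2 by (auto intro!: exI[of _ f] simp: L2_norm_def)

lemma approximable_sum:
  "(\<And>i. i \<in> I \<Longrightarrow> approximable (f i)) \<Longrightarrow> approximable (\<lambda>z. \<Sum>i\<in>I. f i z)"
proof (induction I rule: infinite_finite_induct)
  case (insert x F)
  then show ?case using approximable_add[of "f x" "\<lambda>z. \<Sum>i\<in>F. f i z"] by simp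
qed (simp_all add: approximable_trig trig_const)

lemma approximable_continuous:
  assumes "continuous_on (sphere 0 1) f" shows "approximable f"
proof (rule approximable_closed)
  show "f \<in> L2" using assms by (rule L2I_continuous)
  fix e :: real assume e: "e > 0"
  then obtain g where g: "polynomial_function g" "\<forall>z\<in>sphere 0 1. norm (f z - g z) < e / 2"
    using Stone_Weierstrass_polynomial_function[OF compact_sphere assms, of "e/2"] by auto
  have "L2_norm (\<lambda>z. f z - g z) \<le> e / 2"
    using g by (intro L2_norm_le_bound) (auto intro!: less_imp_le)
  then show "\<exists>g. approximable g \<and> L2_norm (\<lambda>z. f z - g z) < e"
    using approximable_trig[OF polynomial_trig[OF g(1)]] e by (intro exI[of _ g]) auto
qed

text \<open>Regularity encloses \<open>A\<close> between a compact \<open>K\<close> and an open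
  \<open>U\<close>; a Urysohn function that is 1 on \<open>K\<close> and 0 off \<open>U\<close>
  differs from the indicator only on \<open>U - K\<close>, by at most 1.\<close>

lemma approximable_indicator:
  assumes A: "A \<in> sets circle_measure"
  shows "approximable (\<lambda>z. indicator A z)"
proof (rule approximable_closed)
  show "(\<lambda>z. indicator A z) \<in> L2"
    using A by (intro L2I_bounded[where K = 1]) (auto simp: indicator_def)
  fix e :: real assume e: "e > 0"
  \<comment> \<open>Regularity is stated for Borel measures on the whole plane, hence the
    push-forward along the inclusion of the circle.\<close>
  define \<mu> where "\<mu> = distr circle_measure borel (\<lambda>z. z)"
  have m: "(\<lambda>z. z) \<in> measurable circle_measure borel"
    by (rule measurable_continuous_circle) auto
  interpret \<mu>: finite_measure \<mu>
    unfolding \<mu>_def using m by (rule circle.finite_measure_distr)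
  have sets: "sets \<mu> = sets borel" and space: "space \<mu> = UNIV" by (auto simp: \<mu>_def)
  have AB: "A \<in> sets borel"
    using A by (simp add: sets_circle sets_restrict_space_iff)
  \<comment> \<open>The squared error is at most the measure of \<open>U - K\<close>, which is below
    \<open>2 * d\<close>, hence below \<open>e\<^sup>2\<close>.\<close>
  define d where "d = e\<^sup>2 / 4"
  have d: "d > 0" using e by (simp add: d_def)
  have fin: "emeasure \<mu> (space \<mu>) \<noteq> \<infinity>" "emeasure \<mu> A \<noteq> \<infinity>" by simp_all
  obtain K where K: "K \<subseteq> A" "compact K" "emeasure \<mu> A < emeasure \<mu> K + ennreal d"
    using SUP_approx_ennreal[OF d _ inner_regular[OF sets fin(1) AB] fin(2)]
    by (metis (mono_tags, lifting) compact_empty empty_Collect_eq empty_subsetI mem_Collect_eq)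
  obtain U where U: "A \<subseteq> U" "open U" "emeasure \<mu> U < emeasure \<mu> A + ennreal d"
    using INF_approx_ennreal[OF _ outer_regular[OF sets fin(1) AB] fin(2), of d] d by auto
  have KB: "K \<in> sets \<mu>" "U \<in> sets \<mu>" "A \<in> sets \<mu>" using K U AB by (auto simp: sets compact_imp_closed)
  have "measure \<mu> A < measure \<mu> K + d" "measure \<mu> U < measure \<mu> A + d"
    using K(3) U(3) d by (auto simp: \<mu>.emeasure_eq_measure simp flip: ennreal_plus intro!: ennreal_less_iff[THEN iffD1])
  then have UK: "measure \<mu> (U - K) < 2 * d"
    using KB K U by (subst \<mu>.finite_measure_Diff) auto
  obtain f :: "complex \<Rightarrow> real" where f: "continuous_on UNIV f" "\<And>x. f x \<in> closed_segment 1 0"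
     "\<And>x. x \<in> K \<Longrightarrow> f x = 1" "\<And>x. x \<in> - U \<Longrightarrow> f x = 0"
    using Urysohn_local[of UNIV K "-U" 1 "0::real"] K U by (auto simp: compact_imp_closed)
  have f01: "0 \<le> f x" "f x \<le> 1" for x
    using f(2)[of x] by (auto simp: closed_segment_eq_real_ivl)
  have cf: "continuous_on (sphere 0 1) (\<lambda>z. complex_of_real (f z))"
    using f(1) continuous_on_subset[of UNIV f] by (intro continuous_intros) auto
  have UKm: "U - K \<in> sets borel" using KB sets by auto
  have ind: "(\<lambda>z. indicator (U - K) z :: real) \<in> borel_measurable circle_measure"
    using measurable_compose[OF m borel_measurable_indicator[OF UKm]] .
  have [measurable]: "f \<in> borel_measurable circle_measure"
    using f(1) continuous_on_subset by (intro measurable_continuous_circle) auto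
  have "(L2_norm (\<lambda>z. indicator A z - of_real (f z)))\<^sup>2 \<le> (LINT z|circle_measure. indicator (U - K) z)"
    unfolding L2_norm_sq
  proof (rule integral_mono)
    show "integrable circle_measure (\<lambda>z. (cmod (indicator A z - of_real (f z)))\<^sup>2)"
      by (rule L2_integrable, rule L2_diff, rule L2I_bounded[where K = 1])
        (use A in \<open>auto simp: indicator_def L2I_continuous[OF cf]\<close>)
    show "integrable circle_measure (\<lambda>z. indicator (U - K) z :: real)"
      by (rule integrable_circle_bounded[where K = 1, OF ind]) (auto simp: indicator_def)
    fix z
    consider "z \<in> K" | "z \<notin> U" | "z \<in> U - K" by auto
    then show "(cmod (indicator A z - of_real (f z)))\<^sup>2 \<le> indicator (U - K) z"
    proof cases
      case 3
      have "cmod (indicator A z - of_real (f z)) = \<bar>indicator A z - f z\<bar>"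
        by (metis norm_of_real of_real_diff of_real_indicator)
      also have "\<dots> \<le> 1" using f01[of z] by (auto simp: indicator_def)
      finally show ?thesis using 3 by (simp add: power_le_one)
    qed (use K U f in \<open>auto simp: indicator_def\<close>)
  qed
  also have "(LINT z|circle_measure. indicator (U - K) z :: real) = (LINT z|\<mu>. indicator (U - K) z)"
    unfolding \<mu>_def using m UKm by (intro integral_distr[symmetric]) auto
  also have "\<dots> = measure \<mu> (U - K)"
    using KB by (simp add: space)
  also have "\<dots> < e\<^sup>2" using UK zero_less_power[OF e, of 2] unfolding d_def by linarith
  finally have "L2_norm (\<lambda>z. indicator A z - of_real (f z)) < e"
    using e power2_less_imp_less by fastforce
  then show "\<exists>g. approximable g \<and> L2_norm (\<lambda>z. indicator A z - g z) < e"
    using approximable_continuous[OF cf] by blast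
qed

lemma approximable_simple:
  assumes f: "simple_function circle_measure f"
  shows "approximable f"
proof -
  have fin: "finite (f ` space circle_measure)" using f by (simp add: simple_function_def)
  define g where "g = (\<lambda>z. \<Sum>y\<in>f ` sphere 0 1. y * indicator (f -` {y} \<inter> sphere 0 1) z)"
  have "approximable g"
    unfolding g_def using f
    by (intro approximable_sum approximable_cmult approximable_indicator)
       (auto simp: simple_function_def)
  moreover have "f z = g z" if "cmod z = 1" for z
  proof -
    have "g z = (\<Sum>y\<in>f ` sphere 0 1. if y = f z then y else 0)"
      unfolding g_def using that by (intro sum.cong) (auto simp: indicator_def)
    also have "\<dots> = f z" using that fin by auto
    finally show ?thesis by simp
  qed
  moreover have "f \<in> L2"
  proof -
    have "finite (f ` sphere 0 1)" using fin by simp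
    then obtain K where "\<forall>y\<in>f ` sphere 0 1. cmod y \<le> K"
      using finite_imp_bounded bounded_iff by metis
    then show ?thesis
      using f by (intro L2I_bounded[where K = K]) (auto intro: borel_measurable_simple_function)
  qed
  ultimately show ?thesis
    by (intro approximable_closed exI[of _ g])
       (auto intro!: le_less_trans[OF L2_norm_le_bound[where K = 0]])
qed

lemma approximable_L2:
  assumes f: "f \<in> L2" shows "approximable f"
proof (rule approximable_closed[OF f])
  fix e :: real assume e: "e > 0"
  note [measurable] = L2_measurable[OF f]
  obtain F where F: "\<And>i. simple_function circle_measure (F i)"
     "\<And>z. z \<in> space circle_measure \<Longrightarrow> (\<lambda>i. F i z) \<longlonglongrightarrow> f z"
     "\<And>i z. z \<in> space circle_measure \<Longrightarrow> dist (F i z) 0 \<le> 2 * dist (f z) 0"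
    using borel_measurable_implies_sequence_metric[OF L2_measurable[OF f], of 0] by blast
  note [measurable] = borel_measurable_simple_function[OF F(1)]
  have "(\<lambda>i. LINT z|circle_measure. (cmod (f z - F i z))\<^sup>2) \<longlonglongrightarrow> (LINT z|circle_measure. 0)"
  \<comment> \<open>The factor 9 is (1 + 2)^2: the simple functions satisfy |F i| <= 2 |f|.\<close>
  proof (rule integral_dominated_convergence[where w = "\<lambda>z. 9 * (cmod (f z))\<^sup>2"])
    show "integrable circle_measure (\<lambda>z. 9 * (cmod (f z))\<^sup>2)"
      using L2_integrable[OF f] by simp
    show "AE z in circle_measure. (\<lambda>i. (cmod (f z - F i z))\<^sup>2) \<longlonglongrightarrow> 0"
    proof (rule AE_I2)
      fix z assume "z \<in> space circle_measure"
      from F(2)[OF this] have "(\<lambda>i. (cmod (f z - F i z))\<^sup>2) \<longlonglongrightarrow> (cmod (f z - f z))\<^sup>2"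
        by (intro tendsto_intros)
      then show "(\<lambda>i. (cmod (f z - F i z))\<^sup>2) \<longlonglongrightarrow> 0" by simp
    qed
    show "AE z in circle_measure. norm ((cmod (f z - F i z))\<^sup>2) \<le> 9 * (cmod (f z))\<^sup>2" for i
    proof (rule AE_I2)
      fix z assume z: "z \<in> space circle_measure"
      have "cmod (f z - F i z) \<le> 3 * cmod (f z)"
        using F(3)[OF z, of i] norm_triangle_ineq4[of "f z" "F i z"] by simp
      then have "(cmod (f z - F i z))\<^sup>2 \<le> (3 * cmod (f z))\<^sup>2"
        by (rule power_mono) simp
      then show "norm ((cmod (f z - F i z))\<^sup>2) \<le> 9 * (cmod (f z))\<^sup>2"
        by (simp add: power_mult_distrib)
    qed
  qed auto
  then have "\<forall>\<^sub>F i in sequentially. (LINT z|circle_measure. (cmod (f z - F i z))\<^sup>2) < e\<^sup>2"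
    using e by (intro order_tendstoD(2)) auto
  then obtain i where "(LINT z|circle_measure. (cmod (f z - F i z))\<^sup>2) < e\<^sup>2"
    using eventually_happens by fastforce
  then have "L2_norm (\<lambda>z. f z - F i z) < e"
    using e by (intro power2_less_imp_less[of _ e]) (auto simp: L2_norm_sq)
  then show "\<exists>g. approximable g \<and> L2_norm (\<lambda>z. f z - g z) < e"
    using approximable_simple[OF F(1)] by blast
qed

text \<open>Multiplication by \<open>cnj g\<close> mixes only frequencies at distance at most
  \<open>N\<close>, the degree of \<open>g\<close>. Quantifying over all \<open>m\<close>, and over
  all \<open>h\<close> in \<open>L2\<close>, lets the product case apply the two hypotheses in
  succession; degrees add.\<close>

lemma trig_inner_zero:
  assumes "trig g"
  shows "\<exists>N::nat. \<forall>h\<in>L2. \<forall>m. (\<forall>k. \<bar>k - m\<bar> \<le> int N \<longrightarrow> fourier h k = 0) \<longrightarrow>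
    fourier (\<lambda>z. h z * cnj (g z)) m = 0"
  using assms
proof (induction rule: trig.induct)
  case (trig_const c)
  have "fourier (\<lambda>z. h z * cnj c) m = cnj c * fourier h m" for h m
    using fourier_cmult[of "cnj c" h m] by (simp add: mult.commute)
  then show ?case by (intro exI[of _ 0]) auto
next
  case trig_id
  have "fourier (\<lambda>z. h z * cnj z) m = fourier h (m + 1)" for h m
    unfolding fourier_def
  proof (intro Bochner_Integration.integral_cong refl)
    fix z :: complex assume "z \<in> space circle_measure"
    then have "cmod z = 1" "z \<noteq> 0" by auto
    then show "h z * cnj z * z powi - m = h z * z powi - (m + 1)"
      by (simp add: cnj_eq_inverse power_int_diff power_int_minus field_simps)
  qed
  then show ?case by (intro exI[of _ 1]) auto
next
  case trig_cnj
  have "fourier (\<lambda>z. h z * z) m = fourier h (m - 1)" for h m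
    using fourier_powi_mult[of 1 h m] by (simp add: mult.commute)
  then show ?case by (intro exI[of _ 1]) auto
next
  case (trig_add f g)
  then obtain N1 N2 :: nat where
    "\<forall>h\<in>L2. \<forall>m. (\<forall>k. \<bar>k - m\<bar> \<le> int N1 \<longrightarrow> fourier h k = 0) \<longrightarrow> fourier (\<lambda>z. h z * cnj (f z)) m = 0"
    "\<forall>h\<in>L2. \<forall>m. (\<forall>k. \<bar>k - m\<bar> \<le> int N2 \<longrightarrow> fourier h k = 0) \<longrightarrow> fourier (\<lambda>z. h z * cnj (g z)) m = 0"
    by blast
  then show ?case
    using trig_add(1,2) by (intro exI[of _ "max N1 N2"]) (auto simp: distrib_left fourier_add L2_mult_trig)
next
  case (trig_mult f g)
  then obtain N1 N2 :: nat where N: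
    "\<forall>h\<in>L2. \<forall>m. (\<forall>k. \<bar>k - m\<bar> \<le> int N1 \<longrightarrow> fourier h k = 0) \<longrightarrow> fourier (\<lambda>z. h z * cnj (f z)) m = 0"
    "\<forall>h\<in>L2. \<forall>m. (\<forall>k. \<bar>k - m\<bar> \<le> int N2 \<longrightarrow> fourier h k = 0) \<longrightarrow> fourier (\<lambda>z. h z * cnj (g z)) m = 0"
    by blast
  show ?case
  proof (intro exI[of _ "N1 + N2"] ballI allI impI)
    fix h m assume h: "h \<in> L2" "\<forall>k. \<bar>k - m\<bar> \<le> int (N1 + N2) \<longrightarrow> fourier h k = 0"
    have "fourier (\<lambda>z. h z * cnj (f z)) k = 0" if "\<bar>k - m\<bar> \<le> int N2" for k
      using that h by (intro N(1)[rule_format]) auto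
    then have "fourier (\<lambda>z. h z * cnj (f z) * cnj (g z)) m = 0"
      using h trig_mult(1) by (intro N(2)[rule_format] L2_mult_trig) auto
    then show "fourier (\<lambda>z. h z * cnj (f z * g z)) m = 0"
      by (simp add: mult.assoc)
  qed
qed

text \<open>Only nonnegative frequencies are kept: for functions of \<open>plus_part\<close> this is
  the full symmetric partial sum.\<close>

definition fourier_part :: "nat \<Rightarrow> (complex \<Rightarrow> complex) \<Rightarrow> complex \<Rightarrow> complex" where
  "fourier_part n f = (\<lambda>z. \<Sum>k\<le>n. fourier f (int k) * z powi int k)"

lemma fourier_part_L2: "fourier_part n f \<in> L2"
  unfolding fourier_part_def by (intro L2_sum L2_cmult L2_powi)

lemma fourier_fourier_part:
  "fourier (fourier_part n f) j = (if 0 \<le> j \<and> j \<le> int n then fourier f j else 0)"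
proof -
  have "fourier (fourier_part n f) j = (\<Sum>k\<le>n. fourier f (int k) * (if int k = j then 1 else 0))"
    unfolding fourier_part_def
    by (simp add: fourier_sum fourier_cmult L2_cmult L2_powi fourier_powi del: power_int_of_nat)
  also have "\<dots> = (\<Sum>k\<le>n. if k = nat j \<and> 0 \<le> j then fourier f j else 0)"
    by (intro sum.cong) auto
  also have "\<dots> = (if 0 \<le> j \<and> j \<le> int n then fourier f j else 0)"
    by (cases "0 \<le> j") (auto simp: nat_le_iff)
  finally show ?thesis .
qed

lemma fourier_part_plus: "fourier_part n f \<in> plus_part L2"
  by (simp add: plus_part_def fourier_part_L2 fourier_fourier_part)

lemma inner_fourier_part:
  assumes "g \<in> L2"
  shows "L2_inner (fourier_part n f) g = (\<Sum>k\<le>n. fourier f (int k) * cnj (fourier g (int k)))"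
proof -
  have "L2_inner (fourier_part n f) g = (\<Sum>k\<le>n. fourier f (int k) * L2_inner (\<lambda>z. z powi int k) g)"
    unfolding fourier_part_def
    using assms
    by (simp add: L2_inner_sum_left L2_inner_cmult_left L2_cmult L2_powi del: power_int_of_nat)
  also have "\<dots> = (\<Sum>k\<le>n. fourier f (int k) * cnj (fourier g (int k)))"
    by (simp add: fourier_eq_inner flip: L2_inner_cnj del: power_int_of_nat)
  finally show ?thesis .
qed

lemma L2_norm_fourier_part: "(L2_norm (fourier_part n f))\<^sup>2 = (\<Sum>k\<le>n. (cmod (fourier f (int k)))\<^sup>2)"
proof -
  have "complex_of_real ((L2_norm (fourier_part n f))\<^sup>2) =
      (\<Sum>k\<le>n. fourier f (int k) * cnj (fourier (fourier_part n f) (int k)))"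
    unfolding L2_inner_self[symmetric] by (rule inner_fourier_part[OF fourier_part_L2])
  also have "\<dots> = (\<Sum>k\<le>n. complex_of_real ((cmod (fourier f (int k)))\<^sup>2))"
    by (intro sum.cong) (simp_all only: fourier_fourier_part complex_norm_square atMost_iff, simp)
  finally show ?thesis
    unfolding of_real_sum[symmetric] of_real_eq_iff .
qed

text \<open>Best approximation: once \<open>n\<close> exceeds the degree of a trigonometric
  \<open>g\<close>, the remainder \<open>h\<close> is orthogonal to \<open>g\<close> and to the
  partial sum, so its squared norm is the inner product of \<open>f - g\<close> with
  \<open>h\<close>, and \<open>h\<close> is no longer than \<open>f - g\<close>. The negative
  frequencies of \<open>g\<close> do no harm because those of \<open>h\<close> vanish.\<close>

lemma fourier_part_tendsto:
  assumes f: "f \<in> plus_part L2"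
  shows "(\<lambda>n. L2_norm (\<lambda>z. f z - fourier_part n f z)) \<longlonglongrightarrow> 0"
proof (rule LIMSEQ_I)
  have fL: "f \<in> L2" using f by (rule plus_partD)
  fix e :: real assume e: "0 < e"
  obtain g where g: "trig g" "L2_norm (\<lambda>z. f z - g z) < e"
    using approximable_L2[OF fL] e unfolding approximable_def by meson
  obtain N :: nat where
    N: "\<And>h m. h \<in> L2 \<Longrightarrow> (\<And>k. \<bar>k - m\<bar> \<le> int N \<Longrightarrow> fourier h k = 0) \<Longrightarrow>
      fourier (\<lambda>z. h z * cnj (g z)) m = 0"
    using trig_inner_zero[OF g(1)] by blast
  show "\<exists>no. \<forall>n\<ge>no. norm (L2_norm (\<lambda>z. f z - fourier_part n f z) - 0) < e"
  proof (intro exI[of _ N] allI impI)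
    fix n assume n: "N \<le> n"
    define h where "h = (\<lambda>z. f z - fourier_part n f z)"
    have h: "h \<in> L2" unfolding h_def using fL fourier_part_L2 by (rule L2_diff)
    have fh: "fourier h k = 0" if "k \<le> int n" for k
      unfolding h_def using that fL f
      by (simp add: fourier_diff fourier_part_L2 fourier_fourier_part plus_partD)
    have "fourier (\<lambda>z. h z * cnj (g z)) 0 = 0"
      using h fh n by (intro N) auto
    then have "L2_inner h g = 0" by (simp add: fourier_def L2_inner_def)
    then have 0: "L2_inner g h = 0" "L2_inner (fourier_part n f) h = 0"
      using h fh L2_inner_cnj[of g h] by (auto simp: inner_fourier_part)
    have "complex_of_real ((L2_norm h)\<^sup>2) = L2_inner (\<lambda>z. f z - fourier_part n f z) h"
      unfolding L2_inner_self[symmetric] by (simp add: h_def)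
    also have "\<dots> = L2_inner f h - L2_inner g h"
      using fL h 0 by (simp add: L2_inner_diff_left fourier_part_L2)
    also have "\<dots> = L2_inner (\<lambda>z. f z - g z) h"
      using fL h g by (simp add: L2_inner_diff_left trig_L2)
    finally have "(L2_norm h)\<^sup>2 = cmod (L2_inner (\<lambda>z. f z - g z) h)"
      by (metis norm_of_real abs_power2 of_real_eq_iff)
    also have "\<dots> \<le> L2_norm (\<lambda>z. f z - g z) * L2_norm h"
      using fL h g by (intro L2_inner_le L2_diff) (auto simp: trig_L2)
    finally have "L2_norm h * L2_norm h \<le> L2_norm (\<lambda>z. f z - g z) * L2_norm h"
      by (simp add: power2_eq_square)
    then have "L2_norm h \<le> L2_norm (\<lambda>z. f z - g z)"
      by (metis L2_norm_nonneg less_eq_real_def mult_right_le_imp_le)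
    then show "norm (L2_norm (\<lambda>z. f z - fourier_part n f z) - 0) < e"
      using g(2) by (simp add: h_def)
  qed
qed

lemma parseval:
  assumes f: "f \<in> plus_part L2"
  shows "(\<lambda>k. (cmod (fourier f (int k)))\<^sup>2) sums (L2_norm f)\<^sup>2"
proof -
  have fL: "f \<in> L2" using f by (rule plus_partD)
  \<comment> \<open>Pythagoras for the partial sum and the remainder, at every
    \<open>n\<close>.\<close>
  have "(L2_norm f)\<^sup>2 = (L2_norm (\<lambda>z. f z - fourier_part n f z))\<^sup>2 + (\<Sum>k\<le>n. (cmod (fourier f (int k)))\<^sup>2)" for n
  proof -
    have "L2_inner (fourier_part n f) (\<lambda>z. f z - fourier_part n f z) = 0"
      using fL by (simp add: inner_fourier_part L2_diff fourier_part_L2 fourier_diff fourier_fourier_part)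
    then show ?thesis
      using L2_norm_add_sq[of "\<lambda>z. f z - fourier_part n f z" "fourier_part n f"] fL
      by (simp add: L2_diff fourier_part_L2 L2_norm_fourier_part)
  qed
  then have "(\<lambda>n. \<Sum>k\<le>n. (cmod (fourier f (int k)))\<^sup>2) =
     (\<lambda>n. (L2_norm f)\<^sup>2 - (L2_norm (\<lambda>z. f z - fourier_part n f z))\<^sup>2)"
    by (metis add_diff_cancel_left')
  moreover have "(\<lambda>n. (L2_norm f)\<^sup>2 - (L2_norm (\<lambda>z. f z - fourier_part n f z))\<^sup>2) \<longlonglongrightarrow> (L2_norm f)\<^sup>2 - 0\<^sup>2"
    by (intro tendsto_intros fourier_part_tendsto[OF f])
  ultimately show ?thesis
    by (simp add: sums_def_le)
qed

lemma fourier_unique: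
  assumes "f \<in> plus_part L2" "g \<in> plus_part L2" "\<And>k::nat. fourier f (int k) = fourier g (int k)"
  shows "AE z in circle_measure. f z = g z"
proof -
  have L2: "f \<in> L2" "g \<in> L2" using assms by (auto dest: plus_partD)
  have "(\<lambda>k. (cmod (fourier (\<lambda>z. f z - g z) (int k)))\<^sup>2) sums (L2_norm (\<lambda>z. f z - g z))\<^sup>2"
    by (intro parseval plus_part_L2_diff assms)
  moreover have "(\<lambda>k. (cmod (fourier (\<lambda>z. f z - g z) (int k)))\<^sup>2) = (\<lambda>k. 0)"
    using L2 assms(3) by (simp add: fourier_diff)
  ultimately have "(L2_norm (\<lambda>z. f z - g z))\<^sup>2 = 0"
    using sums_unique2 sums_zero by metis
  then show ?thesis using L2_norm_eq_0_iff[OF L2_diff[OF L2]] by simp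
qed

text \<open>The product is only integrable in general, so its \<open>k\<close>-th coefficient is
  read as the inner product of \<open>f\<close> with \<open>G\<close>. Replacing \<open>f\<close> by
  its partial sums gives a finite convolution that no longer changes for \<open>n\<close> at least
  \<open>nat k\<close>, because \<open>g\<close> has no negative frequencies.\<close>

lemma fourier_mult:
  assumes f: "f \<in> plus_part L2" and g: "g \<in> plus_part L2"
  shows "fourier (\<lambda>z. f z * g z) k =
    (if k < 0 then 0 else \<Sum>j\<le>nat k. fourier f (int j) * fourier g (k - int j))"
proof -
  have fL: "f \<in> L2" and gL: "g \<in> L2" using f g by (auto dest: plus_partD)
  have int: "fourier (\<lambda>z. f z * h z) k = L2_inner f (\<lambda>z. cnj (h z * z powi - k))" for f h
    unfolding fourier_def L2_inner_def by (simp add: mult.assoc)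
  define G where "G = (\<lambda>z. cnj (g z * z powi - k))"
  have G: "G \<in> L2" unfolding G_def by (intro L2_cnj L2_powi_mult gL)
  have part: "L2_inner (fourier_part n f) G = (\<Sum>j\<le>n. fourier f (int j) * fourier g (k - int j))" for n
  proof -
    have "cnj (fourier G (int j)) = fourier g (k - int j)" for j
    proof -
      have "cnj (fourier G (int j)) = L2_inner (\<lambda>z. z powi int j) G"
        by (simp add: fourier_eq_inner flip: L2_inner_cnj)
      also have "\<dots> = fourier (\<lambda>z. z powi int j * g z) k"
        by (simp only: int G_def)
      finally show ?thesis by (simp only: fourier_powi_mult)
    qed
    then show ?thesis by (simp add: inner_fourier_part[OF G])
  qed
  have "(\<lambda>n. L2_inner f G - L2_inner (fourier_part n f) G) \<longlonglongrightarrow> 0"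
  proof (rule Lim_null_comparison)
    show "\<forall>\<^sub>F n in sequentially. norm (L2_inner f G - L2_inner (fourier_part n f) G) \<le>
        L2_norm (\<lambda>z. f z - fourier_part n f z) * L2_norm G"
      using L2_inner_le[OF L2_diff[OF fL fourier_part_L2] G]
      by (simp add: L2_inner_diff_left fL fourier_part_L2 G)
    show "(\<lambda>n. L2_norm (\<lambda>z. f z - fourier_part n f z) * L2_norm G) \<longlonglongrightarrow> 0"
      using tendsto_mult_right[OF fourier_part_tendsto[OF f], of "L2_norm G"] by simp
  qed
  moreover have "\<forall>\<^sub>F n in sequentially. L2_inner (fourier_part n f) G =
      (if k < 0 then 0 else \<Sum>j\<le>nat k. fourier f (int j) * fourier g (k - int j))"
  proof (rule eventually_sequentiallyI[of "nat k"])
    fix n assume n: "nat k \<le> n"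
    show "L2_inner (fourier_part n f) G =
      (if k < 0 then 0 else \<Sum>j\<le>nat k. fourier f (int j) * fourier g (k - int j))"
    proof (cases "k < 0")
      case True
      then show ?thesis unfolding part using plus_partD(2)[OF g] by simp
    next
      case False
      have "(\<Sum>j\<le>n. fourier f (int j) * fourier g (k - int j)) = (\<Sum>j\<le>nat k. fourier f (int j) * fourier g (k - int j))"
        using n False by (intro sum.mono_neutral_right) (auto intro!: plus_partD(2)[OF g])
      then show ?thesis using False by (simp add: part)
    qed
  qed
  then have "(\<lambda>n. L2_inner f G - L2_inner (fourier_part n f) G) \<longlonglongrightarrow> L2_inner f G -
      (if k < 0 then 0 else \<Sum>j\<le>nat k. fourier f (int j) * fourier g (k - int j))"
    by (intro tendsto_intros tendsto_eventually)
  ultimately have "L2_inner f G - (if k < 0 then 0 else \<Sum>j\<le>nat k. fourier f (int j) * fourier g (k - int j)) = 0"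
    using LIMSEQ_unique by blast
  then show ?thesis
    unfolding int G_def[symmetric] by (simp only: right_minus_eq)
qed

section \<open>The space \<open>H\<^sup>1\<^sup>/\<^sup>2\<^sub>+\<close>\<close>

text \<open>On \<open>plus_part\<close> the negative indices contribute nothing, so the unordered
  sum over \<open>int\<close> becomes an ordinary series, accessible to comparison and Cauchy
  products.\<close>

definition Hhalf_term :: "(complex \<Rightarrow> complex) \<Rightarrow> nat \<Rightarrow> real" where
  "Hhalf_term f n = (1 + real n) * (cmod (fourier f (int n)))\<^sup>2"

lemma Hhalf_term_nonneg [simp]: "0 \<le> Hhalf_term f n"
  by (simp add: Hhalf_term_def)

lemma summable_on_int_nat:
  fixes g :: "int \<Rightarrow> real"
  assumes "\<And>k. k < 0 \<Longrightarrow> g k = 0" "\<And>k. 0 \<le> g k"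
  shows "g summable_on UNIV \<longleftrightarrow> summable (\<lambda>n. g (int n))"
    and "infsum g UNIV = (\<Sum>\<^sub>\<infinity>n. g (int n))"
proof -
  have r: "k \<notin> range int \<Longrightarrow> g k = 0" for k
    using assms(1)[of k] by (metis nonneg_int_cases not_le rangeI)
  have "g summable_on UNIV \<longleftrightarrow> g summable_on range int"
    by (rule summable_on_cong_neutral) (use r in auto)
  also have "\<dots> \<longleftrightarrow> (\<lambda>n. g (int n)) summable_on UNIV"
    by (subst summable_on_reindex) (auto simp: o_def)
  also have "\<dots> \<longleftrightarrow> summable (\<lambda>n. g (int n))"
    by (rule summable_on_UNIV_nonneg_real_iff) (rule assms)
  finally show "g summable_on UNIV \<longleftrightarrow> summable (\<lambda>n. g (int n))" .
  have "infsum g UNIV = infsum g (range int)"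
    by (rule infsum_cong_neutral) (use r in auto)
  also have "\<dots> = (\<Sum>\<^sub>\<infinity>n. g (int n))"
    by (subst infsum_reindex) (auto simp: o_def)
  finally show "infsum g UNIV = (\<Sum>\<^sub>\<infinity>n. g (int n))" .
qed

lemma plus_part_Hhalf_iff:
  "f \<in> plus_part Hhalf \<longleftrightarrow> f \<in> plus_part L2 \<and> summable (Hhalf_term f)"
proof -
  have "(\<lambda>k. (1 + real_of_int \<bar>k\<bar>) * (cmod (fourier f k))\<^sup>2) summable_on UNIV \<longleftrightarrow> summable (Hhalf_term f)"
    if "\<forall>k<0. fourier f k = 0"
    using summable_on_int_nat(1)[of "\<lambda>k. (1 + real_of_int \<bar>k\<bar>) * (cmod (fourier f k))\<^sup>2"] that
    by (simp add: Hhalf_term_def[abs_def])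
  then show ?thesis by (auto simp: plus_part_def Hhalf_def)
qed

lemma Hhalf_norm_nonneg [simp]: "0 \<le> Hhalf_norm f"
  unfolding Hhalf_norm_def by (auto intro!: infsum_nonneg)

lemma Hhalf_norm_sums:
  assumes "f \<in> plus_part Hhalf"
  shows "Hhalf_term f sums (Hhalf_norm f)\<^sup>2"
proof -
  have *: "\<forall>k<0. fourier f k = 0" "summable (Hhalf_term f)"
    using assms plus_part_Hhalf_iff by (auto simp: plus_part_def)
  have "(Hhalf_norm f)\<^sup>2 = (\<Sum>\<^sub>\<infinity>k. (1 + real_of_int \<bar>k\<bar>) * (cmod (fourier f k))\<^sup>2)"
    unfolding Hhalf_norm_def by (auto intro!: infsum_nonneg)
  also have "\<dots> = (\<Sum>\<^sub>\<infinity>n. Hhalf_term f n)"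
    using summable_on_int_nat(2)[of "\<lambda>k. (1 + real_of_int \<bar>k\<bar>) * (cmod (fourier f k))\<^sup>2"] *
    by (simp add: Hhalf_term_def)
  finally have "(Hhalf_norm f)\<^sup>2 = (\<Sum>\<^sub>\<infinity>n. Hhalf_term f n)" .
  moreover have "Hhalf_term f summable_on UNIV"
    using *(2) by (subst summable_on_UNIV_nonneg_real_iff) auto
  ultimately show ?thesis
    using has_sum_imp_sums has_sum_infsum by metis
qed

lemma Hhalf_plus_L2: "f \<in> plus_part Hhalf \<Longrightarrow> f \<in> plus_part L2"
  by (simp add: plus_part_Hhalf_iff)

lemma Hhalf_plus_in_L2: "f \<in> plus_part Hhalf \<Longrightarrow> f \<in> L2"
  by (rule plus_partD(1)[OF Hhalf_plus_L2])

lemma plus_part_Hhalf_diff: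
  assumes "f \<in> plus_part Hhalf" "g \<in> plus_part Hhalf"
  shows "(\<lambda>z. f z - g z) \<in> plus_part Hhalf"
    and "(Hhalf_norm (\<lambda>z. f z - g z))\<^sup>2 \<le> 2 * (Hhalf_norm f)\<^sup>2 + 2 * (Hhalf_norm g)\<^sup>2"
proof -
  note s = Hhalf_norm_sums[OF assms(1)] Hhalf_norm_sums[OF assms(2)]
  have s2: "(\<lambda>n. 2 * Hhalf_term f n + 2 * Hhalf_term g n) sums (2 * (Hhalf_norm f)\<^sup>2 + 2 * (Hhalf_norm g)\<^sup>2)"
    by (intro sums_add sums_mult s)
  have L2: "f \<in> L2" "g \<in> L2" using assms by (auto intro: Hhalf_plus_in_L2)
  have le: "Hhalf_term (\<lambda>z. f z - g z) n \<le> 2 * Hhalf_term f n + 2 * Hhalf_term g n" for n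
  proof -
    have "(cmod (fourier f (int n) - fourier g (int n)))\<^sup>2 \<le>
        2 * (cmod (fourier f (int n)))\<^sup>2 + 2 * (cmod (fourier g (int n)))\<^sup>2"
      using cmod_add_sq_le[of "fourier f (int n)" "- fourier g (int n)"] by simp
    then have "(1 + real n) * (cmod (fourier f (int n) - fourier g (int n)))\<^sup>2 \<le>
        (1 + real n) * (2 * (cmod (fourier f (int n)))\<^sup>2 + 2 * (cmod (fourier g (int n)))\<^sup>2)"
      by (rule mult_left_mono) simp
    then show ?thesis
      by (simp add: Hhalf_term_def fourier_diff L2 algebra_simps)
  qed
  have sm: "summable (Hhalf_term (\<lambda>z. f z - g z))"
    by (rule summable_comparison_test'[OF sums_summable[OF s2], of 0]) (use le in auto)
  show d: "(\<lambda>z. f z - g z) \<in> plus_part Hhalf"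
    using sm assms by (simp add: plus_part_Hhalf_iff plus_part_L2_diff)
  show "(Hhalf_norm (\<lambda>z. f z - g z))\<^sup>2 \<le> 2 * (Hhalf_norm f)\<^sup>2 + 2 * (Hhalf_norm g)\<^sup>2"
    by (rule sums_le[OF le Hhalf_norm_sums[OF d] s2])
qed

lemma cmod_fourier_le_Hhalf:
  assumes "f \<in> plus_part Hhalf"
  shows "cmod (fourier f (int k)) \<le> Hhalf_norm f"
proof (rule power2_le_imp_le)
  note s = Hhalf_norm_sums[OF assms]
  have "(cmod (fourier f (int k)))\<^sup>2 \<le> Hhalf_term f k"
    by (simp add: Hhalf_term_def distrib_right)
  also have "\<dots> \<le> (Hhalf_norm f)\<^sup>2"
    using sum_le_suminf[OF sums_summable[OF s], of "{k}"] sums_unique[OF s] by simp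
  finally show "(cmod (fourier f (int k)))\<^sup>2 \<le> (Hhalf_norm f)\<^sup>2" .
qed simp

lemma Hhalf_norm_cong_AE:
  assumes "AE z in circle_measure. f z = g z"
    "f \<in> borel_measurable circle_measure" "g \<in> borel_measurable circle_measure"
  shows "Hhalf_norm f = Hhalf_norm g"
  unfolding Hhalf_norm_def using fourier_cong_AE[OF assms] by simp

text \<open>The embedding into \<open>L\<^sup>4\<close>, read off the Fourier coefficients of \<open>f\<^sup>2\<close>.\<close>

lemma L2_norm_square_le:
  assumes f: "f \<in> plus_part Hhalf" and f2: "(\<lambda>z. f z * f z) \<in> L2"
  shows "L2_norm (\<lambda>z. f z * f z) \<le> (Hhalf_norm f)\<^sup>2"
proof (rule power2_le_imp_le)
  have fp: "f \<in> plus_part L2" using f by (rule Hhalf_plus_L2)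
  have p: "(\<lambda>z. f z * f z) \<in> plus_part L2"
    using f2 by (simp add: plus_part_def fourier_mult[OF fp fp])
  note s = Hhalf_norm_sums[OF f]
  have n: "summable (\<lambda>k. norm (Hhalf_term f k))" using sums_summable[OF s] by simp
  have cp: "(\<lambda>k. \<Sum>j\<le>k. Hhalf_term f j * Hhalf_term f (k - j)) sums ((Hhalf_norm f)\<^sup>2 * (Hhalf_norm f)\<^sup>2)"
    using Cauchy_product_sums[OF n n] sums_unique[OF s] by simp
  have le: "(cmod (fourier (\<lambda>z. f z * f z) (int k)))\<^sup>2 \<le> (\<Sum>j\<le>k. Hhalf_term f j * Hhalf_term f (k - j))" for k
  proof -
    define c where "c j = cmod (fourier f (int j))" for j
    \<comment> \<open>The weights satisfy (1 + j)(1 + k - j) >= 1 + k, so their k + 1 reciprocals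
      sum to at most 1. Cauchy-Schwarz with these weights leaves exactly the Cauchy product of the
      \<open>Hhalf\<close> series with itself.\<close>
    define m where "m j = (1 + real j) * (1 + real (k - j))" for j
    have m1: "m j \<ge> 1 + real k" if "j \<le> k" for j
      using that by (simp add: m_def of_nat_diff algebra_simps) (use mult_left_mono[of "real j" "real k" "real j"] in simp)
    have m0: "m j > 0" for j by (auto simp: m_def intro!: mult_pos_pos)
    have "cmod (fourier (\<lambda>z. f z * f z) (int k)) \<le> (\<Sum>j\<le>k. c j * c (k - j))"
      by (simp add: fourier_mult[OF fp fp] c_def)
        (intro sum_norm_le, auto simp: norm_mult of_nat_diff)
    also have "\<dots> = (\<Sum>j\<le>k. (1 / sqrt (m j)) * (sqrt (m j) * (c j * c (k - j))))"
    proof (intro sum.cong refl)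
      fix j show "c j * c (k - j) = (1 / sqrt (m j)) * (sqrt (m j) * (c j * c (k - j)))"
        using m0[of j] by simp
    qed
    finally have "(cmod (fourier (\<lambda>z. f z * f z) (int k)))\<^sup>2 \<le>
        (\<Sum>j\<le>k. (1 / sqrt (m j)) * (sqrt (m j) * (c j * c (k - j))))\<^sup>2"
      by (rule power_mono) simp
    also have "\<dots> \<le> (\<Sum>j\<le>k. (1 / sqrt (m j))\<^sup>2) * (\<Sum>j\<le>k. (sqrt (m j) * (c j * c (k - j)))\<^sup>2)"
      by (rule Cauchy_Schwarz_ineq_sum)
    also have "\<dots> \<le> 1 * (\<Sum>j\<le>k. (sqrt (m j) * (c j * c (k - j)))\<^sup>2)"
    proof (intro mult_right_mono sum_nonneg)
      have "(\<Sum>j\<le>k. (1 / sqrt (m j))\<^sup>2) \<le> (\<Sum>j\<le>k. 1 / (1 + real k))"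
        using m1 m0 by (intro sum_mono) (auto simp: power_divide less_imp_le intro!: divide_left_mono mult_pos_pos)
      then show "(\<Sum>j\<le>k. (1 / sqrt (m j))\<^sup>2) \<le> 1" by simp
    qed simp
    also have "\<dots> = (\<Sum>j\<le>k. Hhalf_term f j * Hhalf_term f (k - j))"
      using m0 by (auto simp: Hhalf_term_def c_def power_mult_distrib less_imp_le m_def mult_ac intro!: sum.cong)
    finally show ?thesis .
  qed
  show "(L2_norm (\<lambda>z. f z * f z))\<^sup>2 \<le> ((Hhalf_norm f)\<^sup>2)\<^sup>2"
    using sums_le[OF le parseval[OF p] cp] by (simp add: power2_eq_square)
qed simp

lemma L2_norm_fourier_tail_le:
  assumes f: "f \<in> plus_part Hhalf"
  shows "L2_norm (\<lambda>z. f z - fourier_part n f z) \<le> Hhalf_norm f / sqrt (1 + real n)"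
proof (rule power2_le_imp_le)
  have fp: "f \<in> plus_part L2" using f by (rule Hhalf_plus_L2)
  note s = Hhalf_norm_sums[OF f]
  have hp: "(\<lambda>z. f z - fourier_part n f z) \<in> plus_part L2"
    using fp fourier_part_plus by (rule plus_part_L2_diff)
  have le: "(cmod (fourier (\<lambda>z. f z - fourier_part n f z) (int k)))\<^sup>2 \<le> Hhalf_term f k / (1 + real n)" for k
  proof (cases "k \<le> n")
    case True
    then show ?thesis
      using plus_partD(1)[OF fp] by (simp add: fourier_diff fourier_part_L2 fourier_fourier_part)
  next
    case False
    then have "(1 + real n) * (cmod (fourier f (int k)))\<^sup>2 \<le> (1 + real k) * (cmod (fourier f (int k)))\<^sup>2"
      by (intro mult_right_mono) auto
    then show ?thesis
      using plus_partD(1)[OF fp] False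
      by (simp add: fourier_diff fourier_part_L2 fourier_fourier_part Hhalf_term_def field_simps)
  qed
  have "(L2_norm (\<lambda>z. f z - fourier_part n f z))\<^sup>2 \<le> (Hhalf_norm f)\<^sup>2 / (1 + real n)"
    by (rule sums_le[OF le parseval[OF hp] sums_divide[OF s]])
  then show "(L2_norm (\<lambda>z. f z - fourier_part n f z))\<^sup>2 \<le> (Hhalf_norm f / sqrt (1 + real n))\<^sup>2"
    by (simp add: power_divide)
qed simp

lemma sum_inverse_le_ln: "(\<Sum>k\<le>n. 1 / (1 + real k)) \<le> 1 + ln (1 + real n)"
proof (induction n)
  case (Suc n)
  have "ln ((1 + real n) / (2 + real n)) \<le> (1 + real n) / (2 + real n) - 1"
    by (rule ln_le_minus_one) simp
  also have "\<dots> = - (1 / (2 + real n))"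
    by (simp add: field_simps)
  finally have "1 / (2 + real n) \<le> ln (2 + real n) - ln (1 + real n)"
    by (simp add: ln_div)
  then show ?case using Suc by (simp add: add.commute)
qed simp

text \<open>Cauchy-Schwarz against the weights 1 + k leaves the harmonic sum. This is the
  quantitative form of the failure of \<open>Hhalf\<close> to embed into the bounded functions, and
  the source of the logarithm in the uniqueness proof.\<close>

lemma cmod_fourier_part_le:
  assumes f: "f \<in> plus_part Hhalf" and z: "cmod z = 1"
  shows "cmod (fourier_part n f z) \<le> sqrt (1 + ln (1 + real n)) * Hhalf_norm f"
proof (rule power2_le_imp_le)
  note s = Hhalf_norm_sums[OF f]
  have "cmod (fourier_part n f z) \<le> (\<Sum>k\<le>n. cmod (fourier f (int k)))"
    unfolding fourier_part_def using z by (intro sum_norm_le) (simp add: norm_mult norm_power)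
  also have "\<dots> = (\<Sum>k\<le>n. (1 / sqrt (1 + real k)) * (sqrt (1 + real k) * cmod (fourier f (int k))))"
    by (intro sum.cong) (auto simp: add_nonneg_eq_0_iff)
  finally have "(cmod (fourier_part n f z))\<^sup>2 \<le>
      (\<Sum>k\<le>n. (1 / sqrt (1 + real k)) * (sqrt (1 + real k) * cmod (fourier f (int k))))\<^sup>2"
    by (rule power_mono) simp
  also have "\<dots> \<le> (\<Sum>k\<le>n. (1 / sqrt (1 + real k))\<^sup>2) * (\<Sum>k\<le>n. (sqrt (1 + real k) * cmod (fourier f (int k)))\<^sup>2)"
    by (rule Cauchy_Schwarz_ineq_sum)
  also have "\<dots> = (\<Sum>k\<le>n. 1 / (1 + real k)) * (\<Sum>k\<le>n. Hhalf_term f k)"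
    by (simp add: power_divide power_mult_distrib Hhalf_term_def)
  also have "\<dots> \<le> (1 + ln (1 + real n)) * (Hhalf_norm f)\<^sup>2"
  proof (intro mult_mono sum_inverse_le_ln sum_nonneg)
    show "(\<Sum>k\<le>n. Hhalf_term f k) \<le> (Hhalf_norm f)\<^sup>2"
      using sum_le_suminf[OF sums_summable[OF s], of "{..n}"] sums_unique[OF s] by simp
  qed (auto intro!: add_nonneg_nonneg)
  finally show "(cmod (fourier_part n f z))\<^sup>2 \<le> (sqrt (1 + ln (1 + real n)) * Hhalf_norm f)\<^sup>2"
    by (simp add: power_mult_distrib add_nonneg_nonneg)
qed (auto intro!: mult_nonneg_nonneg add_nonneg_nonneg)

text \<open>One of the three factors is split at frequency \<open>n\<close>: its low part is bounded
  pointwise, its high part is small in \<open>L2\<close> and is paired with the square of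
  \<open>f\<close>, which the L4 embedding controls. The parameter \<open>n\<close> stays
  free.\<close>

lemma integral_cube_le:
  assumes f: "f \<in> plus_part Hhalf" and f2: "(\<lambda>z. f z * f z) \<in> L2"
  shows "integrable circle_measure (\<lambda>z. (cmod (f z))^3)"
    and "(LINT z|circle_measure. (cmod (f z))^3) \<le>
      sqrt (1 + ln (1 + real n)) * Hhalf_norm f * (L2_norm f)\<^sup>2 + (Hhalf_norm f)^3 / sqrt (1 + real n)"
proof -
  have fL: "f \<in> L2" using f by (rule Hhalf_plus_in_L2)
  show i: "integrable circle_measure (\<lambda>z. (cmod (f z))^3)"
    using integrable_norm[OF L2_mult_integrable[OF f2 fL]]
    by (simp add: norm_mult power3_eq_cube)
  define h where "h = (\<lambda>z. f z - fourier_part n f z)"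
  have h: "h \<in> L2" unfolding h_def using fL fourier_part_L2 by (rule L2_diff)
  define C where "C = sqrt (1 + ln (1 + real n)) * Hhalf_norm f"
  have i2: "integrable circle_measure (\<lambda>z. cmod (f z * f z) * cmod (h z))"
    using integrable_norm[OF L2_mult_integrable[OF f2 h]] by (simp add: norm_mult)
  have "(LINT z|circle_measure. (cmod (f z))^3) \<le>
      (LINT z|circle_measure. C * (cmod (f z))\<^sup>2 + cmod (f z * f z) * cmod (h z))"
  proof (rule integral_mono[OF i])
    show "integrable circle_measure (\<lambda>z. C * (cmod (f z))\<^sup>2 + cmod (f z * f z) * cmod (h z))"
      using i2 L2_integrable[OF fL] by simp
    fix z assume "z \<in> space circle_measure"
    then have "cmod (fourier_part n f z) \<le> C"
      unfolding C_def by (intro cmod_fourier_part_le f) simp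
    then have "cmod (f z) \<le> C + cmod (h z)"
      using norm_triangle_ineq[of "fourier_part n f z" "h z"] by (simp add: h_def)
    then have "(cmod (f z))\<^sup>2 * cmod (f z) \<le> (cmod (f z))\<^sup>2 * (C + cmod (h z))"
      by (rule mult_left_mono) simp
    then show "(cmod (f z))^3 \<le> C * (cmod (f z))\<^sup>2 + cmod (f z * f z) * cmod (h z)"
      by (simp add: norm_mult power2_eq_square power3_eq_cube algebra_simps)
  qed
  also have "\<dots> = C * (L2_norm f)\<^sup>2 + (LINT z|circle_measure. cmod (f z * f z) * cmod (h z))"
    using i2 L2_integrable[OF fL] by (simp add: L2_norm_sq)
  also have "(LINT z|circle_measure. cmod (f z * f z) * cmod (h z)) \<le> L2_norm (\<lambda>z. f z * f z) * L2_norm h"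
    by (rule L2_cauchy_schwarz[OF f2 h])
  also have "\<dots> \<le> (Hhalf_norm f)\<^sup>2 * (Hhalf_norm f / sqrt (1 + real n))"
    unfolding h_def by (intro mult_mono L2_norm_square_le f f2 L2_norm_fourier_tail_le) auto
  finally show "(LINT z|circle_measure. (cmod (f z))^3) \<le>
      sqrt (1 + ln (1 + real n)) * Hhalf_norm f * (L2_norm f)\<^sup>2 + (Hhalf_norm f)^3 / sqrt (1 + real n)"
    by (simp add: C_def power2_eq_square power3_eq_cube)
qed

section \<open>Uniqueness of bounded solutions\<close>

definition cubic :: "(complex \<Rightarrow> complex) \<Rightarrow> complex \<Rightarrow> complex" where
  "cubic u = (\<lambda>z. of_real ((cmod (u z))\<^sup>2) * u z)"

lemma cmod_cubic: "cmod (cubic u z) = cmod (u z) ^ 3"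
  by (simp add: cubic_def norm_mult norm_power power2_eq_square power3_eq_cube)

text \<open>The projection relation in \<open>szego_solution\<close> places the cubic term in
  \<open>L2\<close>, that is, the solution in L6. Interpolation with \<open>L2\<close> then gives
  L4, the hypothesis under which \<open>L2_norm_square_le\<close> and
  \<open>integral_cube_le\<close> apply.\<close>

lemma cubic_L2_imp_square_L2:
  assumes "f \<in> L2" "cubic f \<in> L2" shows "(\<lambda>z. f z * f z) \<in> L2"
proof -
  note [measurable] = L2_measurable[OF assms(1)]
  have "integrable circle_measure (\<lambda>z. (cmod (f z * f z))\<^sup>2)"
  proof (rule Bochner_Integration.integrable_bound)
    show "integrable circle_measure (\<lambda>z. (cmod (f z))\<^sup>2 + (cmod (cubic f z))\<^sup>2)"
      using L2_integrable assms by simp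
    have le: "x^4 \<le> x^2 + x^6" for x :: real
    proof -
      have "2 * x^4 \<le> x^2 + x^6"
        using sum_squares_bound[of x "x^3"] by (simp flip: power_mult power_Suc add: mult.assoc)
      moreover have "0 \<le> x^4" by simp
      ultimately show ?thesis by linarith
    qed
    have "(cmod (f z * f z))\<^sup>2 = cmod (f z) ^ 4" "(cmod (cubic f z))\<^sup>2 = cmod (f z) ^ 6" for z
      by (simp_all add: cmod_cubic norm_mult power_mult_distrib flip: power_mult power_add)
    then show "AE z in circle_measure. norm ((cmod (f z * f z))\<^sup>2) \<le>
        norm ((cmod (f z))\<^sup>2 + (cmod (cubic f z))\<^sup>2)"
      using le by (intro AE_I2) simp
  qed measurable
  then show ?thesis by (simp add: L2_def)
qed

lemma square_diff_L2:
  assumes "f \<in> L2" "(\<lambda>z. f z * f z) \<in> L2" "g \<in> L2" "(\<lambda>z. g z * g z) \<in> L2"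
  shows "(\<lambda>z. (f z - g z) * (f z - g z)) \<in> L2"
proof -
  note [measurable] = L2_measurable[OF assms(1)] L2_measurable[OF assms(3)]
  have "integrable circle_measure (\<lambda>z. (cmod ((f z - g z) * (f z - g z)))\<^sup>2)"
  proof (rule Bochner_Integration.integrable_bound)
    show "integrable circle_measure (\<lambda>z. 8 * (cmod (f z * f z))\<^sup>2 + 8 * (cmod (g z * g z))\<^sup>2)"
      using L2_integrable assms by simp
    have "(cmod (a - b))\<^sup>2 * (cmod (a - b))\<^sup>2 \<le> 8 * (cmod (a * a))\<^sup>2 + 8 * (cmod (b * b))\<^sup>2" for a b
    proof -
      have "(cmod (a - b))\<^sup>2 \<le> 2 * (cmod a)\<^sup>2 + 2 * (cmod b)\<^sup>2"
        using cmod_add_sq_le[of a "-b"] by simp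
      then have "((cmod (a - b))\<^sup>2)\<^sup>2 \<le> (2 * (cmod a)\<^sup>2 + 2 * (cmod b)\<^sup>2)\<^sup>2"
        by (rule power_mono) simp
      also have "\<dots> \<le> 2 * (2 * (cmod a)\<^sup>2)\<^sup>2 + 2 * (2 * (cmod b)\<^sup>2)\<^sup>2"
        by (rule sum_sq_le)
      finally show ?thesis
        by (simp add: norm_mult power_mult_distrib power2_eq_square)
    qed
    then show "AE z in circle_measure. norm ((cmod ((f z - g z) * (f z - g z)))\<^sup>2) \<le>
        norm (8 * (cmod (f z * f z))\<^sup>2 + 8 * (cmod (g z * g z))\<^sup>2)"
      by (intro AE_I2) (auto simp: norm_mult power_mult_distrib)
  qed measurable
  then show ?thesis by (simp add: L2_def)
qed

lemma szego_solutionD: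
  assumes "szego_solution u0 u"
  shows "u t \<in> plus_part Hhalf" "u t \<in> L2" "cubic (u t) \<in> L2" "(\<lambda>z. u t z * u t z) \<in> L2"
    and "\<exists>g. is_szego_projection (cubic (u t)) g \<and>
        ((\<lambda>h. L2_norm (\<lambda>z. \<i> * ((u (t + h) z - u t z) / of_real h) - g z)) \<longlongrightarrow> 0) (at 0)"
    and "((\<lambda>s. Hhalf_norm (\<lambda>z. u s z - u t z)) \<longlongrightarrow> 0) (at t)"
    and "AE z in circle_measure. u 0 z = u0 z"
proof -
  show *: "u t \<in> plus_part Hhalf" "\<exists>g. is_szego_projection (cubic (u t)) g \<and>
        ((\<lambda>h. L2_norm (\<lambda>z. \<i> * ((u (t + h) z - u t z) / of_real h) - g z)) \<longlongrightarrow> 0) (at 0)"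
    "((\<lambda>s. Hhalf_norm (\<lambda>z. u s z - u t z)) \<longlongrightarrow> 0) (at t)" "AE z in circle_measure. u 0 z = u0 z"
    using assms unfolding szego_solution_def cubic_def by blast+
  show "u t \<in> L2" using *(1) by (rule Hhalf_plus_in_L2)
  show "cubic (u t) \<in> L2" using *(2) by (auto simp: is_szego_projection_def)
  then show "(\<lambda>z. u t z * u t z) \<in> L2" by (intro cubic_L2_imp_square_L2 \<open>u t \<in> L2\<close>)
qed

text \<open>For w = u - v the equation reads i w' = G with G the difference of the projected cubic
  terms, and Re(-i x) = Im x. Since w lies in \<open>plus_part L2\<close>, testing with it removes
  the projector.\<close>

lemma L2_distance_deriv:
  assumes u: "szego_solution u0 u" and v: "szego_solution v0 v"
  shows "((\<lambda>t. (L2_norm (\<lambda>z. u t z - v t z))\<^sup>2) has_real_derivative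
     2 * Im (L2_inner (\<lambda>z. cubic (u t) z - cubic (v t) z) (\<lambda>z. u t z - v t z))) (at t)"
proof -
  note uD = szego_solutionD[OF u] and vD = szego_solutionD[OF v]
  define w where "w = (\<lambda>t z. u t z - v t z)"
  obtain gu gv where gu: "is_szego_projection (cubic (u t)) gu"
      "((\<lambda>h. L2_norm (\<lambda>z. \<i> * ((u (t + h) z - u t z) / of_real h) - gu z)) \<longlongrightarrow> 0) (at 0)"
    and gv: "is_szego_projection (cubic (v t)) gv"
      "((\<lambda>h. L2_norm (\<lambda>z. \<i> * ((v (t + h) z - v t z) / of_real h) - gv z)) \<longlongrightarrow> 0) (at 0)"
    using uD(5)[of t] vD(5)[of t] by blast
  let ?U = "\<lambda>h z. \<i> * ((u (t + h) z - u t z) / of_real h) - gu z"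
  let ?V = "\<lambda>h z. \<i> * ((v (t + h) z - v t z) / of_real h) - gv z"
  have gL: "gu \<in> L2" "gv \<in> L2"
    using gu(1) gv(1) by (auto simp: is_szego_projection_def plus_part_def)
  have wL: "w t \<in> L2" for t unfolding w_def by (intro L2_diff uD vD)
  have wp: "w t \<in> plus_part L2"
    unfolding w_def by (intro plus_part_L2_diff Hhalf_plus_L2 uD vD)
  define G where "G = (\<lambda>z. gu z - gv z)"
  have GL: "G \<in> L2" unfolding G_def by (intro L2_diff gL)
  define D where "D = 2 * Im (L2_inner G (w t))"
  have "L2_inner (\<lambda>z. cubic (u t) z - gu z) (w t) = 0" "L2_inner (\<lambda>z. cubic (v t) z - gv z) (w t) = 0"
    using gu(1) gv(1) wp by (auto simp: is_szego_projection_def)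
  then have "L2_inner (\<lambda>z. cubic (u t) z - cubic (v t) z) (w t) = L2_inner G (w t)"
    unfolding G_def using uD(3) vD(3) gL wL by (simp add: L2_inner_diff_left)
  then have D: "2 * Im (L2_inner (\<lambda>z. cubic (u t) z - cubic (v t) z) (\<lambda>z. u t z - v t z)) = D"
    by (simp add: D_def w_def)
  \<comment> \<open>The remainder of the difference quotient, so that w (t + h) = w t - i h (G + r
    h). Expanding the squared norm then gives the exact identity \<open>quot\<close>, and only the
    convergence of \<open>r\<close> to 0 in \<open>L2\<close> is used.\<close>
  define r where "r = (\<lambda>h z. \<i> * ((w (t + h) z - w t z) / of_real h) - G z)"
  have rL: "r h \<in> L2" for h
  proof -
    have "r h = (\<lambda>z. (\<i> / of_real h) * (w (t + h) z - w t z) - G z)"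
      by (auto simp: r_def)
    then show ?thesis
      by (simp only:) (intro L2_diff L2_cmult wL GL)
  qed
  have qL: "(?U h) \<in> L2"
           "(?V h) \<in> L2" for h
    using L2_diff[OF L2_cmult[OF L2_diff[OF uD(2) uD(2)], of "\<i> / of_real h" "t+h" t] gL(1)]
      L2_diff[OF L2_cmult[OF L2_diff[OF vD(2) vD(2)], of "\<i> / of_real h" "t+h" t] gL(2)] by simp_all
  have r0: "((\<lambda>h. L2_norm (r h)) \<longlongrightarrow> 0) (at 0)"
  proof (rule Lim_null_comparison)
    show "\<forall>\<^sub>F h in at 0. norm (L2_norm (r h)) \<le>
        L2_norm (?U h) +
        L2_norm (?V h)"
    proof (intro always_eventually allI)
      fix h
      have "r h = (\<lambda>z. (\<i> * ((u (t + h) z - u t z) / of_real h) - gu z) -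
          (\<i> * ((v (t + h) z - v t z) / of_real h) - gv z))"
        by (intro ext) (simp add: r_def w_def G_def diff_divide_distrib right_diff_distrib)
      then show "norm (L2_norm (r h)) \<le>
        L2_norm (?U h) +
        L2_norm (?V h)"
        using L2_norm_triangle_diff[OF qL(1) qL(2), of h h] by simp
    qed
    show "((\<lambda>h. L2_norm (?U h) +
        L2_norm (?V h)) \<longlongrightarrow> 0) (at 0)"
      using tendsto_add[OF gu(2) gv(2)] by simp
  qed
  define E where "E = (\<lambda>t. (L2_norm (w t))\<^sup>2)"
  have quot: "(E (t + h) - E t) / h - D = 2 * Im (L2_inner (r h) (w t)) + h * (L2_norm (\<lambda>z. G z + r h z))\<^sup>2"
    if "h \<noteq> 0" for h
  proof -
    have "w (t + h) = (\<lambda>z. w t z + (- \<i> * of_real h) * (G z + r h z))"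
      using that by (auto simp: r_def field_simps)
    then have "E (t + h) = E t + 2 * Re (L2_inner (\<lambda>z. (- \<i> * of_real h) * (G z + r h z)) (w t)) +
        (L2_norm (\<lambda>z. (- \<i> * of_real h) * (G z + r h z)))\<^sup>2"
      unfolding E_def
      by (simp only:) (rule L2_norm_add_sq[OF wL L2_cmult[OF L2_add[OF GL rL]]])
    also have "\<dots> = E t + h * (D + 2 * Im (L2_inner (r h) (w t))) + h * (h * (L2_norm (\<lambda>z. G z + r h z))\<^sup>2)"
      unfolding L2_inner_cmult_left L2_norm_cmult L2_inner_add_left[OF GL rL wL]
      by (simp add: D_def norm_mult power_mult_distrib power2_eq_square[of h] algebra_simps)
    finally show ?thesis using that by (simp add: field_simps)
  qed
  have "((\<lambda>h. (E (t + h) - E t) / h - D) \<longlongrightarrow> 0) (at 0)"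
  proof (rule Lim_null_comparison)
    show "\<forall>\<^sub>F h in at 0. norm ((E (t + h) - E t) / h - D) \<le>
      2 * (L2_norm (r h) * L2_norm (w t)) + \<bar>h\<bar> * (L2_norm G + L2_norm (r h))\<^sup>2"
      unfolding eventually_at_filter
    proof (intro always_eventually allI impI)
      fix h :: real assume h: "h \<noteq> 0"
      have "\<bar>Im (L2_inner (r h) (w t))\<bar> \<le> L2_norm (r h) * L2_norm (w t)"
        using L2_inner_le[OF rL wL] abs_Im_le_cmod order_trans by blast
      moreover have "(L2_norm (\<lambda>z. G z + r h z))\<^sup>2 \<le> (L2_norm G + L2_norm (r h))\<^sup>2"
        by (intro power_mono L2_norm_triangle GL rL) simp
      then have "\<bar>h\<bar> * (L2_norm (\<lambda>z. G z + r h z))\<^sup>2 \<le> \<bar>h\<bar> * (L2_norm G + L2_norm (r h))\<^sup>2"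
        by (rule mult_left_mono) simp
      moreover have "\<bar>h * (L2_norm (\<lambda>z. G z + r h z))\<^sup>2\<bar> = \<bar>h\<bar> * (L2_norm (\<lambda>z. G z + r h z))\<^sup>2"
        by (simp add: abs_mult)
      ultimately show "norm ((E (t + h) - E t) / h - D) \<le>
          2 * (L2_norm (r h) * L2_norm (w t)) + \<bar>h\<bar> * (L2_norm G + L2_norm (r h))\<^sup>2"
        unfolding quot[OF h] real_norm_def by linarith
    qed
    have "((\<lambda>h. 2 * (L2_norm (r h) * L2_norm (w t)) + \<bar>h\<bar> * (L2_norm G + L2_norm (r h))\<^sup>2) \<longlongrightarrow>
        2 * (0 * L2_norm (w t)) + \<bar>0\<bar> * (L2_norm G + 0)\<^sup>2) (at 0)"
      by (intro tendsto_intros r0)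
    then show "((\<lambda>h. 2 * (L2_norm (r h) * L2_norm (w t)) + \<bar>h\<bar> * (L2_norm G + L2_norm (r h))\<^sup>2) \<longlongrightarrow> 0) (at 0)"
      by simp
  qed
  then have "((\<lambda>h. (E (t + h) - E t) / h) \<longlongrightarrow> D) (at 0)"
    by (rule LIM_zero_cancel)
  then show ?thesis
    unfolding D by (simp add: DERIV_def E_def w_def)
qed

text \<open>Adding and subtracting |b|^2 a isolates the term |b|^2 |a - b|^2, which is real and
  drops out of the imaginary part. What remains is at most cubic in a - b and requires a bound on
  \<open>a\<close> only, so that one of two compared solutions may be unbounded and
  \<open>integral_cube_le\<close> suffices.\<close>

lemma Im_cubic_diff_le:
  fixes a b :: complex
  assumes "cmod a \<le> K"
  shows "\<bar>Im ((of_real ((cmod a)\<^sup>2) * a - of_real ((cmod b)\<^sup>2) * b) * cnj (a - b))\<bar> \<le>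
     2 * K\<^sup>2 * (cmod (a - b))\<^sup>2 + K * (cmod (a - b))^3"
proof -
  have K: "0 \<le> K" using assms norm_ge_zero order_trans by blast
  have "Im ((of_real ((cmod a)\<^sup>2) * a - of_real ((cmod b)\<^sup>2) * b) * cnj (a - b)) =
      ((cmod a)\<^sup>2 - (cmod b)\<^sup>2) * Im (a * cnj (a - b))"
    by (simp add: algebra_simps)
  also have "\<bar>\<dots>\<bar> = (\<bar>cmod a - cmod b\<bar> * (cmod a + cmod b)) * \<bar>Im (a * cnj (a - b))\<bar>"
    by (simp add: abs_mult power2_eq_square square_diff_square_factored)
  also have "\<dots> \<le> (cmod (a - b) * (2 * K + cmod (a - b))) * (K * cmod (a - b))"
  proof (intro mult_mono)
    show "\<bar>cmod a - cmod b\<bar> \<le> cmod (a - b)" by (rule norm_triangle_ineq3)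
    show "cmod a + cmod b \<le> 2 * K + cmod (a - b)"
      using assms norm_triangle_sub[of b a] by (simp add: norm_minus_commute)
    have "\<bar>Im (a * cnj (a - b))\<bar> \<le> cmod (a * cnj (a - b))" by (rule abs_Im_le_cmod)
    also have "\<dots> \<le> K * cmod (a - b)"
      using assms unfolding norm_mult complex_mod_cnj by (rule mult_right_mono) simp
    finally show "\<bar>Im (a * cnj (a - b))\<bar> \<le> K * cmod (a - b)" .
  qed (use K in auto)
  finally show ?thesis by (simp add: power2_eq_square power3_eq_cube algebra_simps)
qed

lemma Im_inner_cubic_diff_le:
  assumes u: "szego_solution u0 u" and v: "szego_solution v0 v"
    and K: "\<And>z. cmod z = 1 \<Longrightarrow> cmod (u t z) \<le> K" "0 \<le> K"
    and H: "Hhalf_norm (\<lambda>z. u t z - v t z) \<le> H"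
  shows "\<bar>Im (L2_inner (\<lambda>z. cubic (u t) z - cubic (v t) z) (\<lambda>z. u t z - v t z))\<bar> \<le>
    (2 * K\<^sup>2 + K * H * sqrt (1 + ln (1 + real n))) * (L2_norm (\<lambda>z. u t z - v t z))\<^sup>2 + K * H^3 / sqrt (1 + real n)"
proof -
  let ?L = "\<lambda>n. sqrt (1 + ln (1 + real n))"
  note uD = szego_solutionD[OF u] and vD = szego_solutionD[OF v]
  define w where "w = (\<lambda>z. u t z - v t z)"
  have wH: "w \<in> plus_part Hhalf" unfolding w_def by (intro plus_part_Hhalf_diff uD vD)
  have wL: "w \<in> L2" using wH by (rule Hhalf_plus_in_L2)
  have w2: "(\<lambda>z. w z * w z) \<in> L2" unfolding w_def by (intro square_diff_L2 uD vD)
  have cL: "(\<lambda>z. cubic (u t) z - cubic (v t) z) \<in> L2" by (intro L2_diff uD vD)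
  note ci = integral_cube_le[OF wH w2]
  have int: "integrable circle_measure (\<lambda>z. (cubic (u t) z - cubic (v t) z) * cnj (w z))"
    by (rule L2_inner_integrable[OF cL wL])
  have "\<bar>Im (L2_inner (\<lambda>z. cubic (u t) z - cubic (v t) z) w)\<bar> =
      \<bar>LINT z|circle_measure. Im ((cubic (u t) z - cubic (v t) z) * cnj (w z))\<bar>"
    unfolding L2_inner_def integral_Im[OF int] ..
  also have "\<dots> \<le> (LINT z|circle_measure. \<bar>Im ((cubic (u t) z - cubic (v t) z) * cnj (w z))\<bar>)"
    by (rule integral_abs_bound)
  also have "\<dots> \<le> (LINT z|circle_measure. 2 * K\<^sup>2 * (cmod (w z))\<^sup>2 + K * (cmod (w z))^3)"
  proof (rule integral_mono)
    show "integrable circle_measure (\<lambda>z. \<bar>Im ((cubic (u t) z - cubic (v t) z) * cnj (w z))\<bar>)"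
      using int by (intro integrable_abs integrable_Im)
    show "integrable circle_measure (\<lambda>z. 2 * K\<^sup>2 * (cmod (w z))\<^sup>2 + K * (cmod (w z))^3)"
      using ci(1) L2_integrable[OF wL] by simp
    fix z assume "z \<in> space circle_measure"
    then show "\<bar>Im ((cubic (u t) z - cubic (v t) z) * cnj (w z))\<bar> \<le> 2 * K\<^sup>2 * (cmod (w z))\<^sup>2 + K * (cmod (w z))^3"
      unfolding cubic_def w_def using K(1) by (intro Im_cubic_diff_le) simp
  qed
  also have "\<dots> = 2 * K\<^sup>2 * (L2_norm w)\<^sup>2 + K * (LINT z|circle_measure. (cmod (w z))^3)"
    using ci(1) L2_integrable[OF wL] by (simp add: L2_norm_sq)
  also have "\<dots> \<le> 2 * K\<^sup>2 * (L2_norm w)\<^sup>2 + K * (?L n * Hhalf_norm w * (L2_norm w)\<^sup>2 + (Hhalf_norm w)^3 / sqrt (1 + real n))"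
    by (intro add_left_mono mult_left_mono ci K)
  also have "\<dots> \<le> 2 * K\<^sup>2 * (L2_norm w)\<^sup>2 + K * (?L n * H * (L2_norm w)\<^sup>2 + H^3 / sqrt (1 + real n))"
    using H unfolding w_def[symmetric]
    by (intro add_left_mono add_mono mult_left_mono mult_right_mono divide_right_mono power_mono K) auto
  finally show ?thesis unfolding w_def by (simp add: algebra_simps)
qed

text \<open>Continuity is known only through norms of differences of representatives, not as
  continuity into a metric space type, so bisection of the time interval replaces the compactness
  argument.\<close>

lemma Hhalf_norm_locally_bounded:
  fixes w :: "real \<Rightarrow> complex \<Rightarrow> complex"
  assumes w: "\<And>t. w t \<in> plus_part Hhalf" and ab: "a \<le> b"
    and cont: "\<And>t. ((\<lambda>s. Hhalf_norm (\<lambda>z. w s z - w t z)) \<longlongrightarrow> 0) (at t)"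
  shows "\<exists>M. \<forall>t. a \<le> t \<and> t \<le> b \<longrightarrow> (Hhalf_norm (w t))\<^sup>2 \<le> M"
proof (rule Bolzano[of a b "\<lambda>a b. \<exists>M. \<forall>t. a \<le> t \<and> t \<le> b \<longrightarrow> (Hhalf_norm (w t))\<^sup>2 \<le> M", OF ab])
  fix a b c :: real
  assume "\<exists>M. \<forall>t. a \<le> t \<and> t \<le> b \<longrightarrow> (Hhalf_norm (w t))\<^sup>2 \<le> M"
    "\<exists>M. \<forall>t. b \<le> t \<and> t \<le> c \<longrightarrow> (Hhalf_norm (w t))\<^sup>2 \<le> M"
  then obtain M1 M2 where
    "\<forall>t. a \<le> t \<and> t \<le> b \<longrightarrow> (Hhalf_norm (w t))\<^sup>2 \<le> M1" "\<forall>t. b \<le> t \<and> t \<le> c \<longrightarrow> (Hhalf_norm (w t))\<^sup>2 \<le> M2"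
    by blast
  then show "\<exists>M. \<forall>t. a \<le> t \<and> t \<le> c \<longrightarrow> (Hhalf_norm (w t))\<^sup>2 \<le> M"
    by (intro exI[of _ "max M1 M2"]) (metis le_max_iff_disj linear)
next
  fix t
  have "\<forall>\<^sub>F s in at t. Hhalf_norm (\<lambda>z. w s z - w t z) < 1"
    by (rule order_tendstoD(2)[OF cont]) simp
  then obtain d where d: "d > 0" "\<And>s. s \<noteq> t \<Longrightarrow> dist s t < d \<Longrightarrow> Hhalf_norm (\<lambda>z. w s z - w t z) < 1"
    unfolding eventually_at by auto
  have bd: "(Hhalf_norm (w s))\<^sup>2 \<le> 2 + 2 * (Hhalf_norm (w t))\<^sup>2" if s: "dist s t < d" for s
  proof (cases "s = t")
    case False
    have n: "(\<lambda>z. w t z - w s z) \<in> plus_part Hhalf" by (intro plus_part_Hhalf_diff w)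
    have "Hhalf_norm (\<lambda>z. w t z - w s z) = Hhalf_norm (\<lambda>z. w s z - w t z)"
      unfolding Hhalf_norm_def
      using Hhalf_plus_in_L2[OF w] by (simp add: fourier_diff norm_minus_commute)
    then have "(Hhalf_norm (\<lambda>z. w t z - w s z))\<^sup>2 \<le> 1"
      using d(2)[OF False s] by (simp add: power_le_one)
    moreover have "(\<lambda>z. w t z - (w t z - w s z)) = w s" by auto
    ultimately show ?thesis
      using plus_part_Hhalf_diff(2)[OF w[of t] n] by simp
  qed simp
  show "\<exists>d>0. \<forall>a b. a \<le> t \<and> t \<le> b \<and> b - a < d \<longrightarrow>
      (\<exists>M. \<forall>t. a \<le> t \<and> t \<le> b \<longrightarrow> (Hhalf_norm (w t))\<^sup>2 \<le> M)"
  proof (rule exI[of _ d], intro conjI allI impI)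
    fix a b assume ab: "a \<le> t \<and> t \<le> b \<and> b - a < d"
    show "\<exists>M. \<forall>t. a \<le> t \<and> t \<le> b \<longrightarrow> (Hhalf_norm (w t))\<^sup>2 \<le> M"
      using ab by (intro exI[of _ "2 + 2 * (Hhalf_norm (w t))\<^sup>2"] allI impI bd) (auto simp: dist_real_def)
  qed (use d in auto)
qed

lemma gronwall:
  fixes E E' :: "real \<Rightarrow> real"
  assumes E: "\<And>t. (E has_real_derivative E' t) (at t)" and E0: "E 0 = 0"
    and le: "\<And>t. 0 \<le> t \<Longrightarrow> t \<le> T \<Longrightarrow> E' t \<le> A * E t + B" and A: "0 \<le> A" "0 \<le> B" and T: "0 \<le> T"
  shows "E T \<le> B * T * exp (A * T)"
proof -
  \<comment> \<open>Besides the integrating factor, \<open>B * t\<close> absorbs the source term, as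
    the exponential is at most 1 for \<open>t \<ge> 0\<close>.\<close>
  define \<phi> where "\<phi> = (\<lambda>t. exp (- (A * t)) * E t - B * t)"
  have "\<phi> T \<le> \<phi> 0"
  proof (rule DERIV_nonpos_imp_nonincreasing[OF T])
    fix t assume t: "0 \<le> t" "t \<le> T"
    have "(\<phi> has_real_derivative (exp (- (A * t)) * (E' t - A * E t) - B)) (at t)"
      unfolding \<phi>_def by (rule derivative_eq_intros E refl | simp add: algebra_simps)+
    moreover have "exp (- (A * t)) * (E' t - A * E t) \<le> exp (- (A * t)) * B"
      using le[OF t] by (intro mult_left_mono) auto
    moreover have "exp (- (A * t)) * B \<le> 1 * B"
      using A t by (intro mult_right_mono) auto
    ultimately have "(\<phi> has_real_derivative (exp (- (A * t)) * (E' t - A * E t) - B)) (at t)"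
        "exp (- (A * t)) * (E' t - A * E t) - B \<le> 0"
      by linarith+
    then show "\<exists>y. (\<phi> has_real_derivative y) (at t) \<and> y \<le> 0" by blast
  qed
  then have "exp (- (A * T)) * E T \<le> B * T"
    by (simp add: \<phi>_def E0)
  then have "exp (A * T) * (exp (- (A * T)) * E T) \<le> exp (A * T) * (B * T)"
    by (rule mult_left_mono) simp
  then show ?thesis
    by (simp add: exp_minus mult_ac)
qed

text \<open>By the inequality of arithmetic and geometric means, C L <= C^2 + L^2 / 4 with L^2 = 1 +
  ln (1 + n). The exponential is therefore at most a constant times (1 + n)^(1/4), which loses
  against the square root in the denominator.\<close>

lemma yudovich_limit:
  fixes A C D :: real
  assumes "0 \<le> C"
  shows "(\<lambda>n. D / sqrt (1 + real n) * exp (A + C * sqrt (1 + ln (1 + real n)))) \<longlonglongrightarrow> 0"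
proof -
  let ?L = "\<lambda>n. sqrt (1 + ln (1 + real n))"
  have 1: "exp (A + C * ?L n) \<le> exp (A + C\<^sup>2 + 1 / 4) * exp (ln (1 + real n) / 4)" for n
  proof -
    have "2 * C * (?L n / 2) \<le> C\<^sup>2 + (?L n / 2)\<^sup>2"
      by (rule sum_squares_bound)
    then have "A + C * ?L n \<le> (A + C\<^sup>2 + 1 / 4) + ln (1 + real n) / 4"
      by (simp add: power_divide add_nonneg_nonneg add_divide_distrib)
    then show ?thesis
      unfolding exp_add[symmetric] by simp
  qed
  show ?thesis
  proof (rule Lim_null_comparison)
    show "\<forall>\<^sub>F n in sequentially. norm (D / sqrt (1 + real n) * exp (A + C * ?L n)) \<le>
       (\<bar>D\<bar> * exp (A + C\<^sup>2 + 1 / 4)) * (exp (ln (1 + real n) / 4) / sqrt (1 + real n))"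
    proof (intro always_eventually allI)
      fix n
      have "norm (D / sqrt (1 + real n) * exp (A + C * ?L n)) =
        \<bar>D\<bar> / sqrt (1 + real n) * exp (A + C * ?L n)"
        by (simp add: abs_mult)
      also have "\<dots> \<le> \<bar>D\<bar> / sqrt (1 + real n) * (exp (A + C\<^sup>2 + 1 / 4) * exp (ln (1 + real n) / 4))"
        by (intro mult_left_mono 1) auto
      finally show "norm (D / sqrt (1 + real n) * exp (A + C * ?L n)) \<le>
       (\<bar>D\<bar> * exp (A + C\<^sup>2 + 1 / 4)) * (exp (ln (1 + real n) / 4) / sqrt (1 + real n))"
        by (simp add: mult_ac)
    qed
    have "(\<lambda>n. exp (ln (1 + real n) / 4) / sqrt (1 + real n)) \<longlonglongrightarrow> 0"
      by real_asymp
    then show "(\<lambda>n. (\<bar>D\<bar> * exp (A + C\<^sup>2 + 1 / 4)) * (exp (ln (1 + real n) / 4) / sqrt (1 + real n))) \<longlonglongrightarrow> 0"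
      by (rule tendsto_mult_right_zero)
  qed
qed

text \<open>
  The estimate of \<open>Im_inner_cubic_diff_le\<close> only loses a factor \<open>sqrt (ln n)\<close> in the growth
  rate while the error decays like \<open>1 / sqrt n\<close>, so Gronwall's lemma closes as \<open>n \<rightarrow> \<infinity>\<close>.
\<close>

lemma szego_unique:
  assumes u: "szego_solution u0 u" and v: "szego_solution u0 v"
    and K: "\<And>t z. 0 \<le> t \<Longrightarrow> t \<le> T \<Longrightarrow> cmod z = 1 \<Longrightarrow> cmod (u t z) \<le> K"
    and T: "0 \<le> T"
  shows "AE z in circle_measure. u T z = v T z"
proof -
  let ?L = "\<lambda>n. sqrt (1 + ln (1 + real n))"
  note uD = szego_solutionD[OF u] and vD = szego_solutionD[OF v]
  have K0: "0 \<le> K" using order_trans[OF norm_ge_zero K[of 0 1]] T by simp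
  define w where "w = (\<lambda>t z. u t z - v t z)"
  have wH: "w t \<in> plus_part Hhalf" for t unfolding w_def by (intro plus_part_Hhalf_diff uD vD)
  have wL: "w t \<in> L2" for t using wH by (rule Hhalf_plus_in_L2)
  have wc: "((\<lambda>s. Hhalf_norm (\<lambda>z. w s z - w t z)) \<longlongrightarrow> 0) (at t)" for t
  proof (rule Lim_null_comparison)
    let ?S = "\<lambda>s. sqrt (2 * (Hhalf_norm (\<lambda>z. u s z - u t z))\<^sup>2 + 2 * (Hhalf_norm (\<lambda>z. v s z - v t z))\<^sup>2)"
    show "\<forall>\<^sub>F s in at t. norm (Hhalf_norm (\<lambda>z. w s z - w t z)) \<le>
       ?S s"
    proof (intro always_eventually allI)
      fix s
      have "(\<lambda>z. (u s z - u t z) - (v s z - v t z)) = (\<lambda>z. w s z - w t z)"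
        by (auto simp: w_def)
      then have "(Hhalf_norm (\<lambda>z. w s z - w t z))\<^sup>2 \<le> 2 * (Hhalf_norm (\<lambda>z. u s z - u t z))\<^sup>2 + 2 * (Hhalf_norm (\<lambda>z. v s z - v t z))\<^sup>2"
        using plus_part_Hhalf_diff(2)[OF plus_part_Hhalf_diff(1)[OF uD(1)[of s] uD(1)[of t]] plus_part_Hhalf_diff(1)[OF vD(1)[of s] vD(1)[of t]]]
        by simp
      then show "norm (Hhalf_norm (\<lambda>z. w s z - w t z)) \<le>
       ?S s"
        by (simp add: real_le_rsqrt)
    qed
    have "(?S
        \<longlongrightarrow> sqrt (2 * 0\<^sup>2 + 2 * 0\<^sup>2)) (at t)"
      by (intro tendsto_intros uD vD)
    then show "(?S
        \<longlongrightarrow> 0) (at t)" by simp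
  qed
  obtain M where M: "\<And>t. 0 \<le> t \<Longrightarrow> t \<le> T \<Longrightarrow> (Hhalf_norm (w t))\<^sup>2 \<le> M"
    using Hhalf_norm_locally_bounded[OF wH T wc] by auto
  define H where "H = sqrt M"
  have H: "Hhalf_norm (w t) \<le> H" if "0 \<le> t" "t \<le> T" for t
    unfolding H_def using M[OF that] by (simp add: real_le_rsqrt)
  have H0: "0 \<le> H" using order_trans[OF Hhalf_norm_nonneg H[of 0]] T by simp
  define E where "E = (\<lambda>t. (L2_norm (w t))\<^sup>2)"
  define E' where "E' = (\<lambda>t. 2 * Im (L2_inner (\<lambda>z. cubic (u t) z - cubic (v t) z) (w t)))"
  have E: "(E has_real_derivative E' t) (at t)" for t
    unfolding E_def E'_def w_def by (rule L2_distance_deriv[OF u v])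
  have E0: "E 0 = 0"
  proof -
    have "AE z in circle_measure. w 0 z = 0"
      using uD(7) vD(7) by eventually_elim (simp add: w_def)
    then show ?thesis using L2_norm_eq_0_iff[OF wL] by (simp add: E_def)
  qed
  let ?Z = "\<lambda>n. (2 * K * H^3 * T) / sqrt (1 + real n) * exp (4 * K\<^sup>2 * T + (2 * K * H * T) * ?L n)"
  have "E T \<le> ?Z n" for n
  proof -
    define A where "A = 2 * (2 * K\<^sup>2 + K * H * ?L n)"
    define B where "B = 2 * (K * H^3 / sqrt (1 + real n))"
    have "E T \<le> B * T * exp (A * T)"
    proof (rule gronwall[OF E E0 _ _ _ T])
      fix t assume t: "0 \<le> t" "t \<le> T"
      have "\<bar>Im (L2_inner (\<lambda>z. cubic (u t) z - cubic (v t) z) (w t))\<bar> \<le>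
         (2 * K\<^sup>2 + K * H * ?L n) * E t + K * H^3 / sqrt (1 + real n)"
        unfolding w_def E_def
        by (rule Im_inner_cubic_diff_le[OF u v K[OF t] K0 H[OF t, unfolded w_def]])
      then have "2 * Im (L2_inner (\<lambda>z. cubic (u t) z - cubic (v t) z) (w t)) \<le>
         2 * ((2 * K\<^sup>2 + K * H * ?L n) * E t + K * H^3 / sqrt (1 + real n))"
        by (intro mult_left_mono) (auto dest: abs_le_D1)
      then show "E' t \<le> A * E t + B"
        by (simp add: E'_def A_def B_def algebra_simps)
    qed (use K0 H0 in \<open>auto simp: A_def B_def intro!: add_nonneg_nonneg mult_nonneg_nonneg\<close>)
    then show ?thesis by (simp add: A_def B_def algebra_simps)
  qed
  moreover have "?Z \<longlonglongrightarrow> 0"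
    using K0 H0 T by (intro yudovich_limit) auto
  ultimately have "E T \<le> 0"
    by (intro LIMSEQ_le_const[where X = ?Z]) auto
  then have "L2_norm (w T) = 0" by (simp add: E_def)
  then show ?thesis using L2_norm_eq_0_iff[OF wL] by (simp add: w_def)
qed

section \<open>Rational solutions\<close>

text \<open>The constant term is separated from the part with the pole, so that the Fourier
  coefficients are \<open>b\<close> and then \<open>B * p ^ (n - 1)\<close>; the form (a z + b) / (1
  - p z) corresponds to B = a + b p.\<close>

definition ratf :: "complex \<Rightarrow> complex \<Rightarrow> complex \<Rightarrow> complex \<Rightarrow> complex" where
  "ratf b B p z = b + B * (z / (1 - p * z))"

lemma one_minus_mult_nz:
  assumes "cmod p < 1" "cmod z = 1" shows "1 - p * z \<noteq> 0"
proof
  assume "1 - p * z = 0"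
  then have "cmod (p * z) = 1" by (metis eq_iff_diff_eq_0 norm_one)
  then show False using assms by (simp add: norm_mult)
qed

lemma mult_neq_1: "cmod p < 1 \<Longrightarrow> cmod z = 1 \<Longrightarrow> p * z \<noteq> 1"
  using one_minus_mult_nz by fastforce

abbreviation wave :: "complex \<Rightarrow> complex \<Rightarrow> complex \<Rightarrow> complex \<Rightarrow> complex" where
  "wave a b p \<equiv> ratf b (a + b * p) p"

lemma ratf_wave:
  assumes "cmod p < 1" "cmod z = 1"
  shows "wave a b p z = (a * z + b) / (1 - p * z)"
  using one_minus_mult_nz[OF assms] by (simp add: ratf_def field_simps)

lemma continuous_ratf: "cmod p < 1 \<Longrightarrow> continuous_on (sphere 0 1) (ratf b B p)"
  unfolding ratf_def using one_minus_mult_nz by (auto intro!: continuous_intros)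

lemma fourier_cong: "(\<And>z. cmod z = 1 \<Longrightarrow> f z = g z) \<Longrightarrow> fourier f k = fourier g k"
  unfolding fourier_def by (intro Bochner_Integration.integral_cong) auto

lemma L2_inner_cong: "(\<And>z. cmod z = 1 \<Longrightarrow> f z = g z) \<Longrightarrow> L2_inner f h = L2_inner g h"
  unfolding L2_inner_def by (intro Bochner_Integration.integral_cong) auto

text \<open>Dividing by \<open>1 - p z\<close> turns into a first-order recursion for the Fourier coefficients.\<close>

lemma fourier_geometric:
  assumes f: "f \<in> L2" and g: "g \<in> plus_part L2" and p: "cmod p < 1"
    and fg: "\<And>z. cmod z = 1 \<Longrightarrow> (1 - p * z) * f z = g z"
  shows "f \<in> plus_part L2" and "fourier f k = p * fourier f (k - 1) + fourier g k"
proof -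
  have zf: "(\<lambda>z. p * (z powi 1 * f z)) \<in> L2"
    using L2_cmult[OF L2_powi_mult[OF f, of 1], of p] by (simp add: mult.commute)
  have rec: "fourier f k = p * fourier f (k - 1) + fourier g k" for k
  proof -
    have "fourier g k = fourier (\<lambda>z. f z - p * (z powi 1 * f z)) k"
      using fg by (intro fourier_cong) (simp add: algebra_simps)
    also have "\<dots> = fourier f k - p * fourier f (k - 1)"
      unfolding fourier_diff[OF f zf] fourier_cmult fourier_powi_mult ..
    finally show ?thesis by simp
  qed
  show "fourier f k = p * fourier f (k - 1) + fourier g k" by (rule rec)
  have "fourier f k = 0" if k: "k < 0" for k
  proof -
    \<comment> \<open>Below frequency 0 the recursion is homogeneous. Run towards minus infinity it
      multiplies bounded coefficients by powers of \<open>p\<close>, which forces them to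
      vanish.\<close>
    have it: "fourier f k = p ^ n * fourier f (k - int n)" for n
    proof (induction n)
      case (Suc n)
      have "fourier g (k - int n) = 0" using k by (intro plus_partD(2)[OF g]) simp
      then show ?case using Suc rec[of "k - int n"] by (simp add: algebra_simps)
    qed simp
    have "(\<lambda>n. cmod p ^ n * L2_norm f) \<longlonglongrightarrow> 0 * L2_norm f"
      using p by (intro tendsto_intros LIMSEQ_power_zero) simp
    moreover have "cmod (fourier f k) \<le> cmod p ^ n * L2_norm f" for n
    proof -
      have "cmod (fourier f k) = cmod p ^ n * cmod (fourier f (k - int n))"
        using it[of n] by (metis norm_mult norm_power)
      then show ?thesis using cmod_fourier_le[OF f] by (simp add: mult_left_mono)
    qed
    ultimately have "cmod (fourier f k) \<le> 0"
      by (intro LIMSEQ_le_const[where X = "\<lambda>n. cmod p ^ n * L2_norm f"]) auto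
    then show ?thesis by simp
  qed
  then show "f \<in> plus_part L2" using f by (simp add: plus_part_def)
qed

section \<open>The functions 1, \<open>phi p\<close> and its square, with their Fourier
  coefficients\<close>

definition phi :: "complex \<Rightarrow> complex \<Rightarrow> complex" where
  "phi p z = z / (1 - p * z)"

lemma ratf_phi: "ratf b B p = (\<lambda>z. b + B * phi p z)"
  by (auto simp: ratf_def phi_def)

lemma continuous_phi: "cmod p < 1 \<Longrightarrow> continuous_on (sphere 0 1) (phi p)"
  unfolding phi_def using one_minus_mult_nz by (auto intro!: continuous_intros)

lemma phi_L2: "cmod p < 1 \<Longrightarrow> phi p \<in> L2"
  by (intro L2I_continuous continuous_phi)

lemma id_plus: "(\<lambda>z. z) \<in> plus_part L2"
  using fourier_powi[of 1] L2_powi[of 1] by (auto simp: plus_part_def)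

lemma phi_plus: "cmod p < 1 \<Longrightarrow> phi p \<in> plus_part L2"
  by (rule fourier_geometric(1)[OF phi_L2 id_plus])
    (auto simp: phi_def mult_neq_1)

lemma fourier_phi:
  assumes p: "cmod p < 1"
  shows "fourier (phi p) (int n) = (if n = 0 then 0 else p ^ (n - 1))"
proof -
  have rec: "fourier (phi p) k = p * fourier (phi p) (k - 1) + fourier (\<lambda>z. z) k" for k
    by (rule fourier_geometric(2)[OF phi_L2[OF p] id_plus p]) (auto simp: phi_def mult_neq_1[OF p])
  have z: "fourier (\<lambda>z. z) k = (if k = 1 then 1 else 0)" for k
    using fourier_powi[of 1 k] by auto
  have phi0: "fourier (phi p) 0 = 0"
    using rec[of 0] plus_partD(2)[OF phi_plus[OF p], of "-1"] by (simp add: z)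
  have "fourier (phi p) (int (Suc n)) = p ^ n" for n
  proof (induction n)
    case 0
    then show ?case using rec[of 1] phi0 by (simp add: z)
  next
    case (Suc n)
    then show ?case using rec[of "int (Suc (Suc n))"] by (simp add: z)
  qed
  from this[of "n - 1"] show ?thesis using phi0 by (cases n) auto
qed

lemma phi_sq_L2: "cmod p < 1 \<Longrightarrow> (\<lambda>z. phi p z * phi p z) \<in> L2"
  by (intro L2I_continuous continuous_intros continuous_phi)

lemma phi_sq_plus: "cmod p < 1 \<Longrightarrow> (\<lambda>z. phi p z * phi p z) \<in> plus_part L2"
  using phi_sq_L2 by (simp add: plus_part_def fourier_mult[OF phi_plus phi_plus])

lemma fourier_phi_sq:
  assumes p: "cmod p < 1"
  shows "fourier (\<lambda>z. phi p z * phi p z) 0 = 0" "fourier (\<lambda>z. phi p z * phi p z) 1 = 0"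
    "fourier (\<lambda>z. phi p z * phi p z) 2 = 1"
  using fourier_phi[OF p, of 0] fourier_phi[OF p, of 1] fourier_phi[OF p, of 2]
  by (simp_all add: fourier_mult[OF phi_plus[OF p] phi_plus[OF p]] numeral_2_eq_2)

text \<open>This span contains both the time derivative of a \<open>ratf\<close> and the projection
  of its cubic term, so the equation reduces to matching three coefficients.\<close>

definition quadf :: "complex \<Rightarrow> complex \<Rightarrow> complex \<Rightarrow> complex \<Rightarrow> complex \<Rightarrow> complex" where
  "quadf c0 c1 c2 p = (\<lambda>z. c0 + c1 * phi p z + c2 * (phi p z * phi p z))"

lemma fourier_const: "fourier (\<lambda>z. c) k = (if k = 0 then c else 0)"
  using fourier_cmult[of c "\<lambda>z. z powi 0" k] fourier_powi[of 0 k] by auto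

lemma fourier_quadf:
  assumes "cmod p < 1"
  shows "fourier (quadf c0 c1 c2 p) k = (if k = 0 then c0 else 0) + c1 * fourier (phi p) k
     + c2 * fourier (\<lambda>z. phi p z * phi p z) k"
  unfolding quadf_def using assms
  by (simp add: fourier_add L2_add L2_const L2_cmult phi_L2 phi_sq_L2 fourier_cmult fourier_const)

lemma quadf_plus: "cmod p < 1 \<Longrightarrow> quadf c0 c1 c2 p \<in> plus_part L2"
  by (auto simp: plus_part_def fourier_quadf plus_partD(2)[OF phi_plus] plus_partD(2)[OF phi_sq_plus])
    (auto simp: quadf_def intro!: L2_add L2_const L2_cmult phi_L2 phi_sq_L2)

lemma ratf_quadf: "ratf b B p = quadf b B 0 p"
  by (simp add: ratf_phi quadf_def)

definition ratf_coeff :: "complex \<Rightarrow> complex \<Rightarrow> complex \<Rightarrow> nat \<Rightarrow> complex" where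
  "ratf_coeff b B p n = (if n = 0 then b else B * p ^ (n - 1))"

lemma fourier_ratf: "cmod p < 1 \<Longrightarrow> fourier (ratf b B p) (int n) = ratf_coeff b B p n"
  unfolding ratf_quadf by (simp add: fourier_quadf fourier_phi ratf_coeff_def)

lemma ratf_plus: "cmod p < 1 \<Longrightarrow> ratf b B p \<in> plus_part L2"
  unfolding ratf_quadf by (rule quadf_plus)

lemma summable_weighted_geometric:
  assumes "0 \<le> r" "r < 1"
  shows "summable (\<lambda>n. (1 + real n) * (K * r ^ (n - 1))\<^sup>2)"
proof (rule summable_comparison_test)
  have r2: "norm (r\<^sup>2) < 1" using assms by (simp add: abs_square_less_1)
  have "summable (\<lambda>n. K\<^sup>2 * (3 * (of_nat (Suc n) * (r\<^sup>2) ^ n)))"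
    by (intro summable_mult sums_summable[OF geometric_deriv_sums[OF r2]])
  then have "summable (\<lambda>n. K\<^sup>2 * (3 * (of_nat (Suc (n - 1)) * (r\<^sup>2) ^ (n - 1))))"
    by (subst summable_Suc_iff[symmetric]) simp
  then show "summable (\<lambda>n. K\<^sup>2 * (3 * (of_nat (Suc (n - 1)) * (r\<^sup>2) ^ (n - 1))))" .
  show "\<exists>N. \<forall>n\<ge>N. norm ((1 + real n) * (K * r ^ (n - 1))\<^sup>2) \<le> K\<^sup>2 * (3 * (of_nat (Suc (n - 1)) * (r\<^sup>2) ^ (n - 1)))"
  proof (intro exI[of _ 0] allI impI)
    fix n :: nat
    \<comment> \<open>Truncated subtraction gives the indices 0 and 1 the same power of
      \<open>r\<close>; the factor 3 covers both cases.\<close>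
    have "1 + real n \<le> 3 * real (Suc (n - 1))" by (cases n) auto
    then have "(1 + real n) * (K\<^sup>2 * (r\<^sup>2) ^ (n - 1)) \<le> (3 * real (Suc (n - 1))) * (K\<^sup>2 * (r\<^sup>2) ^ (n - 1))"
      by (rule mult_right_mono) auto
    moreover have "(K * r ^ (n - 1))\<^sup>2 = K\<^sup>2 * (r\<^sup>2) ^ (n - 1)"
      by (simp add: power_mult_distrib mult.commute flip: power_mult)
    moreover have "norm ((1 + real n) * (K * r ^ (n - 1))\<^sup>2) = (1 + real n) * (K * r ^ (n - 1))\<^sup>2"
      by simp
    ultimately show "norm ((1 + real n) * (K * r ^ (n - 1))\<^sup>2) \<le> K\<^sup>2 * (3 * (of_nat (Suc (n - 1)) * (r\<^sup>2) ^ (n - 1)))"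
      by (simp only: mult_ac)
  qed
qed

lemma ratf_coeff_le:
  assumes "cmod b \<le> K" "cmod B \<le> K" "cmod p \<le> r"
  shows "cmod (ratf_coeff b B p n) \<le> K * r ^ (n - 1)"
proof -
  have K: "0 \<le> K" using assms(1) norm_ge_zero order_trans by blast
  have "cmod B * cmod p ^ (n - 1) \<le> K * r ^ (n - 1)"
    using assms K by (intro mult_mono power_mono) auto
  then show ?thesis using assms by (simp add: ratf_coeff_def norm_mult norm_power)
qed

lemma ratf_Hhalf:
  assumes p: "cmod p < 1" shows "ratf b B p \<in> plus_part Hhalf"
proof -
  define K where "K = max (cmod b) (cmod B)"
  have "summable (Hhalf_term (ratf b B p))"
  proof (rule summable_comparison_test'[OF summable_weighted_geometric[of "cmod p" K], of 0])
    fix n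
    have "(cmod (fourier (ratf b B p) (int n)))\<^sup>2 \<le> (K * cmod p ^ (n - 1))\<^sup>2"
      unfolding fourier_ratf[OF p] by (intro power_mono ratf_coeff_le) (auto simp: K_def)
    then show "norm (Hhalf_term (ratf b B p) n) \<le> (1 + real n) * (K * cmod p ^ (n - 1))\<^sup>2"
      unfolding Hhalf_term_def by (simp add: mult_left_mono)
  qed (use p in auto)
  then show ?thesis using ratf_plus[OF p] by (simp add: plus_part_Hhalf_iff)
qed

text \<open>Tannery's theorem: near the limit all poles are controlled by a common radius
  \<open>r < 1\<close>, so the weighted coefficients have a summable majorant. The lemma serves both
  the continuity in time of the explicit flow and the compactness of its values as epsilon tends to
  0.\<close>

lemma ratf_tendsto_Hhalf:
  assumes b: "(b \<longlongrightarrow> b') F" and B: "(B \<longlongrightarrow> B') F" and p: "(p \<longlongrightarrow> p') F"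
    and p1: "cmod p' < 1" and F: "F \<noteq> bot"
  shows "((\<lambda>s. Hhalf_norm (\<lambda>z. ratf (b s) (B s) (p s) z - ratf b' B' p' z)) \<longlongrightarrow> 0) F"
proof -
  obtain r where r: "cmod p' < r" "r < 1" using dense[OF p1] by blast
  have r0: "0 \<le> r" using r(1) norm_ge_zero[of p'] by linarith
  define K where "K = max (cmod b') (cmod B') + 1"
  have "\<forall>\<^sub>F s in F. cmod (b s) < K" "\<forall>\<^sub>F s in F. cmod (B s) < K" "\<forall>\<^sub>F s in F. cmod (p s) < r"
    using r by (auto intro!: order_tendstoD(2)[OF tendsto_norm] b B p simp: K_def)
  then have ev: "\<forall>\<^sub>F s in F. cmod (b s) \<le> K \<and> cmod (B s) \<le> K \<and> cmod (p s) \<le> r"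
    by eventually_elim auto
  define d where "d = (\<lambda>s z. ratf (b s) (B s) (p s) z - ratf b' B' p' z)"
  define a where "a = (\<lambda>n s. (1 + real n) * (cmod (ratf_coeff (b s) (B s) (p s) n - ratf_coeff b' B' p' n))\<^sup>2)"
  have "((\<lambda>s. suminf (\<lambda>n. a n s)) \<longlongrightarrow> suminf (\<lambda>n. 0)) F"
  proof (rule tannerys_theorem[THEN conjunct2, THEN conjunct2])
    show "((\<lambda>s. a n s) \<longlongrightarrow> 0) F" for n
    proof -
      have "((\<lambda>s. ratf_coeff (b s) (B s) (p s) n) \<longlongrightarrow> ratf_coeff b' B' p' n) F"
        unfolding ratf_coeff_def using b B p by (auto intro!: tendsto_intros)
      then have "((\<lambda>s. a n s) \<longlongrightarrow> (1 + real n) * (cmod (ratf_coeff b' B' p' n - ratf_coeff b' B' p' n))\<^sup>2) F"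
        unfolding a_def by (intro tendsto_intros)
      then show ?thesis by simp
    qed
    show "\<forall>\<^sub>F (n, s) in sequentially \<times>\<^sub>F F. norm (a n s) \<le> (1 + real n) * ((2 * K) * r ^ (n - 1))\<^sup>2"
    proof (rule eventually_mono[OF eventually_prodI[OF eventually_True ev]])
      fix ns :: "nat \<times> 'a" assume "True \<and> cmod (b (snd ns)) \<le> K \<and> cmod (B (snd ns)) \<le> K \<and> cmod (p (snd ns)) \<le> r"
      moreover obtain n s where ns: "ns = (n, s)" by fastforce
      ultimately have s: "cmod (b s) \<le> K" "cmod (B s) \<le> K" "cmod (p s) \<le> r" by auto
      have "cmod (ratf_coeff b' B' p' n) \<le> K * r ^ (n - 1)"
        using r by (intro ratf_coeff_le) (auto simp: K_def)
      then have "cmod (ratf_coeff (b s) (B s) (p s) n - ratf_coeff b' B' p' n) \<le> 2 * K * r ^ (n - 1)"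
        using ratf_coeff_le[OF s, of n] norm_triangle_ineq4[of "ratf_coeff (b s) (B s) (p s) n" "ratf_coeff b' B' p' n"]
        by linarith
      then have "(cmod (ratf_coeff (b s) (B s) (p s) n - ratf_coeff b' B' p' n))\<^sup>2 \<le> ((2 * K) * r ^ (n - 1))\<^sup>2"
        by (intro power_mono) auto
      then show "case ns of (n, s) \<Rightarrow> norm (a n s) \<le> (1 + real n) * ((2 * K) * r ^ (n - 1))\<^sup>2"
        unfolding ns a_def by (simp add: mult_left_mono)
    qed
    show "summable (\<lambda>n. (1 + real n) * ((2 * K) * r ^ (n - 1))\<^sup>2)"
      using r0 r(2) by (rule summable_weighted_geometric)
  qed (rule F)
  then have "((\<lambda>s. sqrt (suminf (\<lambda>n. a n s))) \<longlongrightarrow> sqrt 0) F"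
    by (intro tendsto_intros) simp
  moreover have "\<forall>\<^sub>F s in F. sqrt (suminf (\<lambda>n. a n s)) = Hhalf_norm (d s)"
    using ev
  proof eventually_elim
    case (elim s)
    then have ps: "cmod (p s) < 1" using r by linarith
    have "d s \<in> plus_part Hhalf"
      unfolding d_def by (intro plus_part_Hhalf_diff ratf_Hhalf ps p1)
    then have "Hhalf_term (d s) sums (Hhalf_norm (d s))\<^sup>2" by (rule Hhalf_norm_sums)
    moreover have "Hhalf_term (d s) = (\<lambda>n. a n s)"
      unfolding Hhalf_term_def a_def d_def
      by (simp add: fourier_diff plus_partD(1)[OF ratf_plus] ps p1 fourier_ratf)
    ultimately have "suminf (\<lambda>n. a n s) = (Hhalf_norm (d s))\<^sup>2" by (simp add: sums_iff)
    then show ?case by simp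
  qed
  ultimately have "((\<lambda>s. Hhalf_norm (d s)) \<longlongrightarrow> 0) F"
    by (simp add: tendsto_cong)
  then show ?thesis by (simp only: d_def)
qed

text \<open>The projection of the cubic term of \<open>ratf b B p\<close> in the basis 1,
  \<open>phi p\<close>, \<open>phi p\<close> squared. The parameter \<open>i\<close> stands for 1 /
  (1 - |p|^2), the squared \<open>L2\<close> norm of \<open>phi p\<close>.\<close>

abbreviation projf :: "complex \<Rightarrow> complex \<Rightarrow> complex \<Rightarrow> complex \<Rightarrow> complex \<Rightarrow> complex" where
  "projf b B p i \<equiv> quadf
    (b * b * cnj b + cnj B * B * (2 * b * i + B * cnj p * i\<^sup>2))
    (2 * b * cnj b * B + cnj B * B * (B * i\<^sup>2 + 2 * b * p * i))
    (cnj b * B * B + cnj B * B * B * p * i) p"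

text \<open>
  On the circle \<open>u\<^sup>2 cnj u\<close> differs from its analytic part by a multiple of
  \<open>cnj (phi p z) = 1 / (z - cnj p)\<close>.
\<close>

lemma cubic_ratf:
  assumes p: "cmod p < 1" and z: "cmod z = 1"
    and i: "i = 1 / (1 - p * cnj p)"
  shows "cubic (ratf b B p) z - projf b B p i z =
    cnj B * (b + B * cnj p * i)\<^sup>2 * cnj (phi p z)"
proof -
  have nz: "1 - p * z \<noteq> 0" by (rule one_minus_mult_nz[OF p z])
  have pp: "p * cnj p = of_real ((cmod p)\<^sup>2)" by (simp only: complex_norm_square)
  have "(cmod p)\<^sup>2 < 1" using p by (simp add: power_less_one_iff)
  then have pp1: "1 - p * cnj p \<noteq> 0" unfolding pp by (metis eq_iff_diff_eq_0 less_irrefl of_real_eq_1_iff)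
  have zz: "z * cnj z = 1" using z by (simp add: complex_norm_square[symmetric])
  define X where "X = phi p z"
  define Y where "Y = cnj (phi p z)"
  have z0: "z \<noteq> 0" using z by auto
  have cz: "cnj z = 1 / z" using zz z0 by (simp add: field_simps)
  have zp: "z - cnj p \<noteq> 0" using p z by (metis complex_mod_cnj eq_iff_diff_eq_0 less_irrefl)
  have Y: "Y = 1 / (z - cnj p)"
    using z0 zp by (simp add: Y_def phi_def cz field_simps)
  have X: "X = z / (1 - p * z)" by (simp add: X_def phi_def)
  \<comment> \<open>Partial fractions separate the pole of \<open>X\<close>, outside the closed
    disc, from the pole of \<open>Y\<close>, inside it. Applying this twice linearises the cubic
    expression.\<close>
  have XY: "X * Y = i * (1 + p * X + cnj p * Y)"
    unfolding X Y i using nz zp pp1 by (simp add: divide_simps) (simp add: algebra_simps)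
  have iD: "i * (1 - p * cnj p) = 1" unfolding i using pp1 by simp
  have "i\<^sup>2 - i\<^sup>2 * (p * cnj p) = i * (i * (1 - p * cnj p))"
    by (simp add: algebra_simps power2_eq_square)
  \<comment> \<open>This makes the coefficient \<open>i + i\<^sup>2 * (p * cnj p)\<close> of
    \<open>X\<close> collapse to \<open>i\<^sup>2\<close>.\<close>
  then have ii: "i = i\<^sup>2 - i\<^sup>2 * (p * cnj p)" unfolding iD by simp
  have "X * X * Y = X * (X * Y)" by simp
  also have "\<dots> = X * (i * (1 + p * X + cnj p * Y))" by (simp only: XY)
  also have "\<dots> = i * (X + p * X * X + cnj p * (X * Y))" by (simp add: algebra_simps)
  finally have XXY: "X * X * Y = i * (X + p * X * X + cnj p * (X * Y))" .
  have "cubic (ratf b B p) z = ratf b B p z * ratf b B p z * cnj (ratf b B p z)"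
    by (simp only: cubic_def complex_norm_square mult_ac)
  also have "\<dots> = (b + B * X) * (b + B * X) * (cnj b + cnj B * Y)"
    by (simp add: ratf_phi X_def Y_def)
  also have "\<dots> = b * b * cnj b + 2 * b * B * cnj b * X + B * B * cnj b * (X * X)
      + cnj B * (b * b * Y + 2 * b * B * (X * Y) + B * B * (X * X * Y))"
    by (simp add: algebra_simps)
  also have "\<dots> = b * b * cnj b + 2 * b * B * cnj b * X + B * B * cnj b * (X * X)
      + cnj B * (b * b * Y + 2 * b * B * (i * (1 + p * X + cnj p * Y))
        + B * B * (i * (X + p * X * X + cnj p * (i * (1 + p * X + cnj p * Y)))))"
    unfolding XXY XY ..
  also have "\<dots> = b * b * cnj b + 2 * b * B * cnj b * X + B * B * cnj b * (X * X)
      + cnj B * (b * b * Y + 2 * b * B * (i * (1 + p * X + cnj p * Y))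
        + B * B * ((i\<^sup>2 - i\<^sup>2 * (p * cnj p)) * X + i * p * X * X + i\<^sup>2 * cnj p * (1 + p * X + cnj p * Y)))"
    unfolding ii[symmetric] by (simp add: algebra_simps power2_eq_square)
  finally show ?thesis
    unfolding quadf_def Y_def[symmetric] unfolding X_def[symmetric]
    by (simp add: algebra_simps power2_eq_square)
qed

lemma continuous_cubic_ratf: "cmod p < 1 \<Longrightarrow> continuous_on (sphere 0 1) (cubic (ratf b B p))"
  unfolding cubic_def by (intro continuous_intros continuous_ratf)

text \<open>The remainder found in \<open>cubic_ratf\<close> is a multiple of
  \<open>cnj (phi p z)\<close>. Its inner product with \<open>h\<close> is the conjugate of the mean
  of \<open>phi p * h\<close>, up to that factor, and this mean is 0 because \<open>phi p\<close>
  has no constant term.\<close>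

lemma szego_projection_ratf:
  assumes p: "cmod p < 1" and i: "i = 1 / (1 - p * cnj p)"
  shows "is_szego_projection (cubic (ratf b B p)) (projf b B p i)"
  unfolding is_szego_projection_def
proof (intro conjI ballI)
  show "cubic (ratf b B p) \<in> L2" by (intro L2I_continuous continuous_cubic_ratf p)
  fix h assume h: "h \<in> plus_part L2"
  define C where "C = cnj B * (b + B * cnj p * i)\<^sup>2"
  have "L2_inner (\<lambda>z. cubic (ratf b B p) z - projf b B p i z) h = L2_inner (\<lambda>z. C * cnj (phi p z)) h"
    unfolding C_def by (intro L2_inner_cong cubic_ratf p i)
  also have "\<dots> = C * cnj (fourier (\<lambda>z. phi p z * h z) 0)"
    unfolding L2_inner_cmult_left
    by (simp add: L2_inner_def fourier_def flip: Bochner_Integration.integral_cnj)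
  also have "fourier (\<lambda>z. phi p z * h z) 0 = 0"
    using fourier_phi[OF p, of 0] by (simp add: fourier_mult[OF phi_plus[OF p] h])
  finally show "L2_inner (\<lambda>z. cubic (ratf b B p) z - projf b B p i z) h = 0" by simp
qed (rule quadf_plus[OF p])

section \<open>Time derivatives of rational functions with moving coefficients\<close>

lemma vector_derivative_quotient:
  fixes f :: "real \<Rightarrow> complex"
  assumes "(f has_vector_derivative f') (at t)"
  shows "((\<lambda>h. (f (t + h) - f t) / of_real h) \<longlongrightarrow> f') (at 0)"
proof -
  have "(\<lambda>h. norm (f (t + h) - f t - h *\<^sub>R f') / norm h) \<midarrow>0\<rightarrow> 0"
    using assms unfolding has_vector_derivative_def has_derivative_at by blast
  moreover have "\<forall>\<^sub>F h in at 0. norm (f (t + h) - f t - h *\<^sub>R f') / norm h = norm ((f (t + h) - f t) / of_real h - f')"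
    unfolding eventually_at_filter
  proof (intro always_eventually allI impI)
    fix h :: real assume h: "h \<noteq> 0"
    have "(f (t + h) - f t) / of_real h - f' = (f (t + h) - f t - h *\<^sub>R f') / of_real h"
      using h by (simp add: diff_divide_distrib scaleR_conv_of_real)
    then show "norm (f (t + h) - f t - h *\<^sub>R f') / norm h = norm ((f (t + h) - f t) / of_real h - f')"
      by (simp add: norm_divide)
  qed
  ultimately have "(\<lambda>h. norm ((f (t + h) - f t) / of_real h - f')) \<midarrow>0\<rightarrow> 0"
    by (simp add: tendsto_cong)
  then show ?thesis
    using tendsto_norm_zero_iff LIM_zero_cancel by blast
qed

lemma cmod_phi_le:
  assumes "cmod p \<le> r" "r < 1" "cmod z = 1" shows "cmod (phi p z) \<le> 1 / (1 - r)"
proof -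
  have "1 - r \<le> cmod (1 - p * z)"
    using norm_triangle_ineq2[of 1 "p * z"] assms by (simp add: norm_mult)
  then show ?thesis using assms by (simp add: phi_def norm_divide frac_le)
qed

lemma phi_diff:
  assumes "cmod p < 1" "cmod q < 1" "cmod z = 1"
  shows "phi p z - phi q z = (p - q) * (phi p z * phi q z)"
  using one_minus_mult_nz[OF assms(1,3)] one_minus_mult_nz[OF assms(2,3)]
  by (simp add: phi_def divide_simps) (simp add: algebra_simps)

text \<open>By \<open>phi_diff\<close> the derivative of \<open>phi p\<close> in \<open>p\<close> is
  its square, which explains the last coefficient. The difference quotient converges uniformly on
  the circle, with the explicit majorant \<open>bd\<close>, and the \<open>L2\<close> statement
  follows.\<close>

lemma ratf_deriv_L2:
  assumes b: "(b has_vector_derivative b') (at t)" and B: "(B has_vector_derivative B') (at t)"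
    and p: "(p has_vector_derivative p') (at t)" and p1: "\<And>s. cmod (p s) < 1"
  shows "((\<lambda>h. L2_norm (\<lambda>z. \<i> * ((ratf (b (t + h)) (B (t + h)) (p (t + h)) z - ratf (b t) (B t) (p t) z) / of_real h)
      - quadf (\<i> * b') (\<i> * B') (\<i> * p' * B t) (p t) z)) \<longlongrightarrow> 0) (at 0)"
proof -
  let ?D = "\<lambda>h z. \<i> * ((ratf (b (t + h)) (B (t + h)) (p (t + h)) z - ratf (b t) (B t) (p t) z) / of_real h)
      - quadf (\<i> * b') (\<i> * B') (\<i> * p' * B t) (p t) z"
  obtain r where r: "cmod (p t) < r" "r < 1" using dense[OF p1] by blast
  define K where "K = 1 / (1 - r)"
  have K0: "0 \<le> K" using r by (simp add: K_def)
  define qb where "qb = (\<lambda>h. (b (t + h) - b t) / of_real h)"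
  define qB where "qB = (\<lambda>h. (B (t + h) - B t) / of_real h)"
  define qp where "qp = (\<lambda>h. (p (t + h) - p t) / of_real h)"
  have lims: "(qb \<longlongrightarrow> b') (at 0)" "(qB \<longlongrightarrow> B') (at 0)" "(qp \<longlongrightarrow> p') (at 0)"
    unfolding qb_def qB_def qp_def by (intro vector_derivative_quotient b B p)+
  have pc: "((\<lambda>h. p (t + h)) \<longlongrightarrow> p t) (at 0)"
    using has_vector_derivative_continuous[OF p] by (simp add: continuous_at LIM_offset_zero_iff)
  define bd where "bd = (\<lambda>h. cmod (qb h - b') + (cmod (qB h - B') * K + cmod B' * (cmod (p (t + h) - p t) * K * K))
     + cmod (B t) * (cmod (qp h - p') * K * K + cmod p' * (cmod (p (t + h) - p t) * K * K * K)))"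
  show ?thesis
  proof (rule Lim_null_comparison)
    have "\<forall>\<^sub>F h in at 0. cmod (p (t + h)) < r"
      by (rule order_tendstoD(2)[OF tendsto_norm[OF pc] r(1)])
    moreover have "\<forall>\<^sub>F h in at 0. h \<noteq> (0::real)" by (simp add: eventually_at_filter)
    ultimately show "\<forall>\<^sub>F h in at 0. norm (L2_norm (\<lambda>z. ?D h z)) \<le> bd h"
    proof eventually_elim
      case (elim h)
      have "L2_norm (\<lambda>z. ?D h z) \<le> bd h"
      proof (rule L2_norm_le_bound)
        fix z :: complex assume z: "cmod z = 1"
        define X where "X = phi (p t) z"
        define Y where "Y = phi (p (t + h)) z"
        have XY: "cmod X \<le> K" "cmod Y \<le> K"
          unfolding X_def Y_def K_def using r elim z by (auto intro!: cmod_phi_le)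
        have d: "Y - X = (p (t + h) - p t) * (X * Y)"
          unfolding X_def Y_def using phi_diff[OF p1 p1 z] by (simp add: mult_ac)
        have YX: "cmod (Y - X) \<le> cmod (p (t + h) - p t) * K * K"
          unfolding d norm_mult mult.assoc using XY K0 by (intro mult_left_mono mult_mono) auto
        have "(ratf (b (t + h)) (B (t + h)) (p (t + h)) z - ratf (b t) (B t) (p t) z) / of_real h
          = qb h + qB h * Y + B t * ((Y - X) / of_real h)"
          unfolding ratf_phi X_def[symmetric] Y_def[symmetric] qb_def qB_def
          using elim(2) by (simp add: field_simps)
        also have "(Y - X) / of_real h = qp h * (X * Y)"
          unfolding d qp_def by simp
        finally have "?D h z
          = \<i> * ((qb h - b') + ((qB h - B') * Y + B' * (Y - X)) + B t * ((qp h - p') * (X * Y) + p' * ((Y - X) * X)))"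
          by (simp add: quadf_def X_def[symmetric] algebra_simps)
        also have "cmod \<dots> = cmod ((qb h - b') + ((qB h - B') * Y + B' * (Y - X)) + B t * ((qp h - p') * (X * Y) + p' * ((Y - X) * X)))"
          by (simp add: norm_mult)
        also have "\<dots> \<le> cmod (qb h - b') + (cmod ((qB h - B') * Y) + cmod (B' * (Y - X)))
           + cmod (B t) * (cmod ((qp h - p') * (X * Y)) + cmod (p' * ((Y - X) * X)))"
          unfolding norm_mult[of "B t"]
          by (intro order_trans[OF norm_triangle_ineq] add_mono order_refl norm_triangle_ineq)
             (auto simp: norm_mult intro!: mult_left_mono order_trans[OF norm_triangle_ineq] add_mono)
        also have "\<dots> \<le> bd h"
        proof -
          have "cmod ((qB h - B') * Y) \<le> cmod (qB h - B') * K"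
            unfolding norm_mult using XY by (intro mult_left_mono) auto
          moreover have "cmod (B' * (Y - X)) \<le> cmod B' * (cmod (p (t + h) - p t) * K * K)"
            unfolding norm_mult using YX by (intro mult_left_mono) auto
          moreover have "cmod ((qp h - p') * (X * Y)) \<le> cmod (qp h - p') * K * K"
            unfolding norm_mult mult.assoc using XY K0 by (intro mult_left_mono mult_mono) auto
          moreover have "cmod (p' * ((Y - X) * X)) \<le> cmod p' * (cmod (p (t + h) - p t) * K * K * K)"
            unfolding norm_mult using XY K0 YX by (intro mult_left_mono mult_mono) auto
          ultimately show ?thesis
            unfolding bd_def by (intro add_mono mult_left_mono order_refl) auto
        qed
        finally show "cmod (?D h z) \<le> bd h" .
      qed
      then show ?case by simp
    qed
    have "(bd \<longlongrightarrow> cmod (b' - b') + (cmod (B' - B') * K + cmod B' * (cmod (p t - p t) * K * K))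
     + cmod (B t) * (cmod (p' - p') * K * K + cmod p' * (cmod (p t - p t) * K * K * K))) (at 0)"
      unfolding bd_def by (intro tendsto_intros lims pc)
    then show "(bd \<longlongrightarrow> 0) (at 0)" by simp
  qed
qed

text \<open>The three equations match coefficients in \<open>quadf\<close>. In the last one the
  factor \<open>B t\<close> stays on the left, so nothing is divided by \<open>B t\<close>.\<close>

lemma szego_solution_ratf:
  assumes b: "\<And>t. (b has_vector_derivative b' t) (at t)" and B: "\<And>t. (B has_vector_derivative B' t) (at t)"
    and p: "\<And>t. (p has_vector_derivative p' t) (at t)" and p1: "\<And>s. cmod (p s) < 1"
    and i: "\<And>t. i t = 1 / (1 - p t * cnj (p t))"
    and ode: "\<And>t. \<i> * b' t = b t * b t * cnj (b t) + cnj (B t) * B t * (2 * b t * i t + B t * cnj (p t) * (i t)\<^sup>2)"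
      "\<And>t. \<i> * B' t = 2 * b t * cnj (b t) * B t + cnj (B t) * B t * (B t * (i t)\<^sup>2 + 2 * b t * p t * i t)"
      "\<And>t. \<i> * p' t * B t = cnj (b t) * B t * B t + cnj (B t) * B t * B t * p t * i t"
    and u0: "\<And>z. cmod z = 1 \<Longrightarrow> u0 z = ratf (b 0) (B 0) (p 0) z"
  shows "szego_solution u0 (\<lambda>t. ratf (b t) (B t) (p t))"
  unfolding szego_solution_def
proof (intro conjI allI)
  fix t
  show "ratf (b t) (B t) (p t) \<in> plus_part Hhalf" by (intro ratf_Hhalf p1)
  have c: "(b \<longlongrightarrow> b t) (at t)" "(B \<longlongrightarrow> B t) (at t)" "(p \<longlongrightarrow> p t) (at t)"
    using has_vector_derivative_continuous[OF b] has_vector_derivative_continuous[OF B]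
      has_vector_derivative_continuous[OF p] by (auto simp: continuous_at)
  show "((\<lambda>s. Hhalf_norm (\<lambda>z. ratf (b s) (B s) (p s) z - ratf (b t) (B t) (p t) z)) \<longlongrightarrow> 0) (at t)"
    by (intro ratf_tendsto_Hhalf c p1) simp
  show "\<exists>g. is_szego_projection (\<lambda>z. of_real ((cmod (ratf (b t) (B t) (p t) z))\<^sup>2) * ratf (b t) (B t) (p t) z) g \<and>
      ((\<lambda>h. L2_norm (\<lambda>z. \<i> * ((ratf (b (t + h)) (B (t + h)) (p (t + h)) z - ratf (b t) (B t) (p t) z) / of_real h) - g z)) \<longlongrightarrow> 0) (at 0)"
  proof (intro exI conjI)
    show "is_szego_projection (\<lambda>z. of_real ((cmod (ratf (b t) (B t) (p t) z))\<^sup>2) * ratf (b t) (B t) (p t) z)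
       (quadf (\<i> * b' t) (\<i> * B' t) (\<i> * p' t * B t) (p t))"
      using szego_projection_ratf[OF p1 i, of "b t" "B t" t]
      unfolding ode[symmetric] by (simp add: cubic_def)
  qed (rule ratf_deriv_L2[OF b B p p1])
next
  show "AE z in circle_measure. ratf (b 0) (B 0) (p 0) z = u0 z"
    using u0 by (intro AE_I2) simp
qed

lemma fourier_szego_projection:
  assumes "is_szego_projection f g"
  shows "fourier g (int k) = fourier f (int k)"
proof -
  have "(\<lambda>z. z powi int k) \<in> plus_part L2"
    by (auto simp: plus_part_def L2_powi fourier_powi simp del: power_int_of_nat)
  then have "fourier (\<lambda>z. f z - g z) (int k) = 0"
    using assms unfolding fourier_eq_inner is_szego_projection_def by blast
  then show ?thesis
    using assms by (simp add: is_szego_projection_def fourier_diff plus_part_def)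
qed

text \<open>A stationary datum is an eigenvector: the projection of its cubic term equals omega
  times the datum. The datum has no component on the square of \<open>phi p\<close>, so that
  coefficient of the projection must vanish, and it is B^2 times the asserted expression divided by
  1 - |p|^2.\<close>

lemma stationary_wave_ratf:
  assumes st: "stationary_wave u0" and u0: "\<And>z. cmod z = 1 \<Longrightarrow> u0 z = ratf b B p z"
    and p: "cmod p < 1" and B: "B \<noteq> 0"
  shows "cnj b * (1 - p * cnj p) + cnj B * p = 0"
proof -
  obtain \<omega> :: real where "szego_solution u0 (\<lambda>t z. exp (- \<i> * of_real (\<omega> * t)) * u0 z)"
    using st by (auto simp: stationary_wave_def)
  note D = szego_solutionD[OF this]
  have u0L: "u0 \<in> L2" using D(2)[of 0] by simp
  obtain g where g: "is_szego_projection (cubic u0) g" and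
     lim: "((\<lambda>h. L2_norm (\<lambda>z. \<i> * ((exp (- \<i> * of_real (\<omega> * h)) * u0 z - u0 z) / of_real h) - g z)) \<longlongrightarrow> 0) (at 0)"
    using D(5)[of 0] by auto
  let ?D = "\<lambda>h z. \<i> * ((exp (- \<i> * of_real (\<omega> * h)) * u0 z - u0 z) / of_real h) - g z"
  have gL: "g \<in> L2" using g by (auto simp: is_szego_projection_def plus_part_def)
  define e where "e = (\<lambda>h. \<i> * ((exp (- \<i> * of_real (\<omega> * h)) - 1) / of_real h))"
  have "((\<lambda>z. exp (- \<i> * of_real \<omega> * z)) has_field_derivative (- \<i> * of_real \<omega>)) (at (of_real 0))"
    by (auto intro!: derivative_eq_intros)
  then have "((\<lambda>t. exp (- \<i> * of_real \<omega> * of_real t)) has_vector_derivative (- \<i> * of_real \<omega>)) (at 0)"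
    by (rule has_vector_derivative_real_field)
  from vector_derivative_quotient[OF this]
  have "((\<lambda>h. \<i> * ((exp (- \<i> * of_real \<omega> * of_real (0 + h)) - exp (- \<i> * of_real \<omega> * of_real 0)) / of_real h)) \<longlongrightarrow> \<i> * (- \<i> * of_real \<omega>)) (at 0)"
    by (intro tendsto_intros)
  then have e: "(e \<longlongrightarrow> of_real \<omega>) (at 0)" by (simp add: e_def mult.assoc)
  \<comment> \<open>The norm does not depend on \<open>h\<close>; bounding it by quantities that
    tend to 0 with \<open>h\<close> shows that it is 0.\<close>
  have "((\<lambda>h::real. L2_norm (\<lambda>z. of_real \<omega> * u0 z - g z)) \<longlongrightarrow> 0) (at 0)"
  proof (rule Lim_null_comparison)
    show "\<forall>\<^sub>F h in at 0. norm (L2_norm (\<lambda>z. of_real \<omega> * u0 z - g z)) \<le>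
       L2_norm (?D h) + cmod (of_real \<omega> - e h) * L2_norm u0"
    proof (intro always_eventually allI)
      fix h
      have eq: "(?D h) = (\<lambda>z. e h * u0 z - g z)"
        by (simp add: e_def diff_divide_distrib algebra_simps)
      have "L2_norm (\<lambda>z. (e h * u0 z - g z) + (of_real \<omega> - e h) * u0 z) \<le>
          L2_norm (\<lambda>z. e h * u0 z - g z) + L2_norm (\<lambda>z. (of_real \<omega> - e h) * u0 z)"
        by (intro L2_norm_triangle L2_diff L2_cmult u0L gL)
      moreover have "(\<lambda>z. (e h * u0 z - g z) + (of_real \<omega> - e h) * u0 z) = (\<lambda>z. of_real \<omega> * u0 z - g z)"
        by (simp add: algebra_simps)
      ultimately show "norm (L2_norm (\<lambda>z. of_real \<omega> * u0 z - g z)) \<le>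
       L2_norm (?D h) + cmod (of_real \<omega> - e h) * L2_norm u0"
        unfolding eq by (simp add: L2_norm_cmult)
    qed
    have "((\<lambda>h. L2_norm (?D h) + cmod (of_real \<omega> - e h) * L2_norm u0)
       \<longlongrightarrow> 0 + cmod (of_real \<omega> - of_real \<omega>) * L2_norm u0) (at 0)"
      by (intro tendsto_intros lim e)
    then show "((\<lambda>h. L2_norm (?D h) + cmod (of_real \<omega> - e h) * L2_norm u0)
       \<longlongrightarrow> 0) (at 0)" by simp
  qed
  then have "L2_norm (\<lambda>z. of_real \<omega> * u0 z - g z) = 0"
    by (rule LIM_const_eq)
  then have "cmod (fourier (\<lambda>z. of_real \<omega> * u0 z - g z) (int k)) \<le> 0" for k
    using cmod_fourier_le[OF L2_diff[OF L2_cmult[OF u0L] gL]] by metis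
  then have gk: "fourier g (int k) = of_real \<omega> * fourier u0 (int k)" for k
    by (simp add: fourier_diff L2_cmult u0L gL fourier_cmult)
  define i where "i = 1 / (1 - p * cnj p)"
  define c0 where "c0 = b * b * cnj b + cnj B * B * (2 * b * i + B * cnj p * i\<^sup>2)"
  define c1 where "c1 = 2 * b * cnj b * B + cnj B * B * (B * i\<^sup>2 + 2 * b * p * i)"
  define c2 where "c2 = cnj b * B * B + cnj B * B * B * p * i"
  have "fourier (quadf c0 c1 c2 p) (int k) = of_real \<omega> * ratf_coeff b B p k" for k
  proof -
    have "fourier (quadf c0 c1 c2 p) (int k) = fourier (cubic (ratf b B p)) (int k)"
      unfolding c0_def c1_def c2_def
      by (intro fourier_szego_projection szego_projection_ratf p i_def)
    also have "\<dots> = fourier (cubic u0) (int k)"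
      by (intro fourier_cong) (simp add: cubic_def u0)
    also have "\<dots> = fourier g (int k)"
      by (rule fourier_szego_projection[OF g, symmetric])
    also have "\<dots> = of_real \<omega> * fourier (ratf b B p) (int k)"
      using fourier_cong[of u0 "ratf b B p" "int k"] u0 by (simp add: gk)
    finally show ?thesis by (simp add: fourier_ratf p)
  qed
  \<comment> \<open>The squared \<open>phi p\<close> has coefficients 0 and 1 at frequencies 1 and
    2, so subtracting \<open>p\<close> times the first equation from the second isolates
    \<open>c2\<close>.\<close>
  from this[of 1] this[of 2] have "c2 = 0"
    using fourier_phi[OF p, of 1] fourier_phi[OF p, of 2]
    by (simp add: fourier_quadf[OF p] fourier_phi_sq[OF p] ratf_coeff_def)
  then have "B * B * (cnj b + cnj B * p * i) = 0"
    by (simp add: c2_def algebra_simps)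
  then have bi: "cnj b + cnj B * p * i = 0" using B by simp
  have "p * cnj p = of_real ((cmod p)\<^sup>2)" by (simp only: complex_norm_square)
  moreover have "(cmod p)\<^sup>2 < 1" using p by (simp add: power_less_one_iff)
  ultimately have "1 - p * cnj p \<noteq> 0" by (metis eq_iff_diff_eq_0 less_irrefl of_real_eq_1_iff)
  then have "i * (1 - p * cnj p) = 1" by (simp add: i_def)
  then have "cnj b * (1 - p * cnj p) + cnj B * p = (cnj b + cnj B * p * i) * (1 - p * cnj p)"
    by (simp add: distrib_right mult.assoc)
  then show ?thesis using bi by simp
qed

section \<open>The motion of the coefficients\<close>

text \<open>
  Along the flow of \<open>(a z + b) / (1 - p z)\<close> the numbers \<open>Q = \<parallel>u\<parallel>\<^sup>2\<close> and
  \<open>M = \<Sum>k \<bar>u\<^sub>k\<bar>\<^sup>2\<close> are conserved, and for given \<open>Q\<close> and \<open>M\<close> the coefficients satisfy the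
  linear system below.
\<close>

locale linear_flow =
  fixes a b p :: "real \<Rightarrow> complex" and Q M :: real
  assumes da: "\<And>t. (a has_vector_derivative (- \<i> * (of_real Q * a t))) (at t)"
    and db: "\<And>t. (b has_vector_derivative (- \<i> * (of_real (Q + M) * b t + of_real M * a t * cnj (p t)))) (at t)"
    and dp: "\<And>t. (p has_vector_derivative (- \<i> * (of_real Q * p t + a t * cnj (b t)))) (at t)"
    and mass_init: "(cmod (b 0))\<^sup>2 + M * (1 - (cmod (p 0))\<^sup>2) = Q"
    and momentum_init: "(cmod (a 0))\<^sup>2 + (Q + M) * (cmod (p 0))\<^sup>2 + 2 * Re (a 0 * cnj (b 0) * cnj (p 0)) = M"
    and gap: "(cmod (a 0))\<^sup>2 < Q"
begin

lemma constant_if_deriv_0: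
  fixes f :: "real \<Rightarrow> complex"
  assumes "\<And>t. (f has_vector_derivative f' t) (at t)" "\<And>t. f' t = 0"
  shows "f t = f 0"
proof -
  obtain c where "\<And>x. x \<in> UNIV \<Longrightarrow> f x = c"
    by (rule has_vector_derivative_zero_constant[of UNIV f])
      (use assms in \<open>auto simp: convex_UNIV\<close>)
  then show ?thesis by simp
qed

lemma norm_a_conserved: "a t * cnj (a t) = a 0 * cnj (a 0)"
  by (rule constant_if_deriv_0[where f = "\<lambda>t. a t * cnj (a t)"],
      rule has_vector_derivative_mult[OF da has_vector_derivative_cnj[OF da]])
     (simp add: algebra_simps)

text \<open>The time derivative of the left side vanishes identically as a polynomial in
  \<open>a\<close>, \<open>b\<close>, \<open>p\<close> and their conjugates. Hence constants
  \<open>Q\<close> and \<open>M\<close> fitted at time 0 remain correct, and the linear system keeps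
  agreeing with the nonlinear equation.\<close>

lemma mass_relation: "b t * cnj (b t) + of_real M * (1 - p t * cnj (p t)) = of_real Q"
proof -
  have "b t * cnj (b t) + of_real M * (1 - p t * cnj (p t)) = b 0 * cnj (b 0) + of_real M * (1 - p 0 * cnj (p 0))"
    by (rule constant_if_deriv_0[where f = "\<lambda>t. b t * cnj (b t) + of_real M * (1 - p t * cnj (p t))"],
      rule has_vector_derivative_add[OF has_vector_derivative_mult[OF db has_vector_derivative_cnj[OF db]]
        has_vector_derivative_mult[OF has_vector_derivative_const
          has_vector_derivative_diff[OF has_vector_derivative_const
           has_vector_derivative_mult[OF dp has_vector_derivative_cnj[OF dp]]]]])
     (simp add: algebra_simps)
  also have "\<dots> = of_real ((cmod (b 0))\<^sup>2 + M * (1 - (cmod (p 0))\<^sup>2))"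
    by (simp only: of_real_add of_real_mult of_real_diff of_real_1 complex_norm_square)
  finally show ?thesis unfolding mass_init .
qed

text \<open>The value of the momentum says |a + b p|^2 = M (1 - |p|^2)^2; eliminating |b|^2 by the
  mass relation gives this form, whose derivative again vanishes identically.\<close>

lemma momentum_relation: "a t * cnj (a t) + of_real (Q + M) * (p t * cnj (p t)) +
    (a t * cnj (b t) * cnj (p t) + cnj (a t) * b t * p t) = of_real M"
proof -
  let ?f = "\<lambda>t. (a t * cnj (a t) + of_real (Q + M) * (p t * cnj (p t))) +
    ((a t * cnj (b t)) * cnj (p t) + (cnj (a t) * b t) * p t)"
  have "?f t = ?f 0"
    by (rule constant_if_deriv_0[where f = ?f],
      rule has_vector_derivative_add[OF
        has_vector_derivative_add[OF has_vector_derivative_mult[OF da has_vector_derivative_cnj[OF da]]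
          has_vector_derivative_mult[OF has_vector_derivative_const
           has_vector_derivative_mult[OF dp has_vector_derivative_cnj[OF dp]]]]
        has_vector_derivative_add[OF
          has_vector_derivative_mult[OF has_vector_derivative_mult[OF da has_vector_derivative_cnj[OF db]]
             has_vector_derivative_cnj[OF dp]]
          has_vector_derivative_mult[OF has_vector_derivative_mult[OF has_vector_derivative_cnj[OF da] db] dp]]])
      (simp add: algebra_simps)
  also have "\<dots> = of_real ((cmod (a 0))\<^sup>2 + (Q + M) * (cmod (p 0))\<^sup>2 + 2 * Re (a 0 * cnj (b 0) * cnj (p 0)))"
    unfolding of_real_add[of "_ + _"] of_real_add[of "(cmod (a 0))\<^sup>2"] of_real_mult[of "Q + M"] complex_norm_square
    using complex_add_cnj[of "a 0 * cnj (b 0) * cnj (p 0)"] by simp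
  finally show ?thesis unfolding momentum_init by simp
qed

lemma cmod_a: "cmod (a t) = cmod (a 0)"
proof -
  have "complex_of_real ((cmod (a t))\<^sup>2) = of_real ((cmod (a 0))\<^sup>2)"
    unfolding complex_norm_square by (rule norm_a_conserved)
  then have "(cmod (a t))\<^sup>2 = (cmod (a 0))\<^sup>2" unfolding of_real_eq_iff .
  then show ?thesis by simp
qed

lemma mass_relation_real: "(cmod (b t))\<^sup>2 + M * (1 - (cmod (p t))\<^sup>2) = Q"
proof -
  have "complex_of_real ((cmod (b t))\<^sup>2 + M * (1 - (cmod (p t))\<^sup>2)) = of_real Q"
    using mass_relation[of t] by (simp only: of_real_add of_real_mult of_real_diff of_real_1 complex_norm_square)
  then show ?thesis unfolding of_real_eq_iff .
qed

text \<open>The quantity b + a cnj p vanishes exactly for stationary waves. The two relations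
  express it through |p| and the conserved |a|, which confines \<open>p\<close> to the disc and
  keeps the solution within O(epsilon) of the stationary waves for all times.\<close>

lemma distance_to_stationary:
  "(cmod (b t + a t * cnj (p t)))\<^sup>2 = (1 - (cmod (p t))\<^sup>2) * (Q - (cmod (a 0))\<^sup>2)"
proof -
  have "(b t + a t * cnj (p t)) * cnj (b t + a t * cnj (p t)) =
     b t * cnj (b t) + a t * cnj (a t) * (p t * cnj (p t)) + (a t * cnj (b t) * cnj (p t) + cnj (a t) * b t * p t)"
    by (simp add: algebra_simps)
  also have "\<dots> = (of_real Q - of_real M * (1 - p t * cnj (p t))) + a t * cnj (a t) * (p t * cnj (p t))
      + (of_real M - a t * cnj (a t) - of_real (Q + M) * (p t * cnj (p t)))"
  proof -
    have "b t * cnj (b t) = of_real Q - of_real M * (1 - p t * cnj (p t))"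
      using mass_relation[of t] by (simp only: eq_diff_eq)
    moreover have "a t * cnj (b t) * cnj (p t) + cnj (a t) * b t * p t =
        of_real M - a t * cnj (a t) - of_real (Q + M) * (p t * cnj (p t))"
      using momentum_relation[of t] by (metis add_diff_cancel_left' diff_diff_eq)
    ultimately show ?thesis by (simp only:)
  qed
  also have "\<dots> = (1 - p t * cnj (p t)) * (of_real Q - a t * cnj (a t))"
    by (simp add: algebra_simps)
  finally have "complex_of_real ((cmod (b t + a t * cnj (p t)))\<^sup>2) =
      of_real ((1 - (cmod (p t))\<^sup>2) * (Q - (cmod (a 0))\<^sup>2))"
    by (simp only: of_real_mult of_real_diff of_real_1 complex_norm_square norm_a_conserved[of t])
  then show ?thesis unfolding of_real_eq_iff .
qed

text \<open>The sign of \<open>distance_to_stationary\<close> gives |p| <= 1. On the boundary the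
  same identity would force |b| = |a|, whereas the mass would give |b|^2 = Q, contradicting
  \<open>gap\<close>.\<close>

lemma cmod_p: "cmod (p t) < 1"
proof -
  have "0 \<le> (1 - (cmod (p t))\<^sup>2) * (Q - (cmod (a 0))\<^sup>2)"
    unfolding distance_to_stationary[symmetric] by simp
  then have le: "(cmod (p t))\<^sup>2 \<le> 1"
    using gap by (simp add: zero_le_mult_iff)
  have "(cmod (p t))\<^sup>2 \<noteq> 1"
  proof
    assume 1: "(cmod (p t))\<^sup>2 = 1"
    then have "b t = - (a t * cnj (p t))"
      using distance_to_stationary[of t] by (simp add: add_eq_0_iff2)
    moreover have "cmod (p t) = 1" using 1 by (simp add: power2_eq_1_iff) (use norm_ge_zero[of "p t"] in linarith)
    ultimately have "cmod (b t) = cmod (a 0)" by (simp add: norm_mult cmod_a[of t])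
    then show False using mass_relation_real[of t] 1 gap by simp
  qed
  then have "(cmod (p t))\<^sup>2 < 1" using le by simp
  then show ?thesis by (simp add: power_less_one_iff abs_square_less_1)
qed

text \<open>The cubic equations of \<open>szego_solution_ratf\<close> contain \<open>b\<close> and
  \<open>B\<close> mostly through |b|^2 and |B|^2. Replacing these by Q - M (1 - |p|^2) and M (1 -
  |p|^2)^2 cancels every denominator and leaves the linear system.\<close>

lemma flow_solution:
  assumes u0: "\<And>z. cmod z = 1 \<Longrightarrow> u0 z = (a 0 * z + b 0) / (1 - p 0 * z)"
  shows "szego_solution u0 (\<lambda>t. wave (a t) (b t) (p t))"
proof (rule szego_solution_ratf[OF db _ dp cmod_p refl])
  fix t
  show "((\<lambda>t. a t + b t * p t) has_vector_derivative
     (- \<i> * (of_real Q * a t) + (b t * (- \<i> * (of_real Q * p t + a t * cnj (b t))) +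
        (- \<i> * (of_real (Q + M) * b t + of_real M * a t * cnj (p t))) * p t))) (at t)"
    by (rule has_vector_derivative_add[OF da has_vector_derivative_mult[OF db dp]])
  define R where "R = 1 - p t * cnj (p t)"
  define i where "i = 1 / R"
  define B where "B = a t + b t * p t"
  have bb: "b t * cnj (b t) = of_real Q - of_real M * R"
    using mass_relation[of t] by (simp add: R_def algebra_simps)
  have BB: "cnj B * B = of_real M * R\<^sup>2"
  proof -
    have "cnj B * B = a t * cnj (a t) + b t * cnj (b t) * (p t * cnj (p t)) + (a t * cnj (b t) * cnj (p t) + cnj (a t) * b t * p t)"
      by (simp add: B_def algebra_simps)
    also have "\<dots> = (of_real M - of_real (Q + M) * (p t * cnj (p t))) + (of_real Q - of_real M * R) * (p t * cnj (p t))"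
    proof -
      have eq: "a t * cnj (a t) + (a t * cnj (b t) * cnj (p t) + cnj (a t) * b t * p t) =
          of_real M - of_real (Q + M) * (p t * cnj (p t))"
        using momentum_relation[of t] by (simp only: eq_diff_eq add_ac)
      show ?thesis unfolding bb eq[symmetric] by (simp only: add_ac)
    qed
    also have "\<dots> = of_real M * R\<^sup>2"
      by (simp add: R_def algebra_simps power2_eq_square)
    finally show ?thesis .
  qed
  have "R = of_real (1 - (cmod (p t))\<^sup>2)"
    unfolding R_def by (simp only: of_real_diff of_real_1 complex_norm_square)
  moreover have "(cmod (p t))\<^sup>2 < 1" using cmod_p[of t] by (simp add: power_less_one_iff)
  ultimately have R0: "R \<noteq> 0" by (metis diff_gt_0_iff_gt less_irrefl of_real_eq_0_iff)
  have iR: "R * i = 1" using R0 by (simp add: i_def)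
  have BBi: "cnj B * B * i = of_real M * R"
    unfolding BB using iR by (simp add: power2_eq_square mult_ac)
  have BBii: "cnj B * B * i\<^sup>2 = of_real M"
    using BBi iR by (metis mult.assoc mult.right_neutral power2_eq_square)
  show "\<i> * (- \<i> * (of_real (Q + M) * b t + of_real M * a t * cnj (p t))) =
      b t * b t * cnj (b t) + cnj (a t + b t * p t) * (a t + b t * p t) *
        (2 * b t * (1 / (1 - p t * cnj (p t))) + (a t + b t * p t) * cnj (p t) * (1 / (1 - p t * cnj (p t)))\<^sup>2)"
  proof -
    have "b t * b t * cnj (b t) + cnj B * B * (2 * b t * i + B * cnj (p t) * i\<^sup>2) =
       b t * (b t * cnj (b t)) + 2 * b t * (cnj B * B * i) + B * cnj (p t) * (cnj B * B * i\<^sup>2)"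
      by (simp add: algebra_simps)
    also have "\<dots> = b t * (of_real Q - of_real M * R) + 2 * b t * (of_real M * R) + B * cnj (p t) * of_real M"
      unfolding bb BBi BBii ..
    also have "\<dots> = \<i> * (- \<i> * (of_real (Q + M) * b t + of_real M * a t * cnj (p t)))"
      by (simp add: B_def R_def algebra_simps)
    finally show ?thesis unfolding B_def[symmetric] R_def[symmetric] i_def[symmetric] by (rule sym)
  qed
  show "\<i> * (- \<i> * (of_real Q * a t) + (b t * (- \<i> * (of_real Q * p t + a t * cnj (b t))) +
        (- \<i> * (of_real (Q + M) * b t + of_real M * a t * cnj (p t))) * p t)) =
      2 * b t * cnj (b t) * (a t + b t * p t) + cnj (a t + b t * p t) * (a t + b t * p t) *
        ((a t + b t * p t) * (1 / (1 - p t * cnj (p t)))\<^sup>2 + 2 * b t * p t * (1 / (1 - p t * cnj (p t))))"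
  proof -
    have "2 * b t * cnj (b t) * B + cnj B * B * (B * i\<^sup>2 + 2 * b t * p t * i) =
       2 * (b t * cnj (b t)) * B + B * (cnj B * B * i\<^sup>2) + 2 * b t * p t * (cnj B * B * i)"
      by (simp add: algebra_simps)
    \<comment> \<open>One copy of \<open>(b t * cnj (b t)) * a t\<close> is left unreplaced, since
      it reappears as \<open>b t * (a t * cnj (b t))\<close> in the derivative of
      \<open>b t * p t\<close>.\<close>
    also have "\<dots> = (b t * cnj (b t)) * a t + (b t * cnj (b t)) * a t + 2 * (b t * cnj (b t)) * (b t * p t)
        + B * of_real M + 2 * b t * p t * (of_real M * R)"
      unfolding BBi BBii by (simp add: B_def algebra_simps)
    also have "\<dots> = (b t * cnj (b t)) * a t + (of_real Q - of_real M * R) * a t + 2 * (of_real Q - of_real M * R) * (b t * p t)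
        + B * of_real M + 2 * b t * p t * (of_real M * R)"
      by (simp only: bb)
    also have "\<dots> = \<i> * (- \<i> * (of_real Q * a t) + (b t * (- \<i> * (of_real Q * p t + a t * cnj (b t))) +
        (- \<i> * (of_real (Q + M) * b t + of_real M * a t * cnj (p t))) * p t))"
      by (simp add: B_def R_def algebra_simps)
    finally show ?thesis unfolding B_def[symmetric] R_def[symmetric] i_def[symmetric] by (rule sym)
  qed
  show "\<i> * (- \<i> * (of_real Q * p t + a t * cnj (b t))) * (a t + b t * p t) =
      cnj (b t) * (a t + b t * p t) * (a t + b t * p t) +
      cnj (a t + b t * p t) * (a t + b t * p t) * (a t + b t * p t) * p t * (1 / (1 - p t * cnj (p t)))"
  proof -
    have "cnj (b t) * B * B + cnj B * B * B * p t * i = B * (cnj (b t) * a t + (b t * cnj (b t)) * p t + (cnj B * B * i) * p t)"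
      by (simp add: B_def algebra_simps)
    also have "\<dots> = \<i> * (- \<i> * (of_real Q * p t + a t * cnj (b t))) * B"
      unfolding bb BBi by (simp add: algebra_simps)
    finally show ?thesis unfolding B_def[symmetric] R_def[symmetric] i_def[symmetric] by (rule sym)
  qed
next
  fix z :: complex assume "cmod z = 1"
  then show "u0 z = wave (a 0) (b 0) (p 0) z"
    using u0 ratf_wave[OF cmod_p] by simp
qed

end

text \<open>With Y = a cnj b the pair (p, Y) satisfies a closed system with matrix rows (Q, 1) and
  (- M N, - M). Here \<open>h\<close> and \<open>m\<close> are half the sum and half the difference
  of \<open>Q\<close> and \<open>M\<close>: subtracting \<open>m\<close> leaves the trace-free rows
  (h, 1) and (- M N, - h), whose square is w^2 times the identity. Since |a|^2 = N is constant,
  \<open>b\<close> is recovered from \<open>Y\<close>.\<close>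

lemma linear_system_solution:
  fixes Q M N w h m :: real and A P0 Y0 :: complex
  assumes w: "w \<noteq> 0" "w\<^sup>2 = h\<^sup>2 - M * N" and QM: "Q = h + m" "M = h - m"
    and N: "N = (cmod A)\<^sup>2" "N \<noteq> 0"
  obtains a b p where
    "\<And>t. (a has_vector_derivative (- \<i> * (of_real Q * a t))) (at t)"
    "\<And>t. (b has_vector_derivative (- \<i> * (of_real (Q + M) * b t + of_real M * a t * cnj (p t)))) (at t)"
    "\<And>t. (p has_vector_derivative (- \<i> * (of_real Q * p t + a t * cnj (b t)))) (at t)"
    "a 0 = A" "b 0 = A * cnj Y0 / of_real N" "p 0 = P0"
    "\<And>t. cmod (p t) = cmod (of_real (cos (w * t)) * P0 - \<i> * of_real (sin (w * t) / w) * (of_real h * P0 + Y0))"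
proof -
  \<comment> \<open>One component of the matrix exponential: \<open>X\<close> is its initial value
    and \<open>X'\<close> the same component after applying the trace-free matrix.\<close>
  define g where "g = (\<lambda>X X' z. exp (- \<i> * of_real m * z) * (cos (of_real w * z) * X - \<i> * (sin (of_real w * z) / of_real w) * X'))"
  define a where "a = (\<lambda>t::real. A * exp (- \<i> * of_real Q * of_real t))"
  define p where "p = (\<lambda>t::real. g P0 (of_real h * P0 + Y0) (of_real t))"
  define Y where "Y = (\<lambda>t::real. g Y0 (- of_real (M * N) * P0 - of_real h * Y0) (of_real t))"
  define b where "b = (\<lambda>t. (1 / of_real N) * (a t * cnj (Y t)))"
  have lin: "c * g X X' z + d * g Y Y' z = g (c * X + d * Y) (c * X' + d * Y') z" for c d X X' Y Y' z
    by (simp add: g_def algebra_simps add_divide_distrib)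
  have dg: "(g X X' has_field_derivative - \<i> * (of_real m * g X X' z + g X' ((of_real w)\<^sup>2 * X) z)) (at z)"
    for X X' z
  proof -
    have e: "((\<lambda>z. exp (- \<i> * of_real m * z)) has_field_derivative (- \<i> * of_real m * exp (- \<i> * of_real m * z))) (at z)"
      by (auto intro!: derivative_eq_intros)
    have co: "((\<lambda>z. cos (of_real w * z)) has_field_derivative (- of_real w * sin (of_real w * z))) (at z)"
      by (auto intro!: derivative_eq_intros)
    have si: "((\<lambda>z. sin (of_real w * z) / of_real w) has_field_derivative cos (of_real w * z)) (at z)"
      using w(1) by (auto intro!: derivative_eq_intros)
    show ?thesis
      unfolding g_def using w(1)
      by (intro DERIV_cong[OF DERIV_mult[OF e DERIV_diff[OF DERIV_cmult_right[OF co]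
            DERIV_cmult_right[OF DERIV_cmult[OF si]]]]]) (simp add: algebra_simps power2_eq_square)
  qed
  have da: "(a has_vector_derivative (- \<i> * (of_real Q * a t))) (at t)" for t
  proof -
    have "((\<lambda>z. A * exp (- \<i> * of_real Q * z)) has_field_derivative (- \<i> * (of_real Q * a t))) (at (of_real t))"
      unfolding a_def by (auto intro!: derivative_eq_intros)
    then show ?thesis unfolding a_def by (rule has_vector_derivative_real_field)
  qed
  have ww: "(complex_of_real w)\<^sup>2 = of_real (h\<^sup>2 - M * N)"
    by (simp only: w(2) flip: of_real_power)
  have dp': "(p has_vector_derivative (- \<i> * (of_real Q * p t + Y t))) (at t)" for t
  proof -
    have "g (of_real h * P0 + Y0) ((of_real w)\<^sup>2 * P0) (of_real t) = of_real h * p t + 1 * Y t"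
      unfolding p_def Y_def lin ww by (simp add: algebra_simps power2_eq_square)
    then have eq: "- \<i> * (of_real Q * p t + Y t) =
        - \<i> * (of_real m * p t + g (of_real h * P0 + Y0) ((of_real w)\<^sup>2 * P0) (of_real t))"
      by (simp add: QM(1) algebra_simps)
    show ?thesis unfolding eq unfolding p_def by (rule has_vector_derivative_real_field[OF dg])
  qed
  have dY: "(Y has_vector_derivative (\<i> * (of_real M * Y t + of_real (M * N) * p t))) (at t)" for t
  proof -
    let ?Z = "- of_real (M * N) * P0 - of_real h * Y0"
    have 1: "- of_real (M * N) * P0 + - of_real h * Y0 = ?Z" by simp
    have 2: "- of_real (M * N) * (of_real h * P0 + Y0) + - of_real h * ?Z = (of_real w)\<^sup>2 * Y0"
      unfolding ww by (simp add: algebra_simps power2_eq_square)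
    have gZ: "g ?Z ((of_real w)\<^sup>2 * Y0) (of_real t) = - of_real (M * N) * p t + - of_real h * Y t"
      unfolding p_def Y_def lin 1 2 ..
    have eq: "\<i> * (of_real M * Y t + of_real (M * N) * p t) =
        - \<i> * (of_real m * Y t + g ?Z ((of_real w)\<^sup>2 * Y0) (of_real t))"
      unfolding gZ by (subst QM(2)) (simp add: algebra_simps)
    show ?thesis unfolding eq unfolding Y_def by (rule has_vector_derivative_real_field[OF dg])
  qed
  have aa: "a t * cnj (a t) = of_real N" for t
  proof -
    have "cmod (a t) = cmod A" by (simp add: a_def norm_mult)
    then show ?thesis unfolding N(1) by (metis complex_norm_square)
  qed
  have ab: "a t * cnj (b t) = Y t" for t
  proof -
    have "a t * cnj (b t) = (a t * cnj (a t)) * Y t / of_real N" by (simp add: b_def)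
    then show ?thesis using N(2) by (simp add: aa)
  qed
  have dp: "(p has_vector_derivative (- \<i> * (of_real Q * p t + a t * cnj (b t)))) (at t)" for t
    unfolding ab by (rule dp')
  have db: "(b has_vector_derivative (- \<i> * (of_real (Q + M) * b t + of_real M * a t * cnj (p t)))) (at t)" for t
  proof -
    have "(b has_vector_derivative (1 / of_real N) * (a t * cnj (\<i> * (of_real M * Y t + of_real (M * N) * p t)) + (- \<i> * (of_real Q * a t)) * cnj (Y t))) (at t)"
      unfolding b_def
      by (intro has_vector_derivative_mult_right has_vector_derivative_mult has_vector_derivative_cnj da dY)
    also have "(1 / of_real N) * (a t * cnj (\<i> * (of_real M * Y t + of_real (M * N) * p t)) + (- \<i> * (of_real Q * a t)) * cnj (Y t)) =
        - \<i> * (of_real (Q + M) * b t + of_real M * a t * cnj (p t))"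
      unfolding b_def using N(2) by (simp add: field_simps)
    finally show ?thesis .
  qed
  show ?thesis
  proof (rule that[OF da db dp])
    show "a 0 = A" "b 0 = A * cnj Y0 / of_real N" "p 0 = P0"
      by (simp_all add: a_def b_def p_def Y_def g_def)
    fix t
    have "cmod (p t) = cmod (cos (of_real w * of_real t) * P0 - \<i> * (sin (of_real w * of_real t) / of_real w) * (of_real h * P0 + Y0))"
      by (simp add: p_def g_def norm_mult)
    then show "cmod (p t) = cmod (of_real (cos (w * t)) * P0 - \<i> * of_real (sin (w * t) / w) * (of_real h * P0 + Y0))"
      by (simp add: cos_of_real sin_of_real flip: of_real_mult)
  qed
qed

text \<open>Intermediate value theorem between an angle \<open>t1\<close> where the first coordinate
  has its maximal size, so that the radius exceeds \<open>r\<close>, and an angle \<open>t0\<close>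
  where it vanishes, so that the radius is at most \<open>y\<close>. Both angles are taken in
  \<open>[0, 2 pi)\<close>, which yields a nonnegative time.\<close>

lemma ellipse_radius:
  fixes s x y r :: real
  assumes "0 < x" "0 \<le> y" "y < r" "r\<^sup>2 < s\<^sup>2 + x\<^sup>2"
  shows "\<exists>\<theta>\<ge>0. (s * cos \<theta> + x * sin \<theta>)\<^sup>2 + (y * sin \<theta>)\<^sup>2 = r\<^sup>2"
proof -
  define R where "R = sqrt (s\<^sup>2 + x\<^sup>2)"
  have R2: "R\<^sup>2 = s\<^sup>2 + x\<^sup>2" by (simp add: R_def)
  have R: "R > 0" using assms(1) by (simp add: R_def add_nonneg_pos)
  have one: "(s / R)\<^sup>2 + (x / R)\<^sup>2 = 1" using R by (simp add: power_divide R2[symmetric] flip: add_divide_distrib)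
  define f where "f = (\<lambda>\<theta>. (s * cos \<theta> + x * sin \<theta>)\<^sup>2 + (y * sin \<theta>)\<^sup>2)"
  obtain t1 where t1: "0 \<le> t1" "t1 < 2 * pi" "s / R = cos t1" "x / R = sin t1"
    using sincos_total_2pi[OF one] by blast
  obtain t0 where t0: "0 \<le> t0" "t0 < 2 * pi" "x / R = cos t0" "- s / R = sin t0"
    using sincos_total_2pi[of "x / R" "- s / R"] one by (auto simp: add.commute)
  have "s * cos t1 + x * sin t1 = R"
    unfolding t1(3,4)[symmetric] using R by (simp add: field_simps R2[symmetric] flip: power2_eq_square)
  then have f1: "r\<^sup>2 \<le> f t1"
    unfolding f_def using assms(4) R2 by (simp add: add_increasing2)
  have "s * cos t0 + x * sin t0 = 0"
    unfolding t0(3,4)[symmetric] by simp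
  then have "f t0 = (y * sin t0)\<^sup>2" by (simp add: f_def)
  also have "\<dots> \<le> y\<^sup>2"
    using mult_left_mono[of "(sin t0)\<^sup>2" 1 "y\<^sup>2"] by (simp add: power_mult_distrib abs_square_le_1)
  also have "\<dots> \<le> r\<^sup>2" using assms by (intro power_mono) auto
  finally have f0: "f t0 \<le> r\<^sup>2" .
  have "connected (f ` {0..2 * pi})"
    unfolding f_def by (intro connected_continuous_image continuous_intros) auto
  then have "{f t0..f t1} \<subseteq> f ` {0..2 * pi}"
    using t0 t1 by (intro connected_contains_Icc) auto
  then have "r\<^sup>2 \<in> f ` {0..2 * pi}" using f0 f1 by auto
  then show ?thesis by (auto simp: f_def)
qed

text \<open>
  Perturbing the constant coefficient of a stationary wave orthogonally to \<open>cnj p\<close> makes \<open>p\<close>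
  move slowly along an ellipse that degenerates, as \<open>e \<rightarrow> 0\<close>, to the diameter of the unit
  disc through \<open>c\<close>.
\<close>

lemma perturbed_flow:
  fixes A c :: complex and s e :: real
  assumes A: "A \<noteq> 0" and c: "cmod c = 1" and s: "0 \<le> s" "s < 1" and e: "0 < e"
  defines "\<rho> \<equiv> 1 - s\<^sup>2"
  defines "k \<equiv> sqrt (1 / \<rho> + e\<^sup>2 / (4 * \<rho>^4))"
  obtains a b p Q M where "linear_flow a b p Q M"
    "a 0 = A" "p 0 = of_real s * c" "b 0 = - A * cnj c * (of_real s + \<i> * of_real e)"
    "Q - (cmod A)\<^sup>2 = (cmod A)\<^sup>2 * e\<^sup>2 / \<rho>"
    "\<And>r. e * s / (2 * \<rho>\<^sup>2 * k) < r \<Longrightarrow> r\<^sup>2 < s\<^sup>2 + (1 / k)\<^sup>2 \<Longrightarrow> \<exists>t\<ge>0. cmod (p t) = r"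
proof -
  have \<rho>: "\<rho> > 0" unfolding \<rho>_def using s by (simp add: abs_square_less_1)
  have \<rho>s: "s\<^sup>2 = 1 - \<rho>" by (simp add: \<rho>_def)
  have k: "k > 0" unfolding k_def using \<rho> by (simp add: add_pos_nonneg)
  have k2: "k\<^sup>2 = 1 / \<rho> + e\<^sup>2 / (4 * \<rho>^4)" unfolding k_def using \<rho> by (simp add: add_nonneg_nonneg)
  define N where "N = (cmod A)\<^sup>2"
  have N: "N > 0" using A by (simp add: N_def)
  \<comment> \<open>\<open>Q\<close> and \<open>M\<close> are the mass and the momentum of the
    perturbed datum, and \<open>h\<close> is half their sum.\<close>
  define Q where "Q = N * (1 + e\<^sup>2 / \<rho>)"
  define M where "M = N * (1 + e\<^sup>2 * s\<^sup>2 / \<rho>\<^sup>2)"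
  define h where "h = N * (1 + e\<^sup>2 / (2 * \<rho>\<^sup>2))"
  \<comment> \<open>The origin of \<open>k\<close>: expanding \<open>h\<^sup>2 - M * N\<close> gives
    exactly \<open>(N * e * k)\<^sup>2\<close>, a frequency of order \<open>e\<close>.\<close>
  define w where "w = N * e * k"
  have w: "w > 0" using N e k by (simp add: w_def)
  have QM: "Q + M = 2 * h"
    unfolding Q_def M_def h_def \<rho>s using \<rho> by (simp add: field_simps power2_eq_square)
  have ww: "w\<^sup>2 = h\<^sup>2 - M * N"
    unfolding w_def power_mult_distrib k2 M_def h_def \<rho>s using \<rho> by (simp add: field_simps power2_eq_square power4_eq_xxxx)
  define P0 where "P0 = of_real s * c"
  \<comment> \<open>The initial value of a cnj b for the perturbed datum.\<close>
  define Y0 where "Y0 = - of_real N * c * (of_real s - \<i> * of_real e)"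
  have wN: "w \<noteq> 0" "N \<noteq> 0" using w N by auto
  have hm: "Q = h + (Q - M) / 2" "M = h - (Q - M) / 2" using QM by (simp_all add: field_simps)
  show ?thesis
  proof (rule linear_system_solution[OF wN(1) ww hm N_def wN(2), where ?P0.0 = P0 and ?Y0.0 = Y0])
    fix a b p assume flow:
      "\<And>t. (a has_vector_derivative (- \<i> * (of_real Q * a t))) (at t)"
      "\<And>t. (b has_vector_derivative (- \<i> * (of_real (Q + M) * b t + of_real M * a t * cnj (p t)))) (at t)"
      "\<And>t. (p has_vector_derivative (- \<i> * (of_real Q * p t + a t * cnj (b t)))) (at t)"
      and init: "a 0 = A" "b 0 = A * cnj Y0 / of_real N" "p 0 = P0"
      and cmod_p: "\<And>t. cmod (p t) = cmod (of_real (cos (w * t)) * P0 - \<i> * of_real (sin (w * t) / w) * (of_real h * P0 + Y0))"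
    have b0: "b 0 = - A * cnj c * (of_real s + \<i> * of_real e)"
      using N by (simp add: init Y0_def)
    have cb0: "(cmod (b 0))\<^sup>2 = N * (s\<^sup>2 + e\<^sup>2)"
      unfolding b0 N_def by (simp add: norm_mult c power_mult_distrib cmod_power2)
    have cp0: "(cmod (p 0))\<^sup>2 = s\<^sup>2" using c by (simp add: init P0_def norm_mult)
    have cc: "cnj c * c = 1" using c complex_norm_square[of c] by (simp add: mult.commute)
    have AA: "A * cnj A = of_real N" unfolding N_def by (simp only: complex_norm_square)
    have "a 0 * cnj (b 0) * cnj (p 0) = - (A * cnj A) * (cnj c * c) * (of_real s * (of_real s - \<i> * of_real e))"
      unfolding b0 init(1,3) P0_def by (simp add: mult_ac)
    then have re: "Re (a 0 * cnj (b 0) * cnj (p 0)) = - N * s\<^sup>2"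
      unfolding cc AA by (simp add: power2_eq_square)
    have "linear_flow a b p Q M"
    proof
      show "(cmod (b 0))\<^sup>2 + M * (1 - (cmod (p 0))\<^sup>2) = Q"
        unfolding cb0 cp0 Q_def M_def \<rho>s using \<rho> by (simp add: field_simps power2_eq_square)
      show "(cmod (a 0))\<^sup>2 + (Q + M) * (cmod (p 0))\<^sup>2 + 2 * Re (a 0 * cnj (b 0) * cnj (p 0)) = M"
        unfolding re unfolding cp0 QM init(1) N_def[symmetric] unfolding h_def M_def \<rho>s using \<rho> by (simp add: field_simps power2_eq_square)
      show "(cmod (a 0))\<^sup>2 < Q"
        unfolding init N_def[symmetric] Q_def using N e \<rho> by simp
    qed (rule flow)+
    moreover have "\<exists>t\<ge>0. cmod (p t) = r" if r: "e * s / (2 * \<rho>\<^sup>2 * k) < r" "r\<^sup>2 < s\<^sup>2 + (1 / k)\<^sup>2" for r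
    proof -
      define y where "y = e * s / (2 * \<rho>\<^sup>2 * k)"
      have y0: "0 \<le> y" using e s \<rho> k by (simp add: y_def)
      obtain \<theta> where \<theta>: "\<theta> \<ge> 0" "(s * cos \<theta> + (1 / k) * sin \<theta>)\<^sup>2 + (y * sin \<theta>)\<^sup>2 = r\<^sup>2"
        using ellipse_radius[of "1 / k" y r s] r k y0 by (auto simp: y_def)
      define t where "t = \<theta> / w"
      have wt: "w * t = \<theta>" using w by (simp add: t_def)
      \<comment> \<open>The terms of order 0 cancel, and the leading term is imaginary relative to
        \<open>c\<close>. After multiplication by \<open>- \<i> * of_real (sin \<theta> / w)\<close>
        it points along \<open>c\<close> with size 1 / k, while the next term gives the small
        half-axis \<open>y\<close>.\<close>
      have hPY: "of_real h * P0 + Y0 = of_real (N * e) * c * (of_real (e * s / (2 * \<rho>\<^sup>2)) + \<i>)"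
        unfolding h_def P0_def Y0_def by (simp add: algebra_simps power2_eq_square)
      have div: "complex_of_real (sin \<theta> / w) * of_real (N * e) = of_real (sin \<theta> / k)"
        unfolding of_real_mult[symmetric] w_def using N e by simp
      have yk: "(e * s / (2 * \<rho>\<^sup>2)) * (sin \<theta> / k) = y * sin \<theta>"
        by (simp add: y_def)
      have "of_real (cos \<theta>) * P0 - \<i> * of_real (sin \<theta> / w) * (of_real h * P0 + Y0) =
        c * (of_real (s * cos \<theta>) - \<i> * (of_real (sin \<theta> / w) * of_real (N * e)) * (of_real (e * s / (2 * \<rho>\<^sup>2)) + \<i>))"
        unfolding hPY unfolding P0_def by (simp add: algebra_simps)
      also have "\<dots> = c * (of_real (s * cos \<theta>) + of_real (sin \<theta> / k) - \<i> * of_real ((e * s / (2 * \<rho>\<^sup>2)) * (sin \<theta> / k)))"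
        unfolding div by (simp add: algebra_simps)
      also have "\<dots> = c * Complex (s * cos \<theta> + (1 / k) * sin \<theta>) (- (y * sin \<theta>))"
        unfolding yk by (simp add: complex_eq_iff)
      finally have "cmod (p t) = cmod (Complex (s * cos \<theta> + (1 / k) * sin \<theta>) (- (y * sin \<theta>)))"
        unfolding cmod_p wt using c by (simp add: norm_mult)
      also have "\<dots> = sqrt (r\<^sup>2)" using \<theta>(2) by (simp add: cmod_def)
      finally have "cmod (p t) = r" using y0 r(1) by (simp add: y_def)
      moreover have "0 \<le> t" using \<theta>(1) w by (simp add: t_def)
      ultimately show ?thesis by blast
    qed
    moreover have "Q - (cmod A)\<^sup>2 = (cmod A)\<^sup>2 * e\<^sup>2 / \<rho>"
      unfolding Q_def N_def by (simp add: algebra_simps)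
    ultimately show thesis
      using that[of a b p Q M] init(1,3) b0 P0_def by blast
  qed
qed

section \<open>From the explicit flow to arbitrary solutions with the same data\<close>

lemma ratf_bounded_on_interval:
  fixes b B p :: "real \<Rightarrow> complex"
  assumes b: "continuous_on {0..T} b" and B: "continuous_on {0..T} B" and p: "continuous_on {0..T} p"
    and p1: "\<And>t. cmod (p t) < 1"
  shows "\<exists>K. \<forall>t z. 0 \<le> t \<longrightarrow> t \<le> T \<longrightarrow> cmod z = 1 \<longrightarrow> cmod (ratf (b t) (B t) (p t) z) \<le> K"
proof -
  define f where "f = (\<lambda>x. ratf (b (fst x)) (B (fst x)) (p (fst x)) (snd x))"
  have c: "continuous_on ({0..T} \<times> sphere 0 1) (\<lambda>x. g (fst x))" if "continuous_on {0..T} g" for g :: "real \<Rightarrow> complex"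
    by (rule continuous_on_compose2[OF that continuous_on_fst[OF continuous_on_id]]) auto
  have "continuous_on ({0..T} \<times> sphere 0 1) f"
    unfolding f_def ratf_def using mult_neq_1[OF p1]
    by (intro continuous_intros c b B p) auto
  moreover have "compact ({0..T} \<times> sphere (0::complex) 1)" by (intro compact_Times) auto
  ultimately have "bounded (f ` ({0..T} \<times> sphere 0 1))"
    by (intro compact_imp_bounded compact_continuous_image)
  then obtain K where K: "\<And>x. x \<in> {0..T} \<times> sphere 0 1 \<Longrightarrow> cmod (f x) \<le> K"
    unfolding bounded_iff by auto
  show ?thesis
  proof (intro exI[of _ K] allI impI)
    fix t z assume "0 \<le> t" "t \<le> T" "cmod z = 1"
    then show "cmod (ratf (b t) (B t) (p t) z) \<le> K"
      using K[of "(t, z)"] by (simp add: f_def)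
  qed
qed

text \<open>The second claim passes from the explicit solution to \<open>v\<close> by
  \<open>szego_unique\<close>: the time that gives radius \<open>r\<close> is nonnegative, and up to
  it the explicit solution is bounded. The number \<open>\<beta>\<close> measures the deviation from
  a stationary wave.\<close>

lemma perturbed_solution:
  fixes A c :: complex and s e :: real
  assumes A: "A \<noteq> 0" and c: "cmod c = 1" and s: "0 \<le> s" "s < 1" and e: "0 < e"
    and u0: "\<And>z. cmod z = 1 \<Longrightarrow> u0 z = (A * z - A * cnj c * (of_real s + \<i> * of_real e)) / (1 - of_real s * c * z)"
  defines "\<rho> \<equiv> 1 - s\<^sup>2"
  defines "k \<equiv> sqrt (1 / \<rho> + e\<^sup>2 / (4 * \<rho>^4))"
  shows "\<exists>u. szego_solution u0 u"
    and "szego_solution u0 v \<Longrightarrow> e * s / (2 * \<rho>\<^sup>2 * k) < r \<Longrightarrow> r\<^sup>2 < s\<^sup>2 + (1 / k)\<^sup>2 \<Longrightarrow>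
      \<exists>t \<alpha> q \<beta>. cmod \<alpha> = cmod A \<and> cmod q = r \<and> (cmod \<beta>)\<^sup>2 \<le> (cmod A)\<^sup>2 * e\<^sup>2 / \<rho> \<and> cmod q < 1 \<and>
        (AE z in circle_measure. v t z = wave \<alpha> (\<beta> - \<alpha> * cnj q) q z)"
proof -
  obtain a b p Q M where fl: "linear_flow a b p Q M" and
    init: "a 0 = A" "p 0 = of_real s * c" "b 0 = - A * cnj c * (of_real s + \<i> * of_real e)" and
    Q: "Q - (cmod A)\<^sup>2 = (cmod A)\<^sup>2 * e\<^sup>2 / \<rho>" and
    rad: "\<And>r. e * s / (2 * \<rho>\<^sup>2 * k) < r \<Longrightarrow> r\<^sup>2 < s\<^sup>2 + (1 / k)\<^sup>2 \<Longrightarrow> \<exists>t\<ge>0. cmod (p t) = r"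
    using perturbed_flow[OF A c s e] unfolding \<rho>_def k_def by metis
  interpret linear_flow a b p Q M by (rule fl)
  define U where "U = (\<lambda>t. wave (a t) (b t) (p t))"
  have U: "szego_solution u0 U"
    unfolding U_def by (rule flow_solution) (simp add: init u0)
  then show "\<exists>u. szego_solution u0 u" by blast
  assume v: "szego_solution u0 v" and r: "e * s / (2 * \<rho>\<^sup>2 * k) < r" "r\<^sup>2 < s\<^sup>2 + (1 / k)\<^sup>2"
  obtain t where t: "t \<ge> 0" "cmod (p t) = r" using rad[OF r] by blast
  have cont: "continuous_on {0..t} a" "continuous_on {0..t} b" "continuous_on {0..t} p"
    using has_vector_derivative_continuous[OF da] has_vector_derivative_continuous[OF db]
      has_vector_derivative_continuous[OF dp]
    by (auto intro: continuous_at_imp_continuous_on)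
  have "continuous_on {0..t} (\<lambda>t. a t + b t * p t)"
    by (intro continuous_intros cont)
  from ratf_bounded_on_interval[OF cont(2) this cont(3) cmod_p]
  obtain K where K: "\<And>x z. 0 \<le> x \<Longrightarrow> x \<le> t \<Longrightarrow> cmod z = 1 \<Longrightarrow> cmod (U x z) \<le> K"
    unfolding U_def by blast
  have AE: "AE z in circle_measure. U t z = v t z"
    using K t(1) by (rule szego_unique[OF U v])
  show "\<exists>t \<alpha> q \<beta>. cmod \<alpha> = cmod A \<and> cmod q = r \<and> (cmod \<beta>)\<^sup>2 \<le> (cmod A)\<^sup>2 * e\<^sup>2 / \<rho> \<and> cmod q < 1 \<and>
        (AE z in circle_measure. v t z = wave \<alpha> (\<beta> - \<alpha> * cnj q) q z)"
  proof (rule exI[of _ t], rule exI[of _ "a t"], rule exI[of _ "p t"], rule exI[of _ "b t + a t * cnj (p t)"], intro conjI)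
    show "cmod (a t) = cmod A" using cmod_a[of t] by (simp add: init)
    have "(cmod (b t + a t * cnj (p t)))\<^sup>2 \<le> 1 * (Q - (cmod (a 0))\<^sup>2)"
      unfolding distance_to_stationary using gap by (intro mult_right_mono) auto
    then show "(cmod (b t + a t * cnj (p t)))\<^sup>2 \<le> (cmod A)\<^sup>2 * e\<^sup>2 / \<rho>"
      by (simp add: init Q)
    show "AE z in circle_measure. v t z = ratf (b t + a t * cnj (p t) - a t * cnj (p t))
      (a t + (b t + a t * cnj (p t) - a t * cnj (p t)) * p t) (p t) z"
      using AE by eventually_elim (simp add: U_def)
  qed (use t cmod_p in auto)
qed

section \<open>Smoothness on the circle\<close>

text \<open>On functions of \<open>cis \<theta>\<close> this is differentiation in the angle; the
  holomorphic form can be iterated on a neighbourhood of the circle.\<close>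

definition angular_op :: "(complex \<Rightarrow> complex) \<Rightarrow> complex \<Rightarrow> complex" where
  "angular_op F = (\<lambda>z. \<i> * z * deriv F z)"

lemma angular_op_holomorphic:
  assumes "open S" "F holomorphic_on S"
  shows "(angular_op ^^ n) F holomorphic_on S"
  by (induction n) (auto simp: angular_op_def intro!: holomorphic_intros assms holomorphic_deriv)

lemma has_vector_derivative_cis_compose:
  assumes S: "open S" "sphere 0 1 \<subseteq> S" "F holomorphic_on S"
  shows "((\<lambda>\<theta>. F (cis \<theta>)) has_vector_derivative angular_op F (cis \<theta>)) (at \<theta>)"
proof -
  have "cis \<theta> \<in> S" using S(2) by (auto simp: dist_norm)
  then have F: "(F has_field_derivative deriv F (cis \<theta>)) (at (exp (\<i> * of_real \<theta>)))"
    using holomorphic_derivI[OF S(3,1)] by (simp add: cis_conv_exp)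
  have "((\<lambda>z. exp (\<i> * z)) has_field_derivative (\<i> * cis \<theta>)) (at (of_real \<theta>))"
    by (auto intro!: derivative_eq_intros simp: cis_conv_exp)
  from DERIV_chain2[OF F this]
  have "((\<lambda>z. F (exp (\<i> * z))) has_field_derivative angular_op F (cis \<theta>)) (at (of_real \<theta>))"
    by (simp add: angular_op_def mult_ac)
  from has_vector_derivative_real_field[OF this] show ?thesis by (simp add: cis_conv_exp)
qed

lemma angular_deriv_holomorphic:
  assumes S: "open S" "sphere 0 1 \<subseteq> S" "F holomorphic_on S"
    and f: "\<And>z. cmod z = 1 \<Longrightarrow> f z = F z"
  shows "angular_deriv n f = (\<lambda>\<theta>. (angular_op ^^ n) F (cis \<theta>))"
proof (induction n)
  case 0
  then show ?case using f by (auto simp: angular_deriv_def)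
next
  case (Suc n)
  have "angular_deriv (Suc n) f = (\<lambda>\<theta>. vector_derivative (angular_deriv n f) (at \<theta>))"
    by (simp add: angular_deriv_def)
  also have "\<dots> = (\<lambda>\<theta>. (angular_op ^^ Suc n) F (cis \<theta>))"
    unfolding Suc
    using has_vector_derivative_cis_compose[OF S(1,2) angular_op_holomorphic[OF S(1,3)]]
    by (intro ext vector_derivative_at) simp
  finally show ?case .
qed

lemma smooth_on_circle_holomorphic:
  assumes S: "open S" "sphere 0 1 \<subseteq> S" "F holomorphic_on S"
    and f: "\<And>z. cmod z = 1 \<Longrightarrow> f z = F z"
  shows "smooth_on_circle f"
proof -
  have "angular_deriv n f = (\<lambda>\<theta>. (angular_op ^^ n) F (cis \<theta>))" for n
    by (rule angular_deriv_holomorphic[OF S]) (rule f)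
  then show ?thesis
    unfolding smooth_on_circle_def
    using differentiableI_vector[OF has_vector_derivative_cis_compose[OF S(1,2) angular_op_holomorphic[OF S(1,3)]]]
    by simp
qed

lemma angular_deriv_bounded:
  assumes S: "open S" "sphere 0 1 \<subseteq> S" "F holomorphic_on S"
    and f: "\<And>z. cmod z = 1 \<Longrightarrow> f z = F z"
  shows "\<exists>K. \<forall>\<theta>. cmod (angular_deriv n f \<theta>) \<le> K"
proof -
  have "continuous_on (sphere 0 1) ((angular_op ^^ n) F)"
    by (rule continuous_on_subset[OF holomorphic_on_imp_continuous_on[OF angular_op_holomorphic[OF S(1,3)]] S(2)])
  then have "bounded ((angular_op ^^ n) F ` sphere 0 1)"
    by (intro compact_imp_bounded compact_continuous_image) auto
  then obtain K where "\<forall>z\<in>sphere 0 1. cmod ((angular_op ^^ n) F z) \<le> K"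
    unfolding bounded_iff by auto
  moreover have "angular_deriv n f = (\<lambda>\<theta>. (angular_op ^^ n) F (cis \<theta>))"
    by (rule angular_deriv_holomorphic[OF S]) (rule f)
  ultimately show ?thesis by (intro exI[of _ K]) auto
qed

lemma angular_deriv_add_cmult:
  assumes "smooth_on_circle f" "smooth_on_circle g"
  shows "angular_deriv n (\<lambda>z. f z + c * g z) = (\<lambda>\<theta>. angular_deriv n f \<theta> + c * angular_deriv n g \<theta>)"
proof (induction n)
  case 0
  then show ?case by (simp add: angular_deriv_def)
next
  case (Suc n)
  have d: "(angular_deriv n h has_vector_derivative angular_deriv (Suc n) h \<theta>) (at \<theta>)"
    if "smooth_on_circle h" for h \<theta>
    using that unfolding smooth_on_circle_def by (simp add: angular_deriv_def vector_derivative_works)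
  have "angular_deriv (Suc n) (\<lambda>z. f z + c * g z) =
      (\<lambda>\<theta>. vector_derivative (angular_deriv n (\<lambda>z. f z + c * g z)) (at \<theta>))"
    by (simp add: angular_deriv_def)
  also have "\<dots> = (\<lambda>\<theta>. angular_deriv (Suc n) f \<theta> + c * angular_deriv (Suc n) g \<theta>)"
    unfolding Suc
    by (intro ext vector_derivative_at has_vector_derivative_add has_vector_derivative_mult_right d assms)
  finally show ?case .
qed

text \<open>The family is affine in its parameter, so convergence in every derivative amounts to
  boundedness of each angular derivative of \<open>g\<close>.\<close>

lemma tendsto_smooth_add_cmult:
  fixes f g :: "complex \<Rightarrow> complex"
  assumes f: "smooth_on_circle f" and g: "smooth_on_circle g"
    and bd: "\<And>n. \<exists>K. \<forall>\<theta>. cmod (angular_deriv n g \<theta>) \<le> K"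
  shows "tendsto_smooth (\<lambda>x z. f z + of_real x * g z) f (at_right 0)"
  unfolding tendsto_smooth_def
proof (intro conjI allI f)
  have "smooth_on_circle (\<lambda>z. f z + of_real x * g z)" for x
    unfolding smooth_on_circle_def angular_deriv_add_cmult[OF f g]
    using f g unfolding smooth_on_circle_def
    by (auto intro!: differentiable_add differentiable_mult differentiable_const)
  then show "\<forall>\<^sub>F x in at_right 0. smooth_on_circle (\<lambda>z. f z + of_real x * g z)" by simp
  fix n
  obtain K where K: "\<And>\<theta>. cmod (angular_deriv n g \<theta>) \<le> K" using bd by blast
  show "uniform_limit UNIV (\<lambda>x. angular_deriv n (\<lambda>z. f z + of_real x * g z)) (angular_deriv n f) (at_right 0)"
  proof (rule uniform_limitI)
    fix e :: real assume e: "0 < e"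
    have "((\<lambda>x. \<bar>x\<bar> * K) \<longlongrightarrow> \<bar>0\<bar> * K) (at_right 0)" by (intro tendsto_intros)
    then have "\<forall>\<^sub>F x in at_right 0. \<bar>x\<bar> * K < e" using e by (intro order_tendstoD(2)) auto
    then show "\<forall>\<^sub>F x in at_right 0. \<forall>\<theta>\<in>UNIV. dist (angular_deriv n (\<lambda>z. f z + of_real x * g z) \<theta>) (angular_deriv n f \<theta>) < e"
    proof eventually_elim
      case (elim x)
      have "\<bar>x\<bar> * cmod (angular_deriv n g \<theta>) < e" for \<theta>
        using mult_left_mono[OF K[of \<theta>], of "\<bar>x\<bar>"] elim by simp
      then show ?case by (simp add: angular_deriv_add_cmult[OF f g] dist_norm norm_mult)
    qed
  qed
qed

lemma wave_holomorphic:
  assumes "cmod p < 1"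
  shows "open {z. 1 - p * z \<noteq> 0}" "sphere 0 1 \<subseteq> {z. 1 - p * z \<noteq> 0}"
    "(\<lambda>z. (a * z + b) / (1 - p * z)) holomorphic_on {z. 1 - p * z \<noteq> 0}"
proof -
  show "open {z. 1 - p * z \<noteq> 0}"
    by (intro open_Collect_neq continuous_intros)
  show "sphere 0 1 \<subseteq> {z. 1 - p * z \<noteq> 0}"
    using one_minus_mult_nz[OF assms] by auto
  show "(\<lambda>z. (a * z + b) / (1 - p * z)) holomorphic_on {z. 1 - p * z \<noteq> 0}"
    by (intro holomorphic_intros) auto
qed

section \<open>Limit points\<close>

lemma blaschke_ratf:
  assumes "cmod q < 1" "cmod z = 1"
  shows "wave \<alpha> (- \<alpha> * cnj q) q z = \<alpha> * ((z - cnj q) / (1 - q * z))"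
  unfolding ratf_wave[OF assms] by (simp add: algebra_simps)

lemma blaschke_cmod:
  assumes "cmod q < 1" "cmod z = 1"
  shows "cmod (\<alpha> * ((z - cnj q) / (1 - q * z))) = cmod \<alpha>"
proof -
  have zz: "z * cnj z = 1" using assms(2) by (simp add: complex_norm_square[symmetric])
  have "z - cnj q = z * cnj (1 - q * z)"
    using zz by (simp add: algebra_simps)
  then have "cmod (z - cnj q) = cmod (1 - q * z)"
    using assms(2) by (simp only: norm_mult complex_mod_cnj mult_1)
  then show ?thesis
    using one_minus_mult_nz[OF assms] by (simp add: norm_mult norm_divide)
qed

text \<open>The pairs (alpha, q) range over a compact product of circles, and \<open>r < 1\<close>
  keeps the poles away from the unit circle, so convergence of parameters implies convergence in
  \<open>Hhalf_norm\<close>.\<close>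

lemma near_stationary_subsequence:
  fixes W :: "nat \<Rightarrow> complex \<Rightarrow> complex"
  assumes W: "\<And>n. W n \<in> plus_part Hhalf" and r: "r < 1"
    and form: "\<And>n. cmod (\<alpha> n) = A \<and> cmod (q n) = r \<and>
       (AE z in circle_measure. W n z = wave (\<alpha> n) (\<beta> n - \<alpha> n * cnj (q n)) (q n) z)"
    and \<beta>: "\<beta> \<longlonglongrightarrow> 0"
  obtains \<sigma> \<alpha>' q' where "strict_mono (\<sigma> :: nat \<Rightarrow> nat)" "cmod \<alpha>' = A" "cmod q' = r"
    "(\<lambda>n. Hhalf_norm (\<lambda>z. W (\<sigma> n) z - wave \<alpha>' (- \<alpha>' * cnj q') q' z)) \<longlonglongrightarrow> 0"
proof -
  have q1: "cmod (q n) < 1" for n using form r by simp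
  have sc: "seq_compact (sphere (0::complex) A \<times> sphere (0::complex) r)"
    by (intro compact_imp_seq_compact compact_Times compact_sphere)
  have "\<forall>n. (\<alpha> n, q n) \<in> sphere 0 A \<times> sphere 0 r" using form by auto
  then obtain l \<sigma> where l: "l \<in> sphere 0 A \<times> sphere 0 r" and \<sigma>: "strict_mono (\<sigma> :: nat \<Rightarrow> nat)"
    and lim: "((\<lambda>n. (\<alpha> n, q n)) \<circ> \<sigma>) \<longlonglongrightarrow> l"
    by (rule seq_compactE[OF sc]) blast
  obtain \<alpha>' q' where lq: "l = (\<alpha>', q')" by fastforce
  have \<alpha>': "(\<lambda>n. \<alpha> (\<sigma> n)) \<longlonglongrightarrow> \<alpha>'" and q': "(\<lambda>n. q (\<sigma> n)) \<longlonglongrightarrow> q'"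
    using tendsto_fst[OF lim] tendsto_snd[OF lim] by (simp_all add: lq o_def)
  have \<beta>': "(\<lambda>n. \<beta> (\<sigma> n)) \<longlonglongrightarrow> 0"
    using LIMSEQ_subseq_LIMSEQ[OF \<beta> \<sigma>] by (simp add: o_def)
  have nrm: "cmod \<alpha>' = A" "cmod q' = r" using l lq by auto
  let ?R = "\<lambda>n. wave (\<alpha> n) (\<beta> n - \<alpha> n * cnj (q n)) (q n)"
  let ?V = "wave \<alpha>' (- \<alpha>' * cnj q') q'"
  have "(\<lambda>n. \<beta> (\<sigma> n) - \<alpha> (\<sigma> n) * cnj (q (\<sigma> n))) \<longlonglongrightarrow> 0 - \<alpha>' * cnj q'"
    by (intro tendsto_intros \<alpha>' q' \<beta>')
  then have 1: "(\<lambda>n. \<beta> (\<sigma> n) - \<alpha> (\<sigma> n) * cnj (q (\<sigma> n))) \<longlonglongrightarrow> - \<alpha>' * cnj q'" by simp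
  have 2: "(\<lambda>n. \<alpha> (\<sigma> n) + (\<beta> (\<sigma> n) - \<alpha> (\<sigma> n) * cnj (q (\<sigma> n))) * q (\<sigma> n)) \<longlonglongrightarrow> \<alpha>' + (- \<alpha>' * cnj q') * q'"
    by (intro tendsto_add tendsto_mult \<alpha>' q' 1)
  have "(\<lambda>n. Hhalf_norm (\<lambda>z. ?R (\<sigma> n) z - ?V z)) \<longlonglongrightarrow> 0"
    by (rule ratf_tendsto_Hhalf[OF 1 2 q']) (use nrm r in auto)
  moreover have "Hhalf_norm (\<lambda>z. W n z - ?V z) = Hhalf_norm (\<lambda>z. ?R n z - ?V z)" for n
  proof (rule Hhalf_norm_cong_AE)
    show "AE z in circle_measure. W n z - ?V z = ?R n z - ?V z"
      using form[of n] by (auto elim: eventually_mono)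
    have V: "?V \<in> L2" using nrm r by (intro Hhalf_plus_in_L2 ratf_Hhalf) simp
    show "(\<lambda>z. W n z - ?V z) \<in> borel_measurable circle_measure"
      by (intro L2_measurable L2_diff V Hhalf_plus_in_L2[OF W])
    show "(\<lambda>z. ?R n z - ?V z) \<in> borel_measurable circle_measure"
      by (intro L2_measurable L2_diff V Hhalf_plus_in_L2[OF ratf_Hhalf[OF q1]])
  qed
  ultimately show ?thesis
    using that[OF \<sigma> nrm] by simp
qed

text \<open>The existence claim rules out that the description of the limit points is vacuous. For
  the description, a sequence realising the limit point \<open>v\<close> has a subsequence tending
  to a stationary wave, and the two limits agree.\<close>

lemma limit_points_stationary:
  fixes w :: "real \<Rightarrow> complex \<Rightarrow> complex"
  assumes r: "r < 1"
    and form: "\<forall>\<^sub>F x in at_right 0. w x \<in> plus_part Hhalf \<and> cmod (\<alpha> x) = A \<and> cmod (q x) = r \<and> (cmod (\<beta> x))\<^sup>2 \<le> C * x\<^sup>2 \<and>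
       (AE z in circle_measure. w x z = wave (\<alpha> x) (\<beta> x - \<alpha> x * cnj (q x)) (q x) z)"
      (is "\<forall>\<^sub>F x in at_right 0. ?P x")
  shows "\<exists>v. Hhalf_limit_point w (at_right 0) v"
    and "Hhalf_limit_point w (at_right 0) v \<Longrightarrow>
      \<exists>\<alpha>' q'. cmod \<alpha>' = A \<and> cmod q' = r \<and> (AE z in circle_measure. v z = \<alpha>' * ((z - cnj q') / (1 - q' * z)))"
proof -
  have sub: "\<exists>\<sigma> \<alpha>' q'. strict_mono (\<sigma> :: nat \<Rightarrow> nat) \<and> cmod \<alpha>' = A \<and> cmod q' = r \<and>
    (\<lambda>n. Hhalf_norm (\<lambda>z. w (e (\<sigma> n)) z - wave \<alpha>' (- \<alpha>' * cnj q') q' z)) \<longlonglongrightarrow> 0"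
    if P: "\<And>n. ?P (e n)" and e: "e \<longlonglongrightarrow> 0" for e
  proof -
    have "(\<lambda>n. \<beta> (e n)) \<longlonglongrightarrow> 0"
    proof (rule Lim_null_comparison)
      show "\<forall>\<^sub>F n in sequentially. norm (\<beta> (e n)) \<le> sqrt (C * (e n)\<^sup>2)"
        using P by (auto intro!: always_eventually real_le_rsqrt)
      have "(\<lambda>n. sqrt (C * (e n)\<^sup>2)) \<longlonglongrightarrow> sqrt (C * 0\<^sup>2)" by (intro tendsto_intros e)
      then show "(\<lambda>n. sqrt (C * (e n)\<^sup>2)) \<longlonglongrightarrow> 0" by simp
    qed
    with P r show ?thesis
      by (rule_tac near_stationary_subsequence[where W = "\<lambda>n. w (e n)" and \<alpha> = "\<lambda>n. \<alpha> (e n)"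
          and q = "\<lambda>n. q (e n)" and \<beta> = "\<lambda>n. \<beta> (e n)" and A = A and r = r]) blast+
  qed
  obtain d where d: "d > 0" "\<And>x. 0 < x \<Longrightarrow> x < d \<Longrightarrow> ?P x"
    using form unfolding eventually_at_right_field by auto
  have V: "wave \<alpha>' (- \<alpha>' * cnj q') q' \<in> plus_part Hhalf" if "cmod q' = r" for \<alpha>' q'
    using that r by (intro ratf_Hhalf) simp
  show "\<exists>v. Hhalf_limit_point w (at_right 0) v"
  proof -
    define e where "e = (\<lambda>n. d / (real n + 2))"
    have e0: "e \<longlonglongrightarrow> 0" unfolding e_def by real_asymp
    have epos: "0 < e n" "e n < d" for n
      using d(1) by (auto simp: e_def field_simps add_pos_nonneg)
    obtain \<sigma> \<alpha>' q' where \<sigma>: "strict_mono \<sigma>" and c: "cmod \<alpha>' = A" "cmod q' = r" and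
      lim: "(\<lambda>n. Hhalf_norm (\<lambda>z. w (e (\<sigma> n)) z - wave \<alpha>' (- \<alpha>' * cnj q') q' z)) \<longlonglongrightarrow> 0"
      using sub[OF d(2)[OF epos] e0] by blast
    have flt: "filterlim (\<lambda>n. e (\<sigma> n)) (at_right 0) sequentially"
      using LIMSEQ_subseq_LIMSEQ[OF e0 \<sigma>] epos less_imp_neq[OF epos(1), symmetric]
      by (auto simp: filterlim_at o_def intro!: always_eventually)
    show ?thesis
      unfolding Hhalf_limit_point_def
    proof (intro exI conjI allI impI)
      let ?N = "\<lambda>x. Hhalf_norm (\<lambda>z. w x z - wave \<alpha>' (- \<alpha>' * cnj q') q' z)"
      fix \<delta> :: real assume \<delta>: "\<delta> > 0"
      show "\<exists>\<^sub>F x in at_right 0. ?N x < \<delta>"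
        unfolding frequently_def
      proof
        assume "\<forall>\<^sub>F x in at_right 0. \<not> ?N x < \<delta>"
        from eventually_compose_filterlim[OF this flt] order_tendstoD(2)[OF lim \<delta>]
        have "\<forall>\<^sub>F n in sequentially. False" by eventually_elim simp
        then show False by simp
      qed
    qed (rule V[OF c(2)])
  qed
  assume v: "Hhalf_limit_point w (at_right 0) v"
  have vH: "v \<in> plus_part Hhalf" using v by (simp add: Hhalf_limit_point_def)
  \<comment> \<open>A limit point of a filter is turned into a limit of a sequence: parameters below
    1 / (n + 1) at distance below 1 / (n + 1) from \<open>v\<close>.\<close>
  have "\<exists>x. 0 < x \<and> x < min d (1 / (real n + 1)) \<and> Hhalf_norm (\<lambda>z. w x z - v z) < 1 / (real n + 1)" for n
  proof -
    have "\<exists>\<^sub>F x in at_right 0. Hhalf_norm (\<lambda>z. w x z - v z) < 1 / (real n + 1)"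
      using v unfolding Hhalf_limit_point_def by simp
    moreover have "\<forall>\<^sub>F x in at_right 0. 0 < x \<and> x < min d (1 / (real n + 1))"
      unfolding eventually_at_right_field using d(1) by (intro exI[of _ "min d (1 / (real n + 1))"]) auto
    ultimately have "\<exists>\<^sub>F x in at_right 0. Hhalf_norm (\<lambda>z. w x z - v z) < 1 / (real n + 1) \<and> (0 < x \<and> x < min d (1 / (real n + 1)))"
      by (rule frequently_eventually_frequently)
    then show ?thesis by (auto dest!: frequently_ex)
  qed
  then obtain e where e: "\<And>n. 0 < e n" "\<And>n. e n < min d (1 / (real n + 1))"
      "\<And>n. Hhalf_norm (\<lambda>z. w (e n) z - v z) < 1 / (real n + 1)"
    by metis
  have one: "(\<lambda>n. 1 / (real n + 1)) \<longlonglongrightarrow> 0" by real_asymp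
  have e0: "e \<longlonglongrightarrow> 0"
    by (rule tendsto_sandwich[OF _ _ tendsto_const one]) (use e(1,2) in \<open>auto intro!: always_eventually less_imp_le\<close>)
  have P: "?P (e n)" for n using d(2)[of "e n"] e(1,2)[of n] by simp
  obtain \<sigma> \<alpha>' q' where \<sigma>: "strict_mono \<sigma>" and c: "cmod \<alpha>' = A" "cmod q' = r" and
    lim: "(\<lambda>n. Hhalf_norm (\<lambda>z. w (e (\<sigma> n)) z - wave \<alpha>' (- \<alpha>' * cnj q') q' z)) \<longlonglongrightarrow> 0"
    using sub[OF P e0] by blast
  let ?V = "wave \<alpha>' (- \<alpha>' * cnj q') q'"
  have wH: "w (e n) \<in> plus_part Hhalf" for n using P by simp
  have lim2: "(\<lambda>n. Hhalf_norm (\<lambda>z. w (e (\<sigma> n)) z - v z)) \<longlonglongrightarrow> 0"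
  proof -
    have "(\<lambda>n. Hhalf_norm (\<lambda>z. w (e n) z - v z)) \<longlonglongrightarrow> 0"
      by (rule tendsto_sandwich[OF _ _ tendsto_const one]) (use e(3) in \<open>auto intro!: always_eventually less_imp_le\<close>)
    from LIMSEQ_subseq_LIMSEQ[OF this \<sigma>] show ?thesis by (simp add: o_def)
  qed
  have fl: "(\<lambda>n. fourier (w (e (\<sigma> n))) (int k)) \<longlonglongrightarrow> fourier g (int k)"
    if g: "g \<in> plus_part Hhalf" and lim: "(\<lambda>n. Hhalf_norm (\<lambda>z. w (e (\<sigma> n)) z - g z)) \<longlonglongrightarrow> 0" for g k
  proof (rule LIM_zero_cancel, rule Lim_null_comparison[OF _ lim])
    have "norm (fourier (w (e (\<sigma> n))) (int k) - fourier g (int k)) \<le> Hhalf_norm (\<lambda>z. w (e (\<sigma> n)) z - g z)" for n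
      using cmod_fourier_le_Hhalf[OF plus_part_Hhalf_diff(1)[OF wH[of "\<sigma> n"] g], of k]
      by (simp add: fourier_diff Hhalf_plus_in_L2[OF wH] Hhalf_plus_in_L2[OF g])
    then show "\<forall>\<^sub>F n in sequentially. norm (fourier (w (e (\<sigma> n))) (int k) - fourier g (int k)) \<le> Hhalf_norm (\<lambda>z. w (e (\<sigma> n)) z - g z)"
      by simp
  qed
  \<comment> \<open>Both limits are compared coefficientwise, and completeness then identifies them
    almost everywhere.\<close>
  have "fourier v (int k) = fourier ?V (int k)" for k
    using fl[OF vH lim2] fl[OF V[OF c(2)] lim] by (rule LIMSEQ_unique)
  then have "AE z in circle_measure. v z = ?V z"
    by (intro fourier_unique Hhalf_plus_L2 vH V[OF c(2)])
  moreover have "AE z in circle_measure. ?V z = \<alpha>' * ((z - cnj q') / (1 - q' * z))"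
    using c r by (intro AE_I2 blaschke_ratf) auto
  ultimately have "AE z in circle_measure. v z = \<alpha>' * ((z - cnj q') / (1 - q' * z))"
    by eventually_elim simp
  then show "\<exists>\<alpha>' q'. cmod \<alpha>' = A \<and> cmod q' = r \<and> (AE z in circle_measure. v z = \<alpha>' * ((z - cnj q') / (1 - q' * z)))"
    using c by blast
qed

lemma M1_tilde_stationary_form:
  assumes "u0 \<in> M1_tilde" "stationary_wave u0"
  obtains a p where "a \<noteq> 0" "cmod p < 1" "\<And>z. cmod z = 1 \<Longrightarrow> u0 z = a * ((z - cnj p) / (1 - p * z))"
proof -
  obtain a b p where *: "a \<noteq> 0" "cmod p < 1" "a + b * p \<noteq> 0"
    "\<And>z. cmod z = 1 \<Longrightarrow> u0 z = (a * z + b) / (1 - p * z)"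
    using assms(1) by (auto simp: M1_tilde_def)
  have "u0 z = ratf b (a + b * p) p z" if "cmod z = 1" for z
    using *(4) ratf_wave[OF *(2)] that by simp
  from stationary_wave_ratf[OF assms(2) this *(2,3)]
  have "cnj b * (1 - p * cnj p) + cnj (a + b * p) * p = 0" by simp
  then have "cnj (cnj b * (1 - p * cnj p) + cnj (a + b * p) * p) = 0" by simp
  \<comment> \<open>With B = a + b p the terms in |p|^2 cancel.\<close>
  then have "b = - a * cnj p" by (simp add: algebra_simps add_eq_0_iff)
  then show ?thesis
    using that[of a p] * by (simp add: algebra_simps)
qed

theorem corollary6:
  fixes u0 :: "complex \<Rightarrow> complex"
  assumes "u0 \<in> M1_tilde" and "stationary_wave u0"
  shows "\<exists>\<epsilon>0>0. \<exists>u0e :: real \<Rightarrow> complex \<Rightarrow> complex.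
    tendsto_smooth u0e u0 (at_right 0) \<and>
    (\<forall>\<epsilon> \<in> {0<..<\<epsilon>0}. u0e \<epsilon> \<in> plus_part Hhalf \<and> (\<exists>u. szego_solution (u0e \<epsilon>) u)) \<and>
    (\<forall>u. (\<forall>\<epsilon> \<in> {0<..<\<epsilon>0}. szego_solution (u0e \<epsilon>) (u \<epsilon>)) \<longrightarrow>
      (\<forall>r \<in> {0<..<1::real}. \<exists>t :: real \<Rightarrow> real.
        (\<exists>v. Hhalf_limit_point (\<lambda>\<epsilon>. u \<epsilon> (t \<epsilon>)) (at_right 0) v) \<and>
        (\<forall>v. Hhalf_limit_point (\<lambda>\<epsilon>. u \<epsilon> (t \<epsilon>)) (at_right 0) v \<longrightarrow>
          (\<exists>\<alpha> q. cmod \<alpha> = L2_norm u0 \<and> cmod q = r \<and>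
            (AE z in circle_measure. v z = \<alpha> * ((z - cnj q) / (1 - q * z)))))))"
proof -
  obtain A p where A: "A \<noteq> 0" and p: "cmod p < 1"
    and u0: "\<And>z. cmod z = 1 \<Longrightarrow> u0 z = A * ((z - cnj p) / (1 - p * z))"
    using M1_tilde_stationary_form[OF assms] by blast
  have L2u0: "L2_norm u0 = cmod A"
  proof -
    have "cmod (u0 z) = cmod A" if "cmod z = 1" for z
      unfolding u0[OF that] by (rule blaschke_cmod[OF p that])
    then have "L2_norm u0 = sqrt (LINT z|circle_measure. (cmod A)\<^sup>2)"
      unfolding L2_norm_def
      by (intro arg_cong[where f = sqrt] Bochner_Integration.integral_cong) auto
    then show ?thesis by simp
  qed
  define s where "s = cmod p"
  \<comment> \<open>For \<open>p = 0\<close> the direction is undetermined and any unit number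
    serves.\<close>
  define c where "c = (if p = 0 then 1 else sgn p)"
  have c: "cmod c = 1" by (simp add: c_def norm_sgn)
  have sc: "of_real s * c = p" by (simp add: s_def c_def sgn_div_norm scaleR_conv_of_real)
  have s: "0 \<le> s" "s < 1" using p by (simp_all add: s_def)
  define g where "g = - (A * \<i> * cnj c)"
  define G where "G = (\<lambda>z. (0 * z + g) / (1 - p * z))"
  define u0e where "u0e = (\<lambda>e z. u0 z + of_real e * G z)"
  define \<rho> where "\<rho> = 1 - s\<^sup>2"
  have \<rho>: "\<rho> > 0" unfolding \<rho>_def using s by (simp add: abs_square_less_1)
  define k where "k = (\<lambda>e. sqrt (1 / \<rho> + e\<^sup>2 / (4 * \<rho>^4)))"
  note hol = wave_holomorphic[OF p]
  have u0': "u0 z = (A * z + - A * cnj p) / (1 - p * z)" if "cmod z = 1" for z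
    using that by (simp add: u0 algebra_simps)
  have smooth: "tendsto_smooth u0e u0 (at_right 0)"
    unfolding u0e_def
  proof (rule tendsto_smooth_add_cmult)
    show "smooth_on_circle u0" using u0' by (rule smooth_on_circle_holomorphic[OF hol])
    show "smooth_on_circle G" unfolding G_def by (rule smooth_on_circle_holomorphic[OF hol refl])
    show "\<exists>K. \<forall>\<theta>. cmod (angular_deriv n G \<theta>) \<le> K" for n
      unfolding G_def by (rule angular_deriv_bounded[OF hol refl])
  qed
  have ue: "u0e e z = (A * z - A * cnj c * (of_real s + \<i> * of_real e)) / (1 - of_real s * c * z)" if "cmod z = 1" for e z
  proof -
    have "cnj p = of_real s * cnj c" unfolding sc[symmetric] by simp
    then show ?thesis
      unfolding sc by (simp add: u0e_def G_def g_def u0'[OF that] add_divide_distrib[symmetric] algebra_simps)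
  qed
  have sol: "\<exists>u. szego_solution (u0e e) u" if "e > 0" for e
    using perturbed_solution(1)[OF A c s that ue] .
  have Hh: "u0e e \<in> plus_part Hhalf" for e
  proof -
    define b where "b = - A * cnj c * (of_real s + \<i> * of_real e)"
    have eq: "u0e e z = wave A b p z" if "cmod z = 1" for z
      unfolding ratf_wave[OF p that] ue[OF that] sc by (simp add: b_def)
    have f: "fourier (u0e e) k = fourier (wave A b p) k" for k
      by (rule fourier_cong) (rule eq)
    have "u0e e \<in> L2"
      by (rule L2I_continuous, rule continuous_on_eq[OF continuous_ratf[OF p]]) (simp add: eq)
    then show ?thesis
      using ratf_Hhalf[OF p, of b "A + b * p"] f by (simp add: plus_part_def Hhalf_def)
  qed
  show ?thesis
  \<comment> \<open>The construction works for every positive parameter, so the threshold 1 is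
    arbitrary.\<close>
  proof (rule exI[of _ "1::real"], intro conjI zero_less_one, rule exI[of _ u0e],
      intro conjI allI impI ballI smooth Hh sol)
    fix u :: "real \<Rightarrow> real \<Rightarrow> complex \<Rightarrow> complex" and r :: real
    assume u: "\<forall>e\<in>{0<..<1}. szego_solution (u0e e) (u e)" and r: "r \<in> {0<..<1}"
    define C where "C = (cmod A)\<^sup>2 / \<rho>"
    \<comment> \<open>The small half-axis tends to 0, so it falls below \<open>r\<close>.\<close>
    have "\<forall>\<^sub>F e in at_right 0. e * s / (2 * \<rho>\<^sup>2 * k e) < r"
    proof (rule order_tendstoD(2))
      have "((\<lambda>e. e * s / (2 * \<rho>\<^sup>2 * k e)) \<longlongrightarrow> 0 * s / (2 * \<rho>\<^sup>2 * k 0)) (at_right 0)"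
        unfolding k_def by (intro tendsto_intros) (use \<rho> in auto)
      then show "((\<lambda>e. e * s / (2 * \<rho>\<^sup>2 * k e)) \<longlongrightarrow> 0) (at_right 0)" by simp
    qed (use r in auto)
    moreover have "\<forall>\<^sub>F e in at_right 0. r\<^sup>2 < s\<^sup>2 + (1 / k e)\<^sup>2"
    proof (rule order_tendstoD(1))
      have "((\<lambda>e. s\<^sup>2 + (1 / k e)\<^sup>2) \<longlongrightarrow> s\<^sup>2 + (1 / k 0)\<^sup>2) (at_right 0)"
        unfolding k_def by (intro tendsto_intros) (use \<rho> in auto)
      \<comment> \<open>At \<open>e = 0\<close> the squared other half-axis is
        \<open>\<rho>\<close>, and \<open>s\<^sup>2 + \<rho> = 1\<close>: the largest radius tends
        to 1, hence exceeds \<open>r\<close>.\<close>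
      moreover have "s\<^sup>2 + (1 / k 0)\<^sup>2 = 1"
        using \<rho> by (simp add: k_def power_divide) (simp add: \<rho>_def)
      ultimately show "((\<lambda>e. s\<^sup>2 + (1 / k e)\<^sup>2) \<longlongrightarrow> 1) (at_right 0)" by simp
    qed (use r in \<open>auto simp: abs_square_less_1\<close>)
    moreover have "\<forall>\<^sub>F e in at_right 0. e \<in> {0<..<1::real}"
      unfolding eventually_at_right_field by (intro exI[of _ 1]) auto
    ultimately have "\<forall>\<^sub>F e in at_right 0. \<exists>t \<alpha> q \<beta>. u e t \<in> plus_part Hhalf \<and> cmod \<alpha> = cmod A \<and> cmod q = r \<and> (cmod \<beta>)\<^sup>2 \<le> C * e\<^sup>2 \<and>
       (AE z in circle_measure. u e t z = wave \<alpha> (\<beta> - \<alpha> * cnj q) q z)"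
    proof eventually_elim
      case (elim e)
      then have e: "0 < e" and v: "szego_solution (u0e e) (u e)" using u by auto
      from perturbed_solution(2)[OF A c s e ue v elim(1)[unfolded k_def \<rho>_def] elim(2)[unfolded k_def \<rho>_def]]
      show ?case
        using szego_solutionD(1)[OF v] unfolding C_def \<rho>_def times_divide_eq_left by blast
    qed
    \<comment> \<open>Choice over the parameter: the time may depend on \<open>e\<close>, on
      \<open>r\<close> and on the given family of solutions.\<close>
    then obtain t \<alpha> q \<beta> where ev: "\<forall>\<^sub>F e in at_right 0. u e (t e) \<in> plus_part Hhalf \<and> cmod (\<alpha> e) = cmod A \<and> cmod (q e) = r \<and> (cmod (\<beta> e))\<^sup>2 \<le> C * e\<^sup>2 \<and>
       (AE z in circle_measure. u e (t e) z = wave (\<alpha> e) (\<beta> e - \<alpha> e * cnj (q e)) (q e) z)"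
      unfolding eventually_ex by blast
    have r1: "r < 1" using r by simp
    show "\<exists>t. (\<exists>v. Hhalf_limit_point (\<lambda>e. u e (t e)) (at_right 0) v) \<and>
        (\<forall>v. Hhalf_limit_point (\<lambda>e. u e (t e)) (at_right 0) v \<longrightarrow>
          (\<exists>\<alpha> q. cmod \<alpha> = L2_norm u0 \<and> cmod q = r \<and>
            (AE z in circle_measure. v z = \<alpha> * ((z - cnj q) / (1 - q * z)))))"
      unfolding L2u0
      using limit_points_stationary[OF r1 ev] by (intro exI[of _ t]) blast
  qed auto
qed

end
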